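(* Let $R$ be an indecomposable commutative ring and let $(\Sigma,i,q)$ be a discrete $R$-twist over an ample Hausdorff groupoid $G$. Let $A=A_R(G;\Sigma)$ and let $B=A_R(G^{(0)};q^{-1}(G^{(0)}))\subseteq A$. Then: - $I(B)$ is a set of local units for $A$; $B=\operatorname{span}_R I(B)$; $A=\operatorname{span}_R N(B)$; and the map $P\colon A\to B$ given by restriction of functions from $\Sigma$ to $q^{-1}(G^{(0)})$ is a faithful conditional expectation. - If $(A,B)$ is an algebraic quasi-Cartan pair, then $P$ is implemented by idempotents. - The pair $(A,B)$ is an algebraic quasi-Cartan pair if and only if $(\Sigma,i,q)$ satisfies the local bisection hypothesis.
   Context: **Rings and groupoids.** A commutative ring $R$ with identity is indecomposable if its only idempotents are $0$ and $1$. $R^\times$ is its group of units, with the discrete topology. Groupoids are locally compact topological groupoids with Hausdorff unit space $G^{(0)}$ and range/source maps $r,s$. A bisection is a subset $D$ contained in an open set $O$ such that $r|_O,s|_O$ are homeomorphisms onto open subsets of $G^{(0)}$. $G$ is étale if $r$ is a local homeomorphism, and ample if it is étale with a basis of compact open bisections. **Twists.** A discrete $R$-twist $(\Sigma,i,q)$ over an étale groupoid $G$ is a sequence $G^{(0)}\times R^\times\xrightarrow{i}\Sigma\xrightarrow{q}G$, where $G^{(0)}\times R^\times$ is the trivial group bundle, $\Sigma$ is a topological groupoid with $\Sigma^{(0)}=i(G^{(0)}\times\{1\})$ (identified with $G^{(0)}$), and $i,q$ are continuous groupoid homomorphisms restricting to homeomorphisms of unit spaces, such that: (DT1) $i(\{x\}\times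 R^\times)=q^{-1}(x)$ for $x\in G^{(0)}$, $i$ injective, $q$ surjective; (DT2) each $\alpha\in G$ has an open bisection $B_\alpha\ni\alpha$ and a continuous $P_\alpha\colon B_\alpha\to\Sigma$ with $q\circ P_\alpha=\mathrm{id}$ and $(\beta,t)\mapsto i(r(\beta),t)P_\alpha(\beta)$ a homeomorphism $B_\alpha\times R^\times\to q^{-1}(B_\alpha)$; (DT3) $i(r(\sigma),t)\sigma=\sigma i(s(\sigma),t)$. Write $t\cdot\sigma=i(r(\sigma),t)\sigma$. **Twisted Steinberg algebra.** $\operatorname{supp}(f)=\{f\neq0\}$, $\operatorname{supp}_G(f)=q(\operatorname{supp}(f))$. $A_R(G;\Sigma)$ is the set of locally constant $f\colon\Sigma\to R$ with $f(t\cdot\sigma)=t^{-1}f(\sigma)$ for $t\in R^\times$ and $q(\operatorname{supp}(f))$ compact; it is an $R$-algebra under pointwise operations and $(f*g)(\sigma)=\sum_{\alpha\in r^{-1}(r(\sigma))\cap\operatorname{supp}_G(f)}f(S(\alpha))g(S(\alpha)^{-1}\sigma)$, with $S\colon\operatorname{supp}_G(f)\to\operatorname{supp}(f)$ any section for $q$. $A_R(G^{(0)};q^{-1}(G^{(0)}))$ is viewed as the commutative subalgebra of those $f$ supported in $q^{-1}(G^{(0)})$ (functions on $q^{-1}(G^{(0)})$ extended by zero). **Normalisers and pairs.** $I(B)$ is the set of idempotents of $B$, called a set of local units for $A$ if every finite $\{a_1,\dots,a_n\}\subseteq A$ admits $e\in I(B)$ with $ea_i=a_i=a_ie$ for all $i$.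 $N(B)=\{n\in A:\exists k\in A,\ knk=k,\ nkn=n,\ kBn\cup nBk\subseteq B\}$ (its elements are the normalisers of $B$ in $A$). A conditional expectation $P\colon A\to B$ is an $R$-linear map with $P|_B=\mathrm{id}_B$ and $P(bab')=bP(a)b'$; it is faithful if for each $a\neq0$ in $A$ there is $n\in N(B)$ with $P(na)\neq0$, and implemented by idempotents if for each $n\in N(B)$ there is $e\in I(B)$ with $P(n)=ne=en$. $(A,B)$ is an algebraic quasi-Cartan pair if $B$ is commutative; $te=0$ with $t\in R$, $e\in I(B)\setminus\{0\}$ implies $t=0$; $I(B)$ is a set of local units for $A$; $B=\operatorname{span}_RI(B)$; $A=\operatorname{span}_RN(B)$; and there is a faithful conditional expectation $A\to B$ implemented by idempotents. The twist satisfies the local bisection hypothesis if $\operatorname{supp}_G(n)$ is a bisection of $G$ for every normaliser $n$ of $A_R(G^{(0)};q^{-1}(G^{(0)}))$ in $A_R(G;\Sigma)$. *)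

theory Defs
  imports "HOL-Analysis.Analysis" "HOL-Library.Function_Algebras"
begin

section \<open>Topological groupoids\<close>

text \<open>The set of arrows of a groupoid is the underlying set of its topology; the operations are
  only meaningful on arrows, and the product only on composable pairs.\<close>

record 'g groupoid =
  gtop :: "'g topology"
  rng :: "'g \<Rightarrow> 'g"
  src :: "'g \<Rightarrow> 'g"
  gcomp :: "'g \<Rightarrow> 'g \<Rightarrow> 'g"
  ginv :: "'g \<Rightarrow> 'g"

definition arrows :: "'g groupoid \<Rightarrow> 'g set" where
  "arrows G = topspace (gtop G)"

definition units :: "'g groupoid \<Rightarrow> 'g set" where
  "units G = rng G ` arrows G"

definition composable :: "'g groupoid \<Rightarrow> ('g \<times> 'g) set" where
  "composable G = {(x, y). x \<in> arrows G \<and> y \<in> arrows G \<and> src G x = rng G y}"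

definition unit_top :: "'g groupoid \<Rightarrow> 'g topology" where
  "unit_top G = subtopology (gtop G) (units G)"

locale groupoid =
  fixes G :: "'g groupoid"
  assumes rng_closed: "x \<in> arrows G \<Longrightarrow> rng G x \<in> arrows G"
    and src_closed: "x \<in> arrows G \<Longrightarrow> src G x \<in> arrows G"
    and inv_closed: "x \<in> arrows G \<Longrightarrow> ginv G x \<in> arrows G"
    and comp_closed: "(x, y) \<in> composable G \<Longrightarrow> gcomp G x y \<in> arrows G"
    and rng_rng: "x \<in> arrows G \<Longrightarrow> rng G (rng G x) = rng G x"
    and src_rng: "x \<in> arrows G \<Longrightarrow> src G (rng G x) = rng G x"
    and rng_src: "x \<in> arrows G \<Longrightarrow> rng G (src G x) = src G x"
    and src_src: "x \<in> arrows G \<Longrightarrow> src G (src G x) = src G x"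
    and rng_comp: "(x, y) \<in> composable G \<Longrightarrow> rng G (gcomp G x y) = rng G x"
    and src_comp: "(x, y) \<in> composable G \<Longrightarrow> src G (gcomp G x y) = src G y"
    and comp_assoc: "(x, y) \<in> composable G \<Longrightarrow> (y, z) \<in> composable G
          \<Longrightarrow> gcomp G (gcomp G x y) z = gcomp G x (gcomp G y z)"
    and comp_rng: "x \<in> arrows G \<Longrightarrow> gcomp G (rng G x) x = x"
    and comp_src: "x \<in> arrows G \<Longrightarrow> gcomp G x (src G x) = x"
    and rng_inv: "x \<in> arrows G \<Longrightarrow> rng G (ginv G x) = src G x"
    and src_inv: "x \<in> arrows G \<Longrightarrow> src G (ginv G x) = rng G x"
    and inv_comp: "x \<in> arrows G \<Longrightarrow> gcomp G (ginv G x) x = src G x"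
    and comp_inv: "x \<in> arrows G \<Longrightarrow> gcomp G x (ginv G x) = rng G x"

text \<open>Continuity of the range and source maps is automatic from the two axioms below.\<close>

locale topological_groupoid = groupoid +
  assumes continuous_comp:
      "continuous_map (subtopology (prod_topology (gtop G) (gtop G)) (composable G)) (gtop G)
         (\<lambda>(x, y). gcomp G x y)"
    and continuous_inv: "continuous_map (gtop G) (gtop G) (ginv G)"

definition homeo_onto_open :: "'a topology \<Rightarrow> 'b topology \<Rightarrow> ('a \<Rightarrow> 'b) \<Rightarrow> 'a set \<Rightarrow> bool" where
  "homeo_onto_open X Y f U \<longleftrightarrow>
     openin Y (f ` U) \<and> homeomorphic_map (subtopology X U) (subtopology Y (f ` U)) f"

definition local_homeomorphism :: "'a topology \<Rightarrow> 'b topology \<Rightarrow> ('a \<Rightarrow> 'b) \<Rightarrow> bool" where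
  "local_homeomorphism X Y f \<longleftrightarrow>
     (\<forall>x\<in>topspace X. \<exists>U. openin X U \<and> x \<in> U \<and> homeo_onto_open X Y f U)"

definition bisection :: "'g groupoid \<Rightarrow> 'g set \<Rightarrow> bool" where
  "bisection G D \<longleftrightarrow>
     (\<exists>U. openin (gtop G) U \<and> D \<subseteq> U \<and>
          homeo_onto_open (gtop G) (unit_top G) (rng G) U \<and>
          homeo_onto_open (gtop G) (unit_top G) (src G) U)"

locale etale_groupoid = topological_groupoid +
  assumes locally_compact: "locally_compact_space (gtop G)"
    and Hausdorff_units: "Hausdorff_space (unit_top G)"
    and etale: "local_homeomorphism (gtop G) (unit_top G) (rng G)"

locale ample_groupoid = etale_groupoid +
  assumes compact_open_bisection_basis:
    "openin (gtop G) W \<Longrightarrow> x \<in> W \<Longrightarrow>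
       \<exists>K. openin (gtop G) K \<and> compactin (gtop G) K \<and> bisection G K \<and> x \<in> K \<and> K \<subseteq> W"

definition continuous_groupoid_hom :: "'g groupoid \<Rightarrow> 'h groupoid \<Rightarrow> ('g \<Rightarrow> 'h) \<Rightarrow> bool" where
  "continuous_groupoid_hom G H \<phi> \<longleftrightarrow>
     continuous_map (gtop G) (gtop H) \<phi> \<and>
     (\<forall>(x, y) \<in> composable G.
        (\<phi> x, \<phi> y) \<in> composable H \<and> \<phi> (gcomp G x y) = gcomp H (\<phi> x) (\<phi> y))"


section \<open>Discrete twists\<close>

definition ring_units :: "'r::comm_ring_1 set" where
  "ring_units = {t. t dvd 1}"

definition unit_inv :: "'r::comm_ring_1 \<Rightarrow> 'r" where
  "unit_inv t = (THE u. t * u = 1)"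

definition trivial_bundle :: "'g groupoid \<Rightarrow> ('g \<times> 'r::comm_ring_1) groupoid" where
  "trivial_bundle G =
     \<lparr> gtop = prod_topology (unit_top G) (discrete_topology ring_units),
       rng = (\<lambda>(x, t). (x, 1)),
       src = (\<lambda>(x, t). (x, 1)),
       gcomp = (\<lambda>(x, t) (y, u). (x, t * u)),
       ginv = (\<lambda>(x, t). (x, unit_inv t)) \<rparr>"

definition preimage :: "'s groupoid \<Rightarrow> ('s \<Rightarrow> 'g) \<Rightarrow> 'g set \<Rightarrow> 's set" where
  "preimage E q D = {\<sigma> \<in> arrows E. q \<sigma> \<in> D}"

text \<open>The unit space of \<open>E\<close> is identified with that of \<open>G\<close> through \<open>q\<close>, which by
  \<open>i_fibre\<close> is inverse to \<open>x \<mapsto> i (x, 1)\<close>; so a unit \<open>rng E \<sigma>\<close> of the total groupoid,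
  regarded as a unit of \<open>G\<close>, is \<open>q (rng E \<sigma>)\<close>.\<close>

definition twist_act :: "'s groupoid \<Rightarrow> ('g \<times> 'r \<Rightarrow> 's) \<Rightarrow> ('s \<Rightarrow> 'g) \<Rightarrow> 'r \<Rightarrow> 's \<Rightarrow> 's" where
  "twist_act E i q t \<sigma> = gcomp E (i (q (rng E \<sigma>), t)) \<sigma>"

locale discrete_twist =
  base: etale_groupoid G + total: topological_groupoid E
  for G :: "'g groupoid" and E :: "'s groupoid" +
  fixes i :: "'g \<times> 'r::comm_ring_1 \<Rightarrow> 's" and q :: "'s \<Rightarrow> 'g"
  assumes units_eq: "units E = i ` (units G \<times> {1})"
    and i_hom: "continuous_groupoid_hom (trivial_bundle G) E i"
    and i_units: "homeomorphic_map (unit_top (trivial_bundle G :: ('g \<times> 'r) groupoid)) (unit_top E) i"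
    and q_hom: "continuous_groupoid_hom E G q"
    and q_units: "homeomorphic_map (unit_top E) (unit_top G) q"
    and i_fibre: "x \<in> units G \<Longrightarrow> i ` ({x} \<times> ring_units) = preimage E q {x}"
    and i_inj: "inj_on i (units G \<times> ring_units)"
    and q_surj: "q ` arrows E = arrows G"
    and local_sections: "\<alpha> \<in> arrows G \<Longrightarrow>
          \<exists>D p. openin (gtop G) D \<and> bisection G D \<and> \<alpha> \<in> D \<and>
                continuous_map (subtopology (gtop G) D) (gtop E) p \<and>
                (\<forall>\<beta>\<in>D. q (p \<beta>) = \<beta>) \<and>
                homeomorphic_map
                  (prod_topology (subtopology (gtop G) D) (discrete_topology ring_units))
                  (subtopology (gtop E) (preimage E q D))
                  (\<lambda>(\<beta>, t). gcomp E (i (rng G \<beta>, t)) (p \<beta>))"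
    and central: "\<sigma> \<in> arrows E \<Longrightarrow> t \<in> ring_units \<Longrightarrow>
          gcomp E (i (q (rng E \<sigma>), t)) \<sigma> = gcomp E \<sigma> (i (q (src E \<sigma>), t))"


section \<open>Twisted Steinberg algebras\<close>

text \<open>Functions on the total groupoid \<open>E\<close> are extended by zero off its set of arrows, and the
  functions that form an algebra carry the pointwise addition of \<^theory>\<open>HOL-Library.Function_Algebras\<close>.\<close>

definition fun_scale :: "'r::comm_ring_1 \<Rightarrow> ('s \<Rightarrow> 'r) \<Rightarrow> 's \<Rightarrow> 'r" where
  "fun_scale t f = (\<lambda>\<sigma>. t * f \<sigma>)"

definition supp :: "'s groupoid \<Rightarrow> ('s \<Rightarrow> 'r::zero) \<Rightarrow> 's set" where
  "supp E f = {\<sigma> \<in> arrows E. f \<sigma> \<noteq> 0}"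

definition locally_constant :: "'s topology \<Rightarrow> ('s \<Rightarrow> 'r) \<Rightarrow> bool" where
  "locally_constant X f \<longleftrightarrow>
     (\<forall>x\<in>topspace X. \<exists>U. openin X U \<and> x \<in> U \<and> (\<forall>y\<in>U. f y = f x))"

definition steinberg_algebra ::
  "'g groupoid \<Rightarrow> 's groupoid \<Rightarrow> ('g \<times> 'r::comm_ring_1 \<Rightarrow> 's) \<Rightarrow> ('s \<Rightarrow> 'g) \<Rightarrow> ('s \<Rightarrow> 'r) set" where
  "steinberg_algebra G E i q =
     {f. (\<forall>\<sigma>. \<sigma> \<notin> arrows E \<longrightarrow> f \<sigma> = 0) \<and>
         locally_constant (gtop E) f \<and>
         (\<forall>t\<in>ring_units. \<forall>\<sigma>\<in>arrows E. f (twist_act E i q t \<sigma>) = unit_inv t * f \<sigma>) \<and>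
         compactin (gtop G) (q ` supp E f)}"

text \<open>The section of \<open>q\<close> over \<open>q ` supp E f\<close> is \<open>inv_into (supp E f) q\<close>; for \<open>f\<close> and \<open>g\<close> in the
  twisted Steinberg algebra the sum is finite and does not depend on this choice.\<close>

definition convolution ::
  "'g groupoid \<Rightarrow> 's groupoid \<Rightarrow> ('s \<Rightarrow> 'g) \<Rightarrow> ('s \<Rightarrow> 'r::comm_ring_1) \<Rightarrow> ('s \<Rightarrow> 'r) \<Rightarrow> 's \<Rightarrow> 'r" where
  "convolution G E q f g = (\<lambda>\<sigma>.
     if \<sigma> \<in> arrows E then
       (let S = inv_into (supp E f) q in
        \<Sum>\<alpha> \<in> {\<alpha> \<in> arrows G. rng G \<alpha> = q (rng E \<sigma>)} \<inter> q ` supp E f.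
          f (S \<alpha>) * g (gcomp E (ginv E (S \<alpha>)) \<sigma>))
     else 0)"

definition diagonal_subalgebra ::
  "'g groupoid \<Rightarrow> 's groupoid \<Rightarrow> ('g \<times> 'r::comm_ring_1 \<Rightarrow> 's) \<Rightarrow> ('s \<Rightarrow> 'g) \<Rightarrow> ('s \<Rightarrow> 'r) set" where
  "diagonal_subalgebra G E i q =
     {f \<in> steinberg_algebra G E i q. supp E f \<subseteq> preimage E q (units G)}"

definition diagonal_restriction ::
  "'g groupoid \<Rightarrow> 's groupoid \<Rightarrow> ('s \<Rightarrow> 'g) \<Rightarrow> ('s \<Rightarrow> 'r::comm_ring_1) \<Rightarrow> 's \<Rightarrow> 'r" where
  "diagonal_restriction G E q f = (\<lambda>\<sigma>. if \<sigma> \<in> preimage E q (units G) then f \<sigma> else 0)"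


section \<open>Algebraic quasi-Cartan pairs\<close>

text \<open>An \<open>R\<close>-algebra, not assumed unital or commutative, is a submodule \<open>A\<close> of an ambient
  \<open>R\<close>-module with a product \<open>mul\<close> that is only considered on \<open>A\<close>.\<close>

locale r_algebra = module scale
  for scale :: "'r::comm_ring_1 \<Rightarrow> 'a::ab_group_add \<Rightarrow> 'a" +
  fixes mul :: "'a \<Rightarrow> 'a \<Rightarrow> 'a" and A :: "'a set"
  assumes carrier_submodule: "subspace A"
    and mul_closed: "a \<in> A \<Longrightarrow> b \<in> A \<Longrightarrow> mul a b \<in> A"
    and mul_assoc: "a \<in> A \<Longrightarrow> b \<in> A \<Longrightarrow> c \<in> A \<Longrightarrow> mul (mul a b) c = mul a (mul b c)"
    and mul_add_left: "a \<in> A \<Longrightarrow> b \<in> A \<Longrightarrow> c \<in> A \<Longrightarrow> mul (a + b) c = mul a c + mul b c"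
    and mul_add_right: "a \<in> A \<Longrightarrow> b \<in> A \<Longrightarrow> c \<in> A \<Longrightarrow> mul a (b + c) = mul a b + mul a c"
    and mul_scale_left: "a \<in> A \<Longrightarrow> b \<in> A \<Longrightarrow> mul (scale t a) b = scale t (mul a b)"
    and mul_scale_right: "a \<in> A \<Longrightarrow> b \<in> A \<Longrightarrow> mul a (scale t b) = scale t (mul a b)"

definition idempotents :: "('a \<Rightarrow> 'a \<Rightarrow> 'a) \<Rightarrow> 'a set \<Rightarrow> 'a set" where
  "idempotents mul B = {e \<in> B. mul e e = e}"

definition local_units :: "('a \<Rightarrow> 'a \<Rightarrow> 'a) \<Rightarrow> 'a set \<Rightarrow> 'a set \<Rightarrow> bool" where
  "local_units mul A I \<longleftrightarrow>
     (\<forall>F. finite F \<and> F \<subseteq> A \<longrightarrow> (\<exists>e\<in>I. \<forall>a\<in>F. mul e a = a \<and> mul a e = a))"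

definition normalisers :: "('a \<Rightarrow> 'a \<Rightarrow> 'a) \<Rightarrow> 'a set \<Rightarrow> 'a set \<Rightarrow> 'a set" where
  "normalisers mul A B =
     {n \<in> A. \<exists>k\<in>A. mul (mul k n) k = k \<and> mul (mul n k) n = n \<and>
                   (\<forall>b\<in>B. mul (mul k b) n \<in> B \<and> mul (mul n b) k \<in> B)}"

definition conditional_expectation ::
  "('r \<Rightarrow> 'a::ab_group_add \<Rightarrow> 'a) \<Rightarrow> ('a \<Rightarrow> 'a \<Rightarrow> 'a) \<Rightarrow> 'a set \<Rightarrow> 'a set \<Rightarrow> ('a \<Rightarrow> 'a) \<Rightarrow> bool" where
  "conditional_expectation smul mul A B P \<longleftrightarrow>
     P ` A \<subseteq> B \<and>
     (\<forall>a\<in>A. \<forall>b\<in>A. P (a + b) = P a + P b) \<and>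
     (\<forall>t. \<forall>a\<in>A. P (smul t a) = smul t (P a)) \<and>
     (\<forall>b\<in>B. P b = b) \<and>
     (\<forall>b\<in>B. \<forall>a\<in>A. \<forall>b'\<in>B. P (mul (mul b a) b') = mul (mul b (P a)) b')"

definition faithful_expectation ::
  "('a::zero \<Rightarrow> 'a \<Rightarrow> 'a) \<Rightarrow> 'a set \<Rightarrow> 'a set \<Rightarrow> ('a \<Rightarrow> 'a) \<Rightarrow> bool" where
  "faithful_expectation mul A B P \<longleftrightarrow>
     (\<forall>a\<in>A. a \<noteq> 0 \<longrightarrow> (\<exists>n\<in>normalisers mul A B. P (mul n a) \<noteq> 0))"

definition implemented_by_idempotents ::
  "('a \<Rightarrow> 'a \<Rightarrow> 'a) \<Rightarrow> 'a set \<Rightarrow> 'a set \<Rightarrow> ('a \<Rightarrow> 'a) \<Rightarrow> bool" where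
  "implemented_by_idempotents mul A B P \<longleftrightarrow>
     (\<forall>n\<in>normalisers mul A B. \<exists>e\<in>idempotents mul B. P n = mul n e \<and> mul n e = mul e n)"

definition algebraic_quasi_cartan_pair ::
  "('r::comm_ring_1 \<Rightarrow> 'a::ab_group_add \<Rightarrow> 'a) \<Rightarrow> ('a \<Rightarrow> 'a \<Rightarrow> 'a) \<Rightarrow> 'a set \<Rightarrow> 'a set \<Rightarrow> bool" where
  "algebraic_quasi_cartan_pair smul mul A B \<longleftrightarrow>
     r_algebra smul mul A \<and> r_algebra smul mul B \<and> B \<subseteq> A \<and>
     (\<forall>a\<in>B. \<forall>b\<in>B. mul a b = mul b a) \<and>
     (\<forall>t. \<forall>e\<in>idempotents mul B - {0}. smul t e = 0 \<longrightarrow> t = 0) \<and>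
     local_units mul A (idempotents mul B) \<and>
     B = module.span smul (idempotents mul B) \<and>
     A = module.span smul (normalisers mul A B) \<and>
     (\<exists>P. conditional_expectation smul mul A B P \<and>
          faithful_expectation mul A B P \<and>
          implemented_by_idempotents mul A B P)"

definition local_bisection_hypothesis ::
  "'g groupoid \<Rightarrow> 's groupoid \<Rightarrow> ('g \<times> 'r::comm_ring_1 \<Rightarrow> 's) \<Rightarrow> ('s \<Rightarrow> 'g) \<Rightarrow> bool" where
  "local_bisection_hypothesis G E i q \<longleftrightarrow>
     (\<forall>n \<in> normalisers (convolution G E q) (steinberg_algebra G E i q) (diagonal_subalgebra G E i q).
        bisection G (q ` supp E n))"

definition indecomposable_ring :: "'r::comm_ring_1 itself \<Rightarrow> bool" where
  "indecomposable_ring TYPE('r) \<longleftrightarrow> (\<forall>e::'r. e * e = e \<longrightarrow> e = 0 \<or> e = 1)"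

end

theory Submission
  imports Defs
begin

text \<open>
The map \<open>q\<close> is a local homeomorphism whose fibres are free orbits of the group of ring units. Call an open subset \<open>S\<close> of the twist with injective range and source maps and compact
image in \<open>G\<close> a twist bisection; its indicator is the equivariant function that is \<open>1\<close> on \<open>S\<close> and
vanishes off the preimage of \<open>q ` S\<close>. Multiplication by such an indicator only translates a function along \<open>S\<close>
(\<open>convolution_indicator_left\<close>, \<open>convolution_indicator_right\<close>). Hence the indicator of \<open>S\<close> is a
normaliser whose partial inverse is the indicator of the inverse of \<open>S\<close>, and an idempotent of the
diagonal if \<open>S\<close> consists of units. Since elements of the algebra are locally constant with compact
support, they are linear combinations of indicators of twist bisections, which may be chosen inside
any open set that lifts the support (\<open>steinberg_in_span\<close>). This gives the two statements on spans,
reduces closure of the algebra under convolution to products with indicators, and provides the local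
units. Multiplying a nonzero function by the indicator of the inverse of a bisection through a point
of its support moves that point to a unit, so the restriction to the diagonal is faithful.

Let \<open>Q\<close> be any conditional expectation implemented by idempotents. For the indicator \<open>h\<close> of a
bisection off the units, \<open>Q h = h e\<close> is supported off the units and lies in the diagonal, so it is
zero. As these \<open>h\<close> span the functions supported off the units, \<open>Q\<close> is the restriction \<open>P\<close>
(\<open>expectation_implemented_by_idempotents_unique\<close>). So the pair is quasi-Cartan if and only if \<open>P\<close> is
implemented by idempotents, and it remains to compare this with the local bisection hypothesis.

Suppose that \<open>P\<close> is implemented and let \<open>n\<close> be a normaliser with \<open>P n = n e = e n\<close>. If \<open>n\<close> is nonzero
at a unit \<open>u\<close>, then the idempotent \<open>e\<close> is nonzero at \<open>u\<close>, hence \<open>1\<close> there because the coefficient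
ring is indecomposable, so every arrow in the support of \<open>n\<close> that starts or ends at \<open>u\<close> survives
in \<open>P n\<close> and is itself a unit. Normalisers are closed under products, so an arbitrary normaliser can
be translated until a given point of its support becomes a unit; thus at most one arrow of the
support has a given range or source (\<open>normaliser_support_bisection\<close>). Conversely, if the support
\<open>D\<close> of \<open>n\<close> is a bisection, the indicator of the units in \<open>D\<close> implements \<open>P\<close> at \<open>n\<close>
(\<open>implemented_by_idempotents_if_local_bisection\<close>).
\<close>

section \<open>Groupoid arithmetic\<close>

context groupoid
begin

lemma composable_iff:
  "(x, y) \<in> composable G \<longleftrightarrow> x \<in> arrows G \<and> y \<in> arrows G \<and> src G x = rng G y"
  by (auto simp: composable_def)

lemma composableI:
  "x \<in> arrows G \<Longrightarrow> y \<in> arrows G \<Longrightarrow> src G x = rng G y \<Longrightarrow> (x, y) \<in> composable G"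
  by (simp add: composable_iff)

lemmas product_closed [simp] = comp_closed [OF composableI]
  and rng_product [simp] = rng_comp [OF composableI]
  and src_product [simp] = src_comp [OF composableI]

lemmas groupoid_simps [simp] = rng_closed src_closed inv_closed rng_rng src_rng rng_src src_src
  comp_rng comp_src rng_inv src_inv inv_comp comp_inv

lemma product_assoc [simp]:
  assumes "x \<in> arrows G" "y \<in> arrows G" "z \<in> arrows G" "src G x = rng G y" "src G y = rng G z"
  shows "gcomp G (gcomp G x y) z = gcomp G x (gcomp G y z)"
  using assms by (intro comp_assoc composableI)

lemma inv_product_cancel [simp]:
  assumes "x \<in> arrows G" "y \<in> arrows G" "src G x = rng G y"
  shows "gcomp G (ginv G x) (gcomp G x y) = y"
  using product_assoc [of "ginv G x" x y] assms by simp

lemma product_inv_cancel [simp]: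
  assumes "x \<in> arrows G" "y \<in> arrows G" "rng G x = rng G y"
  shows "gcomp G x (gcomp G (ginv G x) y) = y"
  using product_assoc [of x "ginv G x" y] assms by simp

lemma left_cancel:
  assumes "x \<in> arrows G" "y \<in> arrows G" "z \<in> arrows G" "src G x = rng G y" "src G x = rng G z"
    and "gcomp G x y = gcomp G x z"
  shows "y = z"
  using assms inv_product_cancel by metis

lemma inv_unique:
  assumes "x \<in> arrows G" "y \<in> arrows G" "src G x = rng G y" "gcomp G x y = rng G x"
  shows "y = ginv G x"
  using assms left_cancel [of x y "ginv G x"] by simp

lemma inv_inv [simp]: "x \<in> arrows G \<Longrightarrow> ginv G (ginv G x) = x"
  using inv_unique [of "ginv G x" x] by simp

lemma inv_product [simp]:
  assumes "x \<in> arrows G" "y \<in> arrows G" "src G x = rng G y"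
  shows "ginv G (gcomp G x y) = gcomp G (ginv G y) (ginv G x)"
proof -
  have "gcomp G (ginv G y) (ginv G x) = ginv G (gcomp G x y)"
    by (rule inv_unique) (use assms in simp_all)
  then show ?thesis by simp
qed

lemma unit_iff: "x \<in> units G \<longleftrightarrow> x \<in> arrows G \<and> rng G x = x"
  unfolding units_def by force

lemma src_unit: "x \<in> units G \<Longrightarrow> src G x = x"
  using src_rng unit_iff by metis

lemma rng_unit: "x \<in> units G \<Longrightarrow> rng G x = x"
  by (simp add: unit_iff)

lemma units_arrows: "x \<in> units G \<Longrightarrow> x \<in> arrows G"
  by (simp add: unit_iff)

lemma units_subset: "units G \<subseteq> arrows G"
  using units_arrows by blast

lemma rng_in_units: "x \<in> arrows G \<Longrightarrow> rng G x \<in> units G"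
  by (simp add: unit_iff)

lemma src_in_units: "x \<in> arrows G \<Longrightarrow> src G x \<in> units G"
  by (simp add: unit_iff)

lemma inv_unit [simp]: "x \<in> units G \<Longrightarrow> ginv G x = x"
  using inv_unique [of x x] comp_rng [of x] by (simp add: unit_iff src_unit)

lemma inv_rng [simp]: "x \<in> arrows G \<Longrightarrow> ginv G (rng G x) = rng G x"
  and inv_src [simp]: "x \<in> arrows G \<Longrightarrow> ginv G (src G x) = src G x"
  by (simp_all add: rng_in_units src_in_units)

lemma comp_rng' [simp]: "x \<in> arrows G \<Longrightarrow> y = rng G x \<Longrightarrow> gcomp G y x = x"
  and comp_src' [simp]: "x \<in> arrows G \<Longrightarrow> y = src G x \<Longrightarrow> gcomp G x y = x"
  by simp_all

lemma inv_product_unit_iff: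
  assumes "x \<in> arrows G" "y \<in> arrows G" "rng G x = rng G y"
  shows "gcomp G (ginv G x) y \<in> units G \<longleftrightarrow> x = y"
proof
  assume "gcomp G (ginv G x) y \<in> units G"
  then have "gcomp G (ginv G x) y = src G x"
    using rng_unit assms by fastforce
  then show "x = y"
    using assms product_inv_cancel comp_src by metis
next
  assume "x = y"
  then show "gcomp G (ginv G x) y \<in> units G"
    using assms src_in_units by simp
qed

lemma product_inv_unit_iff:
  assumes "x \<in> arrows G" "y \<in> arrows G" "src G x = src G y"
  shows "gcomp G x (ginv G y) \<in> units G \<longleftrightarrow> x = y"
proof -
  have "gcomp G x (ginv G y) \<in> units G \<longleftrightarrow> ginv G x = ginv G y"
    using inv_product_unit_iff [of "ginv G x" "ginv G y"] assms by simp
  also have "\<dots> \<longleftrightarrow> x = y"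
    using assms inv_inv by metis
  finally show ?thesis .
qed

end


section \<open>Topology of etale groupoids\<close>

context topological_groupoid
begin

lemma topspace_gtop [simp]: "topspace (gtop G) = arrows G"
  by (simp add: arrows_def)

lemma topspace_unit_top [simp]: "topspace (unit_top G) = units G"
  using units_subset by (auto simp: unit_top_def)

lemma continuous_product:
  assumes f: "continuous_map X (gtop G) f" and g: "continuous_map X (gtop G) g"
    and "\<And>x. x \<in> topspace X \<Longrightarrow> src G (f x) = rng G (g x)"
  shows "continuous_map X (gtop G) (\<lambda>x. gcomp G (f x) (g x))"
proof -
  have "continuous_map X (prod_topology (gtop G) (gtop G)) (\<lambda>x. (f x, g x))"
    using f g by (simp add: continuous_map_paired)
  moreover have "(\<lambda>x. (f x, g x)) \<in> topspace X \<rightarrow> composable G"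
    using assms by (auto simp: composable_iff continuous_map_def)
  ultimately have "continuous_map X (subtopology (prod_topology (gtop G) (gtop G)) (composable G))
      (\<lambda>x. (f x, g x))"
    by (simp add: continuous_map_in_subtopology image_subset_iff_funcset)
  from continuous_map_compose [OF this continuous_comp] show ?thesis
    by (simp add: o_def)
qed

lemma continuous_rng: "continuous_map (gtop G) (gtop G) (rng G)"
proof -
  have "continuous_map (gtop G) (gtop G) (\<lambda>x. gcomp G x (ginv G x))"
    by (rule continuous_product) (use continuous_inv in auto)
  then show ?thesis
    by (rule continuous_map_eq) simp
qed

lemma continuous_src: "continuous_map (gtop G) (gtop G) (src G)"
proof -
  have "continuous_map (gtop G) (gtop G) (rng G \<circ> ginv G)"
    by (rule continuous_map_compose [OF continuous_inv continuous_rng])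
  then show ?thesis
    by (rule continuous_map_eq) simp
qed

lemma openin_inverse_image:
  assumes "openin (gtop G) U"
  shows "openin (gtop G) (ginv G ` U)"
proof -
  have "U \<subseteq> arrows G"
    using openin_subset [OF assms] by simp
  then have "ginv G ` U = {x \<in> topspace (gtop G). ginv G x \<in> U}"
    by (force simp: image_iff)
  then show ?thesis
    using openin_continuous_map_preimage [OF continuous_inv assms] by simp
qed

end

lemma homeo_onto_openI:
  assumes U: "openin X U" and f: "continuous_map X Y f" and op: "open_map X Y f" and inj: "inj_on f U"
  shows "homeo_onto_open X Y f U"
  unfolding homeo_onto_open_def
proof
  show fU: "openin Y (f ` U)"
    using op U by (simp add: open_map_def)
  have sub: "U \<subseteq> topspace X" "f ` U \<subseteq> topspace Y"
    using U fU openin_subset by blast+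
  show "homeomorphic_map (subtopology X U) (subtopology Y (f ` U)) f"
  proof (rule bijective_open_imp_homeomorphic_map)
    show "continuous_map (subtopology X U) (subtopology Y (f ` U)) f"
      using f by (auto simp: continuous_map_in_subtopology continuous_map_from_subtopology)
    show "open_map (subtopology X U) (subtopology Y (f ` U)) f"
      using op U fU unfolding open_map_def openin_open_subtopology [OF U] openin_open_subtopology [OF fU]
      by blast
    show "f ` topspace (subtopology X U) = topspace (subtopology Y (f ` U))"
      using sub by auto
    show "inj_on f (topspace (subtopology X U))"
      using inj by (simp add: inj_on_def)
  qed
qed

lemma local_homeomorphism_imp_open_map:
  assumes "local_homeomorphism X Y f"
  shows "open_map X Y f"
  unfolding open_map_def
proof (intro allI impI)
  fix W assume W: "openin X W"
  show "openin Y (f ` W)"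
  proof (subst openin_subopen, intro ballI)
    fix y assume "y \<in> f ` W"
    then obtain x where x: "x \<in> W" "y = f x" by blast
    then have "x \<in> topspace X" using W openin_subset by blast
    then obtain U where U: "openin X U" "x \<in> U" "openin Y (f ` U)"
      and hom: "homeomorphic_map (subtopology X U) (subtopology Y (f ` U)) f"
      using assms unfolding local_homeomorphism_def homeo_onto_open_def by blast
    have "openin (subtopology X U) (W \<inter> U)"
      using U(1) W by (simp add: openin_open_subtopology openin_Int)
    then have "openin (subtopology Y (f ` U)) (f ` (W \<inter> U))"
      using homeomorphic_imp_open_map [OF hom] unfolding open_map_def by blast
    then have "openin Y (f ` (W \<inter> U))"
      using U(3) openin_trans_full by blast
    with x U show "\<exists>T. openin Y T \<and> y \<in> T \<and> T \<subseteq> f ` W" by blast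
  qed
qed

context topological_groupoid
begin

lemma continuous_rng_units: "continuous_map (gtop G) (unit_top G) (rng G)"
  and continuous_src_units: "continuous_map (gtop G) (unit_top G) (src G)"
  using continuous_rng continuous_src rng_in_units src_in_units
  by (auto simp: unit_top_def continuous_map_in_subtopology)

lemma bisection_inj:
  assumes "bisection G D"
  shows "D \<subseteq> arrows G" "inj_on (rng G) D" "inj_on (src G) D"
proof -
  obtain U where U: "openin (gtop G) U" "D \<subseteq> U"
    "homeomorphic_map (subtopology (gtop G) U) (subtopology (unit_top G) (rng G ` U)) (rng G)"
    "homeomorphic_map (subtopology (gtop G) U) (subtopology (unit_top G) (src G ` U)) (src G)"
    using assms unfolding bisection_def homeo_onto_open_def by blast
  have sub: "U \<subseteq> arrows G"
    using openin_subset [OF U(1)] by simp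
  then show "D \<subseteq> arrows G" using U(2) by blast
  have "inj_on (rng G) (topspace (subtopology (gtop G) U))"
    "inj_on (src G) (topspace (subtopology (gtop G) U))"
    using U(3,4) homeomorphic_imp_injective_map by blast+
  moreover have "D \<subseteq> topspace (subtopology (gtop G) U)"
    using sub U(2) by auto
  ultimately show "inj_on (rng G) D" "inj_on (src G) D"
    using inj_on_subset by blast+
qed

end

context etale_groupoid
begin

lemma open_map_rng_units: "open_map (gtop G) (unit_top G) (rng G)"
  by (rule local_homeomorphism_imp_open_map [OF etale])

lemma local_rng_inj:
  assumes "x \<in> arrows G"
  obtains U where "openin (gtop G) U" "x \<in> U" "inj_on (rng G) U"
proof -
  obtain U where U: "openin (gtop G) U" "x \<in> U"
    "homeomorphic_map (subtopology (gtop G) U) (subtopology (unit_top G) (rng G ` U)) (rng G)"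
    using etale assms unfolding local_homeomorphism_def homeo_onto_open_def by auto
  moreover have "inj_on (rng G) (topspace (subtopology (gtop G) U))"
    using U(3) homeomorphic_imp_injective_map by blast
  ultimately show thesis
    using that openin_subset [OF U(1)] by (simp add: Int_absorb1)
qed

text \<open>Near a unit \<open>x\<close> the range map is injective, and an arrow \<open>y\<close> close to \<open>x\<close> has the same
  range as the nearby arrow \<open>rng G y\<close>; hence \<open>y = rng G y\<close>.\<close>

lemma openin_units: "openin (gtop G) (units G)"
proof (subst openin_subopen, intro ballI)
  fix x assume x: "x \<in> units G"
  then obtain U where U: "openin (gtop G) U" "x \<in> U" "inj_on (rng G) U"
    using local_rng_inj units_arrows by blast
  have sub: "U \<subseteq> arrows G"
    using openin_subset [OF U(1)] by simp
  define V where "V = U \<inter> {y \<in> topspace (gtop G). rng G y \<in> U}"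
  have "openin (gtop G) V"
    unfolding V_def using U(1) openin_continuous_map_preimage [OF continuous_rng] by blast
  moreover have "x \<in> V"
    using x U by (simp add: V_def unit_iff)
  moreover have "V \<subseteq> units G"
  proof
    fix y assume "y \<in> V"
    then have y: "y \<in> U" "rng G y \<in> U" "y \<in> arrows G" by (auto simp: V_def)
    then have "rng G y = y"
      using inj_onD [OF U(3), of "rng G y" y] by simp
    with y(3) show "y \<in> units G" by (simp add: unit_iff)
  qed
  ultimately show "\<exists>T. openin (gtop G) T \<and> x \<in> T \<and> T \<subseteq> units G" by blast
qed

lemma openin_unit_top_iff: "openin (unit_top G) U \<longleftrightarrow> openin (gtop G) U \<and> U \<subseteq> units G"
  unfolding unit_top_def by (rule openin_open_subtopology [OF openin_units])

lemma openin_rng_image: "openin (gtop G) U \<Longrightarrow> openin (gtop G) (rng G ` U)"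
  using open_map_rng_units unfolding open_map_def openin_unit_top_iff by blast

lemma src_image_eq: "U \<subseteq> arrows G \<Longrightarrow> src G ` U = rng G ` ginv G ` U"
  unfolding image_image by (intro image_cong) auto

lemma openin_src_image: "openin (gtop G) U \<Longrightarrow> openin (gtop G) (src G ` U)"
  using openin_rng_image [OF openin_inverse_image] src_image_eq openin_subset topspace_gtop by metis

lemma open_map_src_units: "open_map (gtop G) (unit_top G) (src G)"
  unfolding open_map_def openin_unit_top_iff
  using openin_src_image openin_subset src_in_units by fastforce

text \<open>The range and source maps of an etale groupoid are open and continuous, so on an open set only
  their injectivity is at stake.\<close>

lemma open_bisectionI:
  assumes "openin (gtop G) U" "inj_on (rng G) U" "inj_on (src G) U"
  shows "bisection G U"
  unfolding bisection_def
  using assms homeo_onto_openI [OF _ continuous_rng_units open_map_rng_units]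
    homeo_onto_openI [OF _ continuous_src_units open_map_src_units] by blast

text \<open>A compact set is covered by finitely many open sets on which the range map is injective, and each
  of them contains at most one arrow with range \<open>x\<close>. This makes the sums in convolutions finite.\<close>

lemma finite_compact_fibre:
  assumes "compactin (gtop G) C"
  shows "finite {\<alpha> \<in> C. rng G \<alpha> = x}"
proof -
  have "C \<subseteq> arrows G"
    using compactin_subset_topspace [OF assms] by simp
  then have "C \<subseteq> \<Union> {U. openin (gtop G) U \<and> inj_on (rng G) U}"
    using local_rng_inj by blast
  then obtain \<U> where \<U>: "finite \<U>" "\<U> \<subseteq> {U. openin (gtop G) U \<and> inj_on (rng G) U}" "C \<subseteq> \<Union> \<U>"
    using assms unfolding compactin_def by (metis (no_types, lifting) mem_Collect_eq)
  have "finite {\<alpha> \<in> U. rng G \<alpha> = x}" if "U \<in> \<U>" for U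
  proof -
    have "inj_on (rng G) U" using \<U> that by blast
    then have "inj_on (rng G) {\<alpha> \<in> U. rng G \<alpha> = x}"
      by (auto simp: inj_on_def)
    moreover have "finite (rng G ` {\<alpha> \<in> U. rng G \<alpha> = x})"
      by (rule finite_subset [of _ "{x}"]) auto
    ultimately show ?thesis
      using finite_imageD by blast
  qed
  then have "finite (\<Union>U\<in>\<U>. {\<alpha> \<in> U. rng G \<alpha> = x})"
    using \<U>(1) by blast
  then show ?thesis
    by (rule rev_finite_subset) (use \<U>(3) in blast)
qed

text \<open>As the unit space is Hausdorff, the composable pairs form a closed set, so the composable pairs
  in \<open>C \<times> D\<close> form a compact set; the product is its continuous image.\<close>

lemma compactin_product:
  assumes C: "compactin (gtop G) C" and D: "compactin (gtop G) D"
  shows "compactin (gtop G) {gcomp G x y | x y. x \<in> C \<and> y \<in> D \<and> src G x = rng G y}"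
proof -
  have sub: "C \<subseteq> arrows G" "D \<subseteq> arrows G"
    using compactin_subset_topspace C D by fastforce+
  let ?X = "prod_topology (gtop G) (gtop G)"
  have "continuous_map ?X (unit_top G) (\<lambda>z. src G (fst z))"
    "continuous_map ?X (unit_top G) (\<lambda>z. rng G (snd z))"
    using continuous_map_compose [OF continuous_map_fst continuous_src_units]
      continuous_map_compose [OF continuous_map_snd continuous_rng_units]
    by (simp_all add: o_def)
  then have "closedin ?X {z \<in> topspace ?X. src G (fst z) = rng G (snd z)}"
    using closedin_continuous_maps_eq [OF Hausdorff_units] by blast
  moreover have "{z \<in> topspace ?X. src G (fst z) = rng G (snd z)} = composable G"
    by (auto simp: composable_iff)
  ultimately have "closedin ?X (composable G)" by simp
  then have "compactin ?X (composable G \<inter> C \<times> D)"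
    using C D by (simp add: closed_Int_compactin compactin_Times)
  then have "compactin (subtopology ?X (composable G)) (composable G \<inter> C \<times> D)"
    by (simp add: compactin_subtopology)
  from image_compactin [OF this continuous_comp]
  have "compactin (gtop G) ((\<lambda>(x, y). gcomp G x y) ` (composable G \<inter> C \<times> D))" .
  moreover have "(\<lambda>(x, y). gcomp G x y) ` (composable G \<inter> C \<times> D)
      = {gcomp G x y | x y. x \<in> C \<and> y \<in> D \<and> src G x = rng G y}"
    using sub by (force simp: composable_iff image_iff)
  ultimately show ?thesis by simp
qed

lemma closedin_units:
  assumes "Hausdorff_space (gtop G)"
  shows "closedin (gtop G) (units G)"
proof -
  have "closedin (gtop G) {x \<in> topspace (gtop G). rng G x = x}"
    using closedin_continuous_maps_eq [OF assms continuous_rng continuous_map_id] by simp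
  moreover have "{x \<in> topspace (gtop G). rng G x = x} = units G"
    by (auto simp: unit_iff)
  ultimately show ?thesis by simp
qed

end

section \<open>Units of the coefficient ring\<close>

lemma unit_inv_eqI:
  fixes t :: "'r::comm_ring_1"
  assumes "t * u = 1"
  shows "unit_inv t = u"
  unfolding unit_inv_def
proof (rule the_equality)
  fix v assume v: "t * v = 1"
  have "v = (t * u) * v" using assms by simp
  also have "\<dots> = u * (t * v)" by (simp add: ac_simps)
  finally show "v = u" using v by simp
qed (rule assms)

lemma ring_unitsI: "t * u = 1 \<Longrightarrow> t \<in> ring_units" for t :: "'r::comm_ring_1"
  unfolding ring_units_def by (metis dvdI mem_Collect_eq)

lemma mult_unit_inv [simp]:
  fixes t :: "'r::comm_ring_1"
  assumes "t \<in> ring_units"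
  shows "t * unit_inv t = 1" "unit_inv t * t = 1"
proof -
  obtain u where "t * u = 1"
    using assms unfolding ring_units_def dvd_def by force
  with unit_inv_eqI show "t * unit_inv t = 1" by blast
  then show "unit_inv t * t = 1" by (simp add: mult.commute)
qed

lemma mult_unit_inv_cancel [simp]:
  fixes t :: "'r::comm_ring_1"
  assumes "t \<in> ring_units"
  shows "t * (unit_inv t * x) = x" "unit_inv t * (t * x) = x"
  using assms by (simp_all flip: mult.assoc)

lemma unit_inv_in_ring_units [simp]: "t \<in> ring_units \<Longrightarrow> unit_inv t \<in> ring_units"
  using mult_unit_inv(2) ring_unitsI by blast

lemma unit_inv_unit_inv [simp]: "t \<in> ring_units \<Longrightarrow> unit_inv (unit_inv t) = t"
  by (rule unit_inv_eqI) simp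

lemma one_in_ring_units [simp]: "1 \<in> ring_units"
  by (rule ring_unitsI) (rule mult_1)

lemma unit_inv_one [simp]: "unit_inv 1 = 1"
  by (rule unit_inv_eqI) simp

lemma mult_in_ring_units [simp]: "t \<in> ring_units \<Longrightarrow> u \<in> ring_units \<Longrightarrow> t * u \<in> ring_units"
  by (rule ring_unitsI [where u = "unit_inv u * unit_inv t"]) (simp add: mult.assoc)

lemma unit_inv_mult: "t \<in> ring_units \<Longrightarrow> u \<in> ring_units \<Longrightarrow> unit_inv (t * u) = unit_inv t * unit_inv u"
  by (rule unit_inv_eqI) (simp add: ac_simps)

lemma unit_mult_eq_0_iff [simp]: "t \<in> ring_units \<Longrightarrow> t * x = 0 \<longleftrightarrow> x = 0"
  by (metis mult_unit_inv_cancel(2) mult_zero_right)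


section \<open>The action of the ring units on a twist\<close>

context discrete_twist
begin

abbreviation act :: "'r \<Rightarrow> 's \<Rightarrow> 's" where
  "act \<equiv> twist_act E i q"

lemma q_arrows [simp]: "\<sigma> \<in> arrows E \<Longrightarrow> q \<sigma> \<in> arrows G"
  using q_surj by blast

lemma continuous_q: "continuous_map (gtop E) (gtop G) q"
  using q_hom by (simp add: continuous_groupoid_hom_def)

lemma
  assumes "\<sigma> \<in> arrows E" "\<tau> \<in> arrows E" "src E \<sigma> = rng E \<tau>"
  shows q_product [simp]: "q (gcomp E \<sigma> \<tau>) = gcomp G (q \<sigma>) (q \<tau>)"
    and q_composable: "src G (q \<sigma>) = rng G (q \<tau>)"
proof -
  have "(\<sigma>, \<tau>) \<in> composable E"
    using assms by (simp add: total.composable_iff)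
  then have "(q \<sigma>, q \<tau>) \<in> composable G \<and> q (gcomp E \<sigma> \<tau>) = gcomp G (q \<sigma>) (q \<tau>)"
    using q_hom unfolding continuous_groupoid_hom_def by blast
  then show "q (gcomp E \<sigma> \<tau>) = gcomp G (q \<sigma>) (q \<tau>)" "src G (q \<sigma>) = rng G (q \<tau>)"
    by (simp_all add: base.composable_iff)
qed

lemma q_image_units: "q ` units E = units G"
  using homeomorphic_imp_surjective_map [OF q_units] by simp

lemma q_in_units: "u \<in> units E \<Longrightarrow> q u \<in> units G"
  using q_image_units by blast

lemma q_inj_units: "u \<in> units E \<Longrightarrow> v \<in> units E \<Longrightarrow> q u = q v \<Longrightarrow> u = v"
  using homeomorphic_imp_injective_map [OF q_units] by (simp add: inj_on_def)

lemma q_rng [simp]: "\<sigma> \<in> arrows E \<Longrightarrow> q (rng E \<sigma>) = rng G (q \<sigma>)"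
  using q_composable [of "rng E \<sigma>" \<sigma>] base.src_unit [OF q_in_units] total.rng_in_units by simp

lemma q_src [simp]: "\<sigma> \<in> arrows E \<Longrightarrow> q (src E \<sigma>) = src G (q \<sigma>)"
  using q_composable [of \<sigma> "src E \<sigma>"] base.rng_unit [OF q_in_units] total.src_in_units by simp

lemma rng_eq_iff:
  assumes "\<sigma> \<in> arrows E" "\<tau> \<in> arrows E"
  shows "rng E \<sigma> = rng E \<tau> \<longleftrightarrow> rng G (q \<sigma>) = rng G (q \<tau>)"
proof -
  have "rng E \<sigma> = rng E \<tau> \<longleftrightarrow> q (rng E \<sigma>) = q (rng E \<tau>)"
    using assms q_inj_units [OF total.rng_in_units total.rng_in_units] by metis
  then show ?thesis using assms by simp
qed

lemma src_eq_rng_iff: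
  assumes "\<sigma> \<in> arrows E" "\<tau> \<in> arrows E"
  shows "src E \<sigma> = rng E \<tau> \<longleftrightarrow> src G (q \<sigma>) = rng G (q \<tau>)"
proof -
  have "src E \<sigma> = rng E \<tau> \<longleftrightarrow> q (src E \<sigma>) = q (rng E \<tau>)"
    using assms q_inj_units [OF total.src_in_units total.rng_in_units] by metis
  then show ?thesis using assms by simp
qed

lemma src_eq_iff:
  assumes "\<sigma> \<in> arrows E" "\<tau> \<in> arrows E"
  shows "src E \<sigma> = src E \<tau> \<longleftrightarrow> src G (q \<sigma>) = src G (q \<tau>)"
proof -
  have "src E \<sigma> = src E \<tau> \<longleftrightarrow> q (src E \<sigma>) = q (src E \<tau>)"
    using assms q_inj_units [OF total.src_in_units total.src_in_units] by metis
  then show ?thesis using assms by simp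
qed

lemma q_inv [simp]:
  assumes "\<sigma> \<in> arrows E"
  shows "q (ginv E \<sigma>) = ginv G (q \<sigma>)"
proof (rule base.inv_unique)
  show "src G (q \<sigma>) = rng G (q (ginv E \<sigma>))"
    by (rule q_composable) (use assms in simp_all)
  have "gcomp G (q \<sigma>) (q (ginv E \<sigma>)) = q (gcomp E \<sigma> (ginv E \<sigma>))"
    by (rule q_product [symmetric]) (use assms in simp_all)
  also have "\<dots> = rng G (q \<sigma>)"
    using assms by simp
  finally show "gcomp G (q \<sigma>) (q (ginv E \<sigma>)) = rng G (q \<sigma>)" .
qed (use assms in simp_all)

lemma
  assumes "x \<in> units G" "t \<in> ring_units"
  shows i_arrows [simp]: "i (x, t) \<in> arrows E" and q_i [simp]: "q (i (x, t)) = x"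
proof -
  have "i (x, t) \<in> i ` ({x} \<times> ring_units)"
    using assms(2) by (intro imageI) simp
  then have "i (x, t) \<in> preimage E q {x}"
    by (simp only: i_fibre [OF assms(1)])
  then show "i (x, t) \<in> arrows E" "q (i (x, t)) = x"
    by (auto simp: preimage_def)
qed

lemma i_one_unit: "x \<in> units G \<Longrightarrow> i (x, 1) \<in> units E"
  by (simp add: units_eq)

lemma unit_eq_i: "u \<in> units E \<Longrightarrow> u = i (q u, 1)"
  using q_inj_units [of u "i (q u, 1)"] by (simp add: i_one_unit q_in_units)

lemma
  assumes "x \<in> units G" "t \<in> ring_units"
  shows rng_i [simp]: "rng E (i (x, t)) = i (x, 1)" and src_i [simp]: "src E (i (x, t)) = i (x, 1)"
proof -
  have "q (rng E (i (x, t))) = x" "q (src E (i (x, t))) = x"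
    using assms by (simp_all add: base.rng_unit base.src_unit)
  moreover have "rng E (i (x, t)) \<in> units E" "src E (i (x, t)) \<in> units E"
    using assms by (simp_all add: total.rng_in_units total.src_in_units)
  ultimately show "rng E (i (x, t)) = i (x, 1)" "src E (i (x, t)) = i (x, 1)"
    using unit_eq_i by metis+
qed

lemma trivial_bundle_simps:
  "arrows (trivial_bundle G :: ('g \<times> 'r) groupoid) = units G \<times> ring_units"
  "gtop (trivial_bundle G :: ('g \<times> 'r) groupoid) = prod_topology (unit_top G) (discrete_topology ring_units)"
  by (simp_all add: arrows_def trivial_bundle_def base.topspace_unit_top [unfolded arrows_def])

lemma i_product [simp]:
  assumes "x \<in> units G" "t \<in> ring_units" "u \<in> ring_units"
  shows "gcomp E (i (x, t)) (i (x, u)) = i (x, t * u)"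
proof -
  have "((x, t), (x, u)) \<in> composable (trivial_bundle G)"
    using assms unfolding composable_def trivial_bundle_simps by (simp add: trivial_bundle_def)
  moreover have "gcomp (trivial_bundle G) (x, t) (x, u) = (x, t * u)"
    by (simp add: trivial_bundle_def)
  ultimately show ?thesis
    using i_hom unfolding continuous_groupoid_hom_def by fastforce
qed

lemma i_rng_one [simp]: "\<sigma> \<in> arrows E \<Longrightarrow> i (rng G (q \<sigma>), 1) = rng E \<sigma>"
  and i_src_one [simp]: "\<sigma> \<in> arrows E \<Longrightarrow> i (src G (q \<sigma>), 1) = src E \<sigma>"
  using unit_eq_i [of "rng E \<sigma>"] unit_eq_i [of "src E \<sigma>"] total.rng_in_units total.src_in_units
  by simp_all

lemma act_eq_left: "\<sigma> \<in> arrows E \<Longrightarrow> act t \<sigma> = gcomp E (i (rng G (q \<sigma>), t)) \<sigma>"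
  by (simp add: twist_act_def)

lemma act_eq_right:
  "\<sigma> \<in> arrows E \<Longrightarrow> t \<in> ring_units \<Longrightarrow> act t \<sigma> = gcomp E \<sigma> (i (src G (q \<sigma>), t))"
  using central [of \<sigma> t] by (simp add: twist_act_def)

lemma
  assumes "\<sigma> \<in> arrows E" "t \<in> ring_units"
  shows act_arrows [simp]: "act t \<sigma> \<in> arrows E"
    and rng_act [simp]: "rng E (act t \<sigma>) = rng E \<sigma>"
    and src_act [simp]: "src E (act t \<sigma>) = src E \<sigma>"
    and q_act [simp]: "q (act t \<sigma>) = q \<sigma>"
  using assms by (simp_all add: act_eq_left base.rng_in_units)

lemma act_one [simp]: "\<sigma> \<in> arrows E \<Longrightarrow> act 1 \<sigma> = \<sigma>"
  by (simp add: act_eq_left)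

lemma act_act [simp]:
  assumes "\<sigma> \<in> arrows E" "t \<in> ring_units" "u \<in> ring_units"
  shows "act t (act u \<sigma>) = act (t * u) \<sigma>"
proof -
  have "act t (act u \<sigma>) = gcomp E (i (rng G (q \<sigma>), t)) (gcomp E (i (rng G (q \<sigma>), u)) \<sigma>)"
    using assms by (simp add: act_eq_left base.rng_in_units)
  also have "\<dots> = gcomp E (gcomp E (i (rng G (q \<sigma>), t)) (i (rng G (q \<sigma>), u))) \<sigma>"
    using assms by (intro total.product_assoc [symmetric]) (simp_all add: base.rng_in_units)
  also have "\<dots> = act (t * u) \<sigma>"
    using assms by (simp add: base.rng_in_units act_eq_left)
  finally show ?thesis .
qed

lemma act_product_left [simp]:
  assumes "\<sigma> \<in> arrows E" "\<tau> \<in> arrows E" "src E \<sigma> = rng E \<tau>" "t \<in> ring_units"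
  shows "gcomp E (act t \<sigma>) \<tau> = act t (gcomp E \<sigma> \<tau>)"
  using assms q_composable [OF assms(1-3)] by (simp add: act_eq_left base.rng_in_units)

lemma act_product_right [simp]:
  assumes "\<sigma> \<in> arrows E" "\<tau> \<in> arrows E" "src E \<sigma> = rng E \<tau>" "t \<in> ring_units"
  shows "gcomp E \<sigma> (act t \<tau>) = act t (gcomp E \<sigma> \<tau>)"
  using assms q_composable [OF assms(1-3)] by (simp add: act_eq_right base.src_in_units)

lemma inv_act [simp]:
  assumes "\<sigma> \<in> arrows E" "t \<in> ring_units"
  shows "ginv E (act t \<sigma>) = act (unit_inv t) (ginv E \<sigma>)"
proof -
  have "act (unit_inv t) (ginv E \<sigma>) = ginv E (act t \<sigma>)"
    by (rule total.inv_unique) (use assms in simp_all)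
  then show ?thesis by simp
qed

text \<open>Together with the next lemma: each fibre of \<open>q\<close> is a single free orbit of the ring units. The
  point is that \<open>\<tau> \<sigma>\<^sup>-\<^sup>1\<close> lies over a unit of \<open>G\<close> when \<open>\<sigma>\<close> and \<open>\<tau>\<close> lie in the same fibre.\<close>

lemma act_free:
  assumes "\<sigma> \<in> arrows E" "t \<in> ring_units" "u \<in> ring_units" "act t \<sigma> = act u \<sigma>"
  shows "t = u"
proof -
  let ?x = "rng G (q \<sigma>)"
  have "i (?x, v) = gcomp E (act v \<sigma>) (ginv E \<sigma>)" if "v \<in> ring_units" for v
  proof -
    have "gcomp E (act v \<sigma>) (ginv E \<sigma>) = act v (rng E \<sigma>)"
      using that assms by simp
    also have "\<dots> = i (?x, v)"
      using that assms by (simp add: act_eq_left base.rng_in_units)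
    finally show ?thesis by simp
  qed
  then have "i (?x, t) = i (?x, u)"
    using assms by metis
  then show ?thesis
    using inj_onD [OF i_inj, of "(?x, t)" "(?x, u)"] assms by (simp add: base.rng_in_units)
qed

lemma act_transitive:
  assumes "\<sigma> \<in> arrows E" "\<tau> \<in> arrows E" "q \<sigma> = q \<tau>"
  obtains t where "t \<in> ring_units" "\<tau> = act t \<sigma>"
proof -
  have eq: "rng E \<sigma> = rng E \<tau>" "src E \<sigma> = src E \<tau>"
    using assms rng_eq_iff src_eq_iff by auto
  let ?\<rho> = "gcomp E \<tau> (ginv E \<sigma>)"
  have \<rho>: "?\<rho> \<in> arrows E" "q ?\<rho> = rng G (q \<sigma>)"
    using assms eq by simp_all
  then have "?\<rho> \<in> preimage E q {rng G (q \<sigma>)}"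
    by (simp add: preimage_def)
  then obtain t where t: "t \<in> ring_units" "?\<rho> = i (rng G (q \<sigma>), t)"
    using i_fibre [of "rng G (q \<sigma>)"] assms base.rng_in_units by (auto simp: image_iff)
  have "act t \<sigma> = gcomp E ?\<rho> \<sigma>"
    using assms t by (simp add: act_eq_left)
  also have "\<dots> = \<tau>"
    using assms eq by simp
  finally show thesis
    using that t(1) by simp
qed


section \<open>Topology of a twist\<close>

lemma continuous_i:
  assumes "t \<in> ring_units"
  shows "continuous_map (unit_top G) (gtop E) (\<lambda>x. i (x, t))"
proof -
  have "continuous_map (unit_top G) (gtop (trivial_bundle G)) (\<lambda>x. (x, t))"
    using assms by (simp add: trivial_bundle_simps continuous_map_paired)
  moreover have "continuous_map (gtop (trivial_bundle G)) (gtop E) i"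
    using i_hom by (simp add: continuous_groupoid_hom_def)
  ultimately show ?thesis
    using continuous_map_compose by (fastforce simp: o_def)
qed

lemma continuous_act:
  assumes "t \<in> ring_units"
  shows "continuous_map (gtop E) (gtop E) (act t)"
proof -
  have "continuous_map (gtop E) (unit_top G) (\<lambda>\<sigma>. rng G (q \<sigma>))"
    using continuous_map_compose [OF continuous_q base.continuous_rng_units] by (simp add: o_def)
  then have "continuous_map (gtop E) (gtop E) (\<lambda>\<sigma>. i (rng G (q \<sigma>), t))"
    using continuous_map_compose continuous_i [OF assms] by (fastforce simp: o_def)
  then have "continuous_map (gtop E) (gtop E) (\<lambda>\<sigma>. gcomp E (i (rng G (q \<sigma>), t)) \<sigma>)"
    by (rule total.continuous_product [OF _ continuous_map_id [unfolded id_def]])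
       (use assms base.rng_in_units in simp)
  then show ?thesis
    by (rule continuous_map_eq) (simp add: act_eq_left)
qed

lemma openin_act_image:
  assumes "openin (gtop E) W" "t \<in> ring_units"
  shows "openin (gtop E) (act t ` W)"
proof -
  have W: "W \<subseteq> arrows E"
    using openin_subset [OF assms(1)] by simp
  have "act t ` W = {\<sigma> \<in> topspace (gtop E). act (unit_inv t) \<sigma> \<in> W}"
  proof (intro set_eqI iffI)
    fix \<sigma> assume "\<sigma> \<in> {\<sigma> \<in> topspace (gtop E). act (unit_inv t) \<sigma> \<in> W}"
    then have "act (unit_inv t) \<sigma> \<in> W" "\<sigma> = act t (act (unit_inv t) \<sigma>)"
      using assms by simp_all
    then show "\<sigma> \<in> act t ` W" by blast
  qed (use assms W in auto)
  then show ?thesis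
    using openin_continuous_map_preimage [OF continuous_act assms(1)] assms(2) by simp
qed

lemma openin_q_preimage: "openin (gtop G) D \<Longrightarrow> openin (gtop E) (preimage E q D)"
  using openin_continuous_map_preimage [OF continuous_q] by (simp add: preimage_def)

lemma closedin_q_preimage: "closedin (gtop G) D \<Longrightarrow> closedin (gtop E) (preimage E q D)"
  using closedin_continuous_map_preimage [OF continuous_q] by (simp add: preimage_def)

text \<open>The map \<open>q\<close> is a local homeomorphism: the group of ring units is discrete, so a local
  trivialisation \<open>D \<times> ring_units\<close> of the twist splits into open copies of \<open>D\<close>.\<close>

lemma q_local_homeomorphism:
  assumes W: "openin (gtop E) W" and \<sigma>: "\<sigma> \<in> W"
  obtains S where "openin (gtop E) S" "\<sigma> \<in> S" "S \<subseteq> W" "inj_on q S" "openin (gtop G) (q ` S)"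
proof -
  have sub: "W \<subseteq> arrows E"
    using openin_subset [OF W] by simp
  then have q\<sigma>: "q \<sigma> \<in> arrows G" using \<sigma> by auto
  obtain D p where D: "openin (gtop G) D" "q \<sigma> \<in> D" and p: "\<forall>\<beta>\<in>D. q (p \<beta>) = \<beta>"
    and cp: "continuous_map (subtopology (gtop G) D) (gtop E) p"
    and hom: "homeomorphic_map
                  (prod_topology (subtopology (gtop G) D) (discrete_topology ring_units))
                  (subtopology (gtop E) (preimage E q D))
                  (\<lambda>(\<beta>, t). gcomp E (i (rng G \<beta>, t)) (p \<beta>))"
    using local_sections [OF q\<sigma>] by blast
  let ?X = "prod_topology (subtopology (gtop G) D) (discrete_topology (ring_units :: 'r set))"
  let ?\<Phi> = "\<lambda>(\<beta>, t). gcomp E (i (rng G \<beta>, t)) (p \<beta>)"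
  have DG: "D \<subseteq> arrows G"
    using openin_subset [OF D(1)] by simp
  have pE: "p \<beta> \<in> arrows E" if "\<beta> \<in> D" for \<beta>
    using cp that DG by (force simp: continuous_map_def)
  have \<Phi>: "?\<Phi> (\<beta>, t) = act t (p \<beta>)" if "\<beta> \<in> D" for \<beta> t
    using that pE p by (simp add: act_eq_left)
  have qW: "openin (gtop E) (preimage E q D)"
    by (rule openin_q_preimage [OF D(1)])
  have top: "topspace ?X = D \<times> ring_units"
    using DG by auto
  obtain t where t: "t \<in> ring_units" "\<sigma> = act t (p (q \<sigma>))"
    using act_transitive [of "p (q \<sigma>)" \<sigma>] pE p D(2) sub \<sigma> by (metis subsetD)
  define S where "S = ?\<Phi> ` (D \<times> {t}) \<inter> W"
  have S\<Phi>: "S = (\<lambda>\<beta>. act t (p \<beta>)) ` D \<inter> W"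
    using \<Phi> by (force simp: S_def image_iff)
  have "openin ?X (D \<times> {t})"
    using t(1) by (simp add: openin_prod_Times_iff openin_subtopology_refl DG)
  then have "openin (subtopology (gtop E) (preimage E q D)) (?\<Phi> ` (D \<times> {t}))"
    using homeomorphic_imp_open_map [OF hom] unfolding open_map_def by blast
  then have "openin (gtop E) (?\<Phi> ` (D \<times> {t}))"
    using qW openin_trans_full by blast
  then have S: "openin (gtop E) S"
    unfolding S_def using W by (rule openin_Int)
  moreover have "\<sigma> \<in> S"
    using \<sigma> t(2) D(2) unfolding S\<Phi> by blast
  moreover have "S \<subseteq> W"
    by (simp add: S_def)
  moreover have "inj_on q S"
    using p pE t(1) by (auto simp: S\<Phi> inj_on_def)
  moreover have "openin (gtop G) (q ` S)"
  proof -
    have "continuous_map (subtopology (gtop G) D) (gtop E) (act t \<circ> p)"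
      using continuous_map_compose [OF cp continuous_act [OF t(1)]] .
    from openin_continuous_map_preimage [OF this W]
    have "openin (gtop G) {\<beta> \<in> D. act t (p \<beta>) \<in> W}"
      using D(1) DG by (simp add: openin_open_subtopology Int_absorb1)
    moreover have "q ` S = {\<beta> \<in> D. act t (p \<beta>) \<in> W}"
      using p pE t(1) by (force simp: S\<Phi> image_iff)
    ultimately show ?thesis by simp
  qed
  ultimately show thesis by (rule that)
qed

lemma openin_q_image:
  assumes "openin (gtop E) W"
  shows "openin (gtop G) (q ` W)"
proof (subst openin_subopen, intro ballI)
  fix \<alpha> assume "\<alpha> \<in> q ` W"
  then obtain \<sigma> where "\<sigma> \<in> W" "\<alpha> = q \<sigma>" by blast
  then show "\<exists>T. openin (gtop G) T \<and> \<alpha> \<in> T \<and> T \<subseteq> q ` W"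
    using q_local_homeomorphism [OF assms] by (metis image_mono imageI)
qed

text \<open>The unit section \<open>x \<mapsto> i (x, 1)\<close> is continuous, so near a unit it stays in an open set on
  which \<open>q\<close> is injective; there it is the only section of \<open>q\<close>.\<close>

lemma openin_units_total: "openin (gtop E) (units E)"
proof (subst openin_subopen, intro ballI)
  fix u assume u: "u \<in> units E"
  then obtain S where S: "openin (gtop E) S" "u \<in> S" "inj_on q S"
    using q_local_homeomorphism [of "arrows E" u] total.units_arrows
    by (metis openin_topspace total.topspace_gtop)
  have sub: "S \<subseteq> arrows E"
    using openin_subset [OF S(1)] by simp
  define V where "V = {x \<in> units G. i (x, 1) \<in> S}"
  have "openin (unit_top G) V"
    using openin_continuous_map_preimage [OF continuous_i S(1)] by (simp add: V_def)
  then have "openin (gtop G) V"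
    by (simp add: base.openin_unit_top_iff)
  then have "openin (gtop E) (S \<inter> preimage E q V)"
    using S(1) openin_q_preimage by blast
  moreover have "u \<in> S \<inter> preimage E q V"
    using S(2) sub u unit_eq_i [OF u] q_in_units [OF u] by (auto simp: V_def preimage_def)
  moreover have "S \<inter> preimage E q V \<subseteq> units E"
  proof
    fix \<sigma> assume "\<sigma> \<in> S \<inter> preimage E q V"
    then have \<sigma>: "\<sigma> \<in> S" "q \<sigma> \<in> units G" "i (q \<sigma>, 1) \<in> S"
      by (auto simp: V_def preimage_def)
    then have "\<sigma> = i (q \<sigma>, 1)"
      using inj_onD [OF S(3), of \<sigma> "i (q \<sigma>, 1)"] by simp
    then show "\<sigma> \<in> units E"
      using i_one_unit [OF \<sigma>(2)] by simp
  qed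
  ultimately show "\<exists>T. openin (gtop E) T \<and> u \<in> T \<and> T \<subseteq> units E" by blast
qed

end

section \<open>Convolution of equivariant functions\<close>

context discrete_twist
begin

abbreviation conv :: "('s \<Rightarrow> 'r) \<Rightarrow> ('s \<Rightarrow> 'r) \<Rightarrow> 's \<Rightarrow> 'r" (infixl \<open>\<star>\<close> 70) where
  "f \<star> g \<equiv> convolution G E q f g"

text \<open>Bilinearity and associativity of the convolution hold for equivariant functions with finitely many
  arrows of each range in their support. Isolating this class separates the algebra of the product
  from the topology of the groupoid.\<close>

definition equivariant :: "('s \<Rightarrow> 'r) \<Rightarrow> bool" where
  "equivariant f \<longleftrightarrow> (\<forall>\<sigma>. \<sigma> \<notin> arrows E \<longrightarrow> f \<sigma> = 0) \<and>
     (\<forall>t\<in>ring_units. \<forall>\<sigma>\<in>arrows E. f (act t \<sigma>) = unit_inv t * f \<sigma>)"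

definition fibre_finite :: "('s \<Rightarrow> 'r) \<Rightarrow> bool" where
  "fibre_finite f \<longleftrightarrow> (\<forall>x. finite {\<alpha> \<in> q ` supp E f. rng G \<alpha> = x})"

lemma equivariant_act [simp]:
  "equivariant f \<Longrightarrow> t \<in> ring_units \<Longrightarrow> \<sigma> \<in> arrows E \<Longrightarrow> f (act t \<sigma>) = unit_inv t * f \<sigma>"
  by (simp add: equivariant_def)

lemma equivariant_outside: "equivariant f \<Longrightarrow> \<sigma> \<notin> arrows E \<Longrightarrow> f \<sigma> = 0"
  by (simp add: equivariant_def)

lemma equivariant_nonzero_arrows: "equivariant f \<Longrightarrow> f \<sigma> \<noteq> 0 \<Longrightarrow> \<sigma> \<in> arrows E"
  using equivariant_outside by blast

lemma q_supp_subset: "q ` supp E f \<subseteq> arrows G"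
  by (auto simp: supp_def)

lemma q_supp_I: "\<sigma> \<in> arrows E \<Longrightarrow> f \<sigma> \<noteq> 0 \<Longrightarrow> q \<sigma> \<in> q ` supp E f"
  by (simp add: supp_def)

lemma q_in_q_supp_iff:
  assumes "equivariant f" "\<sigma> \<in> arrows E"
  shows "q \<sigma> \<in> q ` supp E f \<longleftrightarrow> f \<sigma> \<noteq> 0"
proof
  assume "q \<sigma> \<in> q ` supp E f"
  then obtain \<tau> where \<tau>: "\<tau> \<in> arrows E" "f \<tau> \<noteq> 0" "q \<sigma> = q \<tau>"
    by (auto simp: supp_def)
  then obtain t where "t \<in> ring_units" "\<tau> = act t \<sigma>"
    using act_transitive assms(2) by metis
  then show "f \<sigma> \<noteq> 0"
    using \<tau>(2) assms by auto
qed (use q_supp_I assms in blast)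

text \<open>Replacing \<open>\<tau>\<close> by \<open>t \<cdot> \<tau>\<close> multiplies the first factor by the inverse of \<open>t\<close> and
  the second by \<open>t\<close>.\<close>

lemma convolution_term_cong:
  assumes fg: "equivariant f" "equivariant g"
    and \<sigma>: "\<sigma> \<in> arrows E" and \<tau>: "\<tau> \<in> arrows E" and \<tau>': "\<tau>' \<in> arrows E"
    and r: "rng E \<tau> = rng E \<sigma>" and q: "q \<tau> = q \<tau>'"
  shows "f \<tau> * g (gcomp E (ginv E \<tau>) \<sigma>) = f \<tau>' * g (gcomp E (ginv E \<tau>') \<sigma>)"
proof -
  obtain t where t: "t \<in> ring_units" "\<tau>' = act t \<tau>"
    using act_transitive [OF \<tau> \<tau>' q] .
  have "gcomp E (ginv E \<tau>') \<sigma> = act (unit_inv t) (gcomp E (ginv E \<tau>) \<sigma>)"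
    using t \<sigma> \<tau> r by simp
  then have "g (gcomp E (ginv E \<tau>') \<sigma>) = t * g (gcomp E (ginv E \<tau>) \<sigma>)"
    using t fg \<sigma> \<tau> r by simp
  moreover have "f \<tau>' = unit_inv t * f \<tau>"
    using t fg \<tau> by simp
  ultimately show ?thesis
    using t(1) by (simp add: ac_simps)
qed

text \<open>The value of a convolution does not depend on the section of \<open>q\<close>, and the sum may run over
  any finite family of lifts that meets every fibre of \<open>q\<close> with a non-zero summand.\<close>

lemma convolution_eq_sum:
  assumes fg: "equivariant f" "equivariant g" and fin: "fibre_finite f"
    and \<sigma>: "\<sigma> \<in> arrows E" and J: "finite J"
    and T: "\<And>j. j \<in> J \<Longrightarrow> T j \<in> arrows E" "\<And>j. j \<in> J \<Longrightarrow> rng E (T j) = rng E \<sigma>"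
    and inj: "inj_on (\<lambda>j. q (T j)) J"
    and zero: "\<And>\<tau>. \<tau> \<in> arrows E \<Longrightarrow> rng E \<tau> = rng E \<sigma> \<Longrightarrow> q \<tau> \<notin> (\<lambda>j. q (T j)) ` J
                 \<Longrightarrow> f \<tau> * g (gcomp E (ginv E \<tau>) \<sigma>) = 0"
  shows "(f \<star> g) \<sigma> = (\<Sum>j\<in>J. f (T j) * g (gcomp E (ginv E (T j)) \<sigma>))"
proof -
  define S where "S = inv_into (supp E f) q"
  define F0 where "F0 = {\<alpha> \<in> arrows G. rng G \<alpha> = q (rng E \<sigma>)} \<inter> q ` supp E f"
  define F where "F = (\<lambda>j. q (T j)) ` J"
  define T' where "T' = (\<lambda>\<alpha>. T (inv_into J (\<lambda>j. q (T j)) \<alpha>))"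
  let ?t = "\<lambda>\<tau>. f \<tau> * g (gcomp E (ginv E \<tau>) \<sigma>)"
  have T'T: "T' (q (T j)) = T j" if "j \<in> J" for j
    unfolding T'_def using inv_into_f_f [OF inj that] by simp
  have T': "T' \<alpha> \<in> arrows E" "q (T' \<alpha>) = \<alpha>" "rng E (T' \<alpha>) = rng E \<sigma>" if "\<alpha> \<in> F" for \<alpha>
    using that T'T T by (auto simp: F_def)
  have S: "S \<alpha> \<in> arrows E" "q (S \<alpha>) = \<alpha>" "rng E (S \<alpha>) = rng E \<sigma>" if "\<alpha> \<in> F0" for \<alpha>
  proof -
    have "S \<alpha> \<in> supp E f" "q (S \<alpha>) = \<alpha>"
      using that inv_into_into [of \<alpha> q "supp E f"] f_inv_into_f [of \<alpha> q "supp E f"]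
      by (auto simp: S_def F0_def)
    moreover from this show "S \<alpha> \<in> arrows E" by (simp add: supp_def)
    ultimately show "q (S \<alpha>) = \<alpha>" "rng E (S \<alpha>) = rng E \<sigma>"
      using that \<sigma> by (simp_all add: F0_def rng_eq_iff)
  qed
  have fin0: "finite F0"
    by (rule finite_subset [of _ "{\<alpha> \<in> q ` supp E f. rng G \<alpha> = q (rng E \<sigma>)}"])
       (use fin in \<open>auto simp: F0_def fibre_finite_def\<close>)
  have finF: "finite F"
    using J by (simp add: F_def)
  have "(f \<star> g) \<sigma> = (\<Sum>\<alpha>\<in>F0. ?t (S \<alpha>))"
    using \<sigma> by (simp add: convolution_def S_def F0_def Let_def)
  also have "\<dots> = (\<Sum>\<alpha>\<in>F0 \<inter> F. ?t (S \<alpha>))"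
  proof (rule sum.mono_neutral_right [OF fin0])
    show "\<forall>\<alpha>\<in>F0 - F0 \<inter> F. ?t (S \<alpha>) = 0"
      using S zero unfolding F_def [symmetric] by (metis Diff_iff Int_iff)
  qed auto
  also have "\<dots> = (\<Sum>\<alpha>\<in>F0 \<inter> F. ?t (T' \<alpha>))"
  proof (rule sum.cong [OF refl])
    fix \<alpha> assume "\<alpha> \<in> F0 \<inter> F"
    then show "?t (S \<alpha>) = ?t (T' \<alpha>)"
      using S T' by (intro convolution_term_cong [OF fg \<sigma>]) auto
  qed
  also have "\<dots> = (\<Sum>\<alpha>\<in>F. ?t (T' \<alpha>))"
  proof (rule sum.mono_neutral_left [OF finF])
    show "\<forall>\<alpha>\<in>F - F0 \<inter> F. ?t (T' \<alpha>) = 0"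
    proof
      fix \<alpha> assume \<alpha>: "\<alpha> \<in> F - F0 \<inter> F"
      then have "rng G (q (T' \<alpha>)) = q (rng E \<sigma>)"
        using T' [of \<alpha>] q_rng [of "T' \<alpha>"] by simp
      then have "f (T' \<alpha>) = 0"
        using \<alpha> T' [of \<alpha>] q_supp_I [of "T' \<alpha>" f] q_arrows [of "T' \<alpha>"] by (auto simp: F0_def)
      then show "?t (T' \<alpha>) = 0" by simp
    qed
  qed auto
  also have "\<dots> = (\<Sum>j\<in>J. ?t (T' (q (T j))))"
    unfolding F_def using sum.reindex [OF inj] by simp
  also have "\<dots> = (\<Sum>j\<in>J. ?t (T j))"
    using T'T by simp
  finally show ?thesis .
qed

lemma convolution_eq_term:
  assumes "equivariant f" "equivariant g" "fibre_finite f" "\<sigma> \<in> arrows E"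
    and "\<tau> \<in> arrows E" "rng E \<tau> = rng E \<sigma>"
    and "\<And>\<rho>. \<rho> \<in> arrows E \<Longrightarrow> rng E \<rho> = rng E \<sigma> \<Longrightarrow> f \<rho> \<noteq> 0
            \<Longrightarrow> g (gcomp E (ginv E \<rho>) \<sigma>) \<noteq> 0 \<Longrightarrow> q \<rho> = q \<tau>"
  shows "(f \<star> g) \<sigma> = f \<tau> * g (gcomp E (ginv E \<tau>) \<sigma>)"
proof -
  have "(f \<star> g) \<sigma> = (\<Sum>j\<in>{()}. f \<tau> * g (gcomp E (ginv E \<tau>) \<sigma>))"
  proof (rule convolution_eq_sum)
    fix \<rho> assume "\<rho> \<in> arrows E" "rng E \<rho> = rng E \<sigma>" "q \<rho> \<notin> (\<lambda>_. q \<tau>) ` {()}"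
    then have "f \<rho> = 0 \<or> g (gcomp E (ginv E \<rho>) \<sigma>) = 0"
      using assms(7) by blast
    then show "f \<rho> * g (gcomp E (ginv E \<rho>) \<sigma>) = 0" by auto
  qed (use assms in auto)
  then show ?thesis by simp
qed

lemma convolution_outside [simp]: "\<sigma> \<notin> arrows E \<Longrightarrow> (f \<star> g) \<sigma> = 0"
  by (simp add: convolution_def)

lemma convolution_nonzeroE:
  assumes "(f \<star> g) \<sigma> \<noteq> 0"
  obtains \<tau> where "\<sigma> \<in> arrows E" "\<tau> \<in> arrows E" "rng E \<tau> = rng E \<sigma>"
    "f \<tau> \<noteq> 0" "g (gcomp E (ginv E \<tau>) \<sigma>) \<noteq> 0"
proof -
  define S where "S = inv_into (supp E f) q"
  define F where "F = {\<alpha> \<in> arrows G. rng G \<alpha> = q (rng E \<sigma>)} \<inter> q ` supp E f"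
  have \<sigma>: "\<sigma> \<in> arrows E"
    using assms convolution_outside by blast
  then have "(\<Sum>\<alpha>\<in>F. f (S \<alpha>) * g (gcomp E (ginv E (S \<alpha>)) \<sigma>)) \<noteq> 0"
    using assms by (simp add: convolution_def S_def F_def Let_def)
  then obtain \<alpha> where \<alpha>: "\<alpha> \<in> F" "f (S \<alpha>) * g (gcomp E (ginv E (S \<alpha>)) \<sigma>) \<noteq> 0"
    by (rule sum.not_neutral_contains_not_neutral)
  have S: "S \<alpha> \<in> supp E f" "q (S \<alpha>) = \<alpha>"
    using \<alpha>(1) inv_into_into [of \<alpha> q "supp E f"] f_inv_into_f [of \<alpha> q "supp E f"]
    by (auto simp: S_def F_def)
  then have SE: "S \<alpha> \<in> arrows E" "f (S \<alpha>) \<noteq> 0"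
    by (simp_all add: supp_def)
  moreover have "rng E (S \<alpha>) = rng E \<sigma>"
    using \<alpha>(1) S SE(1) \<sigma> by (simp add: F_def rng_eq_iff)
  moreover have "g (gcomp E (ginv E (S \<alpha>)) \<sigma>) \<noteq> 0"
    using \<alpha>(2) by auto
  ultimately show thesis
    using that \<sigma> by blast
qed

lemma equivariant_convolution:
  assumes "equivariant g"
  shows "equivariant (f \<star> g)"
  unfolding equivariant_def
proof (intro conjI ballI allI impI)
  fix t \<sigma> assume t: "t \<in> (ring_units :: 'r set)" and \<sigma>: "\<sigma> \<in> arrows E"
  define S where "S = inv_into (supp E f) q"
  define F where "F = {\<alpha> \<in> arrows G. rng G \<alpha> = q (rng E \<sigma>)} \<inter> q ` supp E f"
  have "f (S \<alpha>) * g (gcomp E (ginv E (S \<alpha>)) (act t \<sigma>))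
      = unit_inv t * (f (S \<alpha>) * g (gcomp E (ginv E (S \<alpha>)) \<sigma>))" if "\<alpha> \<in> F" for \<alpha>
  proof -
    have S: "S \<alpha> \<in> supp E f" "q (S \<alpha>) = \<alpha>"
      using that inv_into_into [of \<alpha> q "supp E f"] f_inv_into_f [of \<alpha> q "supp E f"]
      by (auto simp: S_def F_def)
    then have SE: "S \<alpha> \<in> arrows E"
      by (simp add: supp_def)
    then have "rng E (S \<alpha>) = rng E \<sigma>"
      using that S \<sigma> by (simp add: F_def rng_eq_iff)
    then show ?thesis
      using SE t \<sigma> assms by (simp add: ac_simps)
  qed
  then show "(f \<star> g) (act t \<sigma>) = unit_inv t * (f \<star> g) \<sigma>"
    using t \<sigma> by (simp add: convolution_def S_def F_def Let_def sum_distrib_left)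
qed simp

definition lift :: "'g \<Rightarrow> 's" where
  "lift = inv_into (arrows E) q"

lemma
  assumes "\<alpha> \<in> arrows G"
  shows lift_arrows [simp]: "lift \<alpha> \<in> arrows E" and q_lift [simp]: "q (lift \<alpha>) = \<alpha>"
  using assms q_surj unfolding lift_def by (metis inv_into_into, metis f_inv_into_f)

lemma convolution_eq_sum_lift:
  assumes fg: "equivariant f" "equivariant g" "fibre_finite f"
    and \<sigma>: "\<sigma> \<in> arrows E" and F: "finite F" "F \<subseteq> {\<alpha> \<in> arrows G. rng G \<alpha> = rng G (q \<sigma>)}"
    and zero: "\<And>\<tau>. \<tau> \<in> arrows E \<Longrightarrow> rng E \<tau> = rng E \<sigma> \<Longrightarrow> f \<tau> \<noteq> 0
                 \<Longrightarrow> g (gcomp E (ginv E \<tau>) \<sigma>) \<noteq> 0 \<Longrightarrow> q \<tau> \<in> F"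
  shows "(f \<star> g) \<sigma> = (\<Sum>\<alpha>\<in>F. f (lift \<alpha>) * g (gcomp E (ginv E (lift \<alpha>)) \<sigma>))"
proof (rule convolution_eq_sum [OF fg \<sigma> F(1)])
  fix \<alpha> assume \<alpha>: "\<alpha> \<in> F"
  then show l: "lift \<alpha> \<in> arrows E"
    using F by auto
  show "rng E (lift \<alpha>) = rng E \<sigma>"
    using \<alpha> F \<sigma> l by (subst rng_eq_iff) auto
next
  have q: "q (lift \<alpha>) = \<alpha>" if "\<alpha> \<in> F" for \<alpha>
    using that F by auto
  then show "inj_on (\<lambda>\<alpha>. q (lift \<alpha>)) F"
    by (simp add: inj_on_def)
  fix \<tau> assume \<tau>: "\<tau> \<in> arrows E" "rng E \<tau> = rng E \<sigma>" and "q \<tau> \<notin> (\<lambda>\<alpha>. q (lift \<alpha>)) ` F"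
  then have "q \<tau> \<notin> F"
    using q by force
  then have "f \<tau> = 0 \<or> g (gcomp E (ginv E \<tau>) \<sigma>) = 0"
    using zero \<tau> by blast
  then show "f \<tau> * g (gcomp E (ginv E \<tau>) \<sigma>) = 0" by auto
qed

lemma fibre_finiteD: "fibre_finite f \<Longrightarrow> finite {\<alpha> \<in> q ` supp E f. rng G \<alpha> = x}"
  by (simp add: fibre_finite_def)

lemma supp_fibre_subset: "{\<alpha> \<in> q ` supp E f. rng G \<alpha> = x} \<subseteq> {\<alpha> \<in> arrows G. rng G \<alpha> = x}"
  using q_supp_subset by blast

lemma q_in_supp_fibre:
  assumes "\<sigma> \<in> arrows E" "\<tau> \<in> arrows E" "rng E \<tau> = rng E \<sigma>" "f \<tau> \<noteq> 0"
  shows "q \<tau> \<in> {\<alpha> \<in> q ` supp E f. rng G \<alpha> = rng G (q \<sigma>)}"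
  using assms rng_eq_iff [of \<tau> \<sigma>] q_supp_I [of \<tau> f] by simp

lemma equivariant_add: "equivariant f \<Longrightarrow> equivariant g \<Longrightarrow> equivariant (f + g)"
  by (simp add: equivariant_def distrib_left)

lemma equivariant_scale: "equivariant f \<Longrightarrow> equivariant (fun_scale c f)"
  by (simp add: equivariant_def fun_scale_def ac_simps)

lemma fibre_finite_add:
  assumes "fibre_finite f" "fibre_finite f'"
  shows "fibre_finite (f + f')"
  unfolding fibre_finite_def
proof
  fix x
  have "{\<alpha> \<in> q ` supp E (f + f'). rng G \<alpha> = x}
      \<subseteq> {\<alpha> \<in> q ` supp E f. rng G \<alpha> = x} \<union> {\<alpha> \<in> q ` supp E f'. rng G \<alpha> = x}"
    by (auto simp: supp_def)
  then show "finite {\<alpha> \<in> q ` supp E (f + f'). rng G \<alpha> = x}"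
    by (rule finite_subset) (intro finite_UnI fibre_finiteD assms)
qed

lemma fibre_finite_scale:
  assumes "fibre_finite f"
  shows "fibre_finite (fun_scale c f)"
  unfolding fibre_finite_def
proof
  fix x
  have "{\<alpha> \<in> q ` supp E (fun_scale c f). rng G \<alpha> = x} \<subseteq> {\<alpha> \<in> q ` supp E f. rng G \<alpha> = x}"
    by (auto simp: supp_def fun_scale_def)
  then show "finite {\<alpha> \<in> q ` supp E (fun_scale c f). rng G \<alpha> = x}"
    using assms fibre_finiteD finite_subset by blast
qed

lemma convolution_add_right: "f \<star> (g + h) = f \<star> g + f \<star> h"
  by (auto simp: fun_eq_iff convolution_def Let_def distrib_left sum.distrib)

lemma convolution_scale_right: "f \<star> fun_scale c g = fun_scale c (f \<star> g)"
  by (auto simp: fun_eq_iff convolution_def fun_scale_def Let_def sum_distrib_left ac_simps)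

lemma convolution_scale_left:
  assumes f: "equivariant f" "fibre_finite f" and g: "equivariant g"
  shows "fun_scale c f \<star> g = fun_scale c (f \<star> g)"
proof
  fix \<sigma>
  show "(fun_scale c f \<star> g) \<sigma> = fun_scale c (f \<star> g) \<sigma>"
  proof (cases "\<sigma> \<in> arrows E")
    case True
    let ?F = "{\<alpha> \<in> q ` supp E f. rng G \<alpha> = rng G (q \<sigma>)}"
    note F = fibre_finiteD [OF f(2)] supp_fibre_subset
    have "(fun_scale c f \<star> g) \<sigma>
        = (\<Sum>\<alpha>\<in>?F. fun_scale c f (lift \<alpha>) * g (gcomp E (ginv E (lift \<alpha>)) \<sigma>))"
    proof (rule convolution_eq_sum_lift [OF equivariant_scale [OF f(1)] g fibre_finite_scale [OF f(2)] True F])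
      fix \<tau> assume "\<tau> \<in> arrows E" "rng E \<tau> = rng E \<sigma>" "fun_scale c f \<tau> \<noteq> 0"
      then show "q \<tau> \<in> ?F"
        by (intro q_in_supp_fibre [OF True]) (auto simp: fun_scale_def)
    qed
    moreover have "(f \<star> g) \<sigma> = (\<Sum>\<alpha>\<in>?F. f (lift \<alpha>) * g (gcomp E (ginv E (lift \<alpha>)) \<sigma>))"
      by (rule convolution_eq_sum_lift [OF f(1) g f(2) True F]) (rule q_in_supp_fibre [OF True])
    ultimately show ?thesis
      by (simp add: fun_scale_def sum_distrib_left ac_simps)
  qed (simp add: fun_scale_def)
qed

lemma convolution_add_left:
  assumes f: "equivariant f" "fibre_finite f" and f': "equivariant f'" "fibre_finite f'"
    and g: "equivariant g"
  shows "(f + f') \<star> g = f \<star> g + f' \<star> g"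
proof
  fix \<sigma>
  show "((f + f') \<star> g) \<sigma> = (f \<star> g + f' \<star> g) \<sigma>"
  proof (cases "\<sigma> \<in> arrows E")
    case True
    let ?F = "{\<alpha> \<in> q ` supp E f. rng G \<alpha> = rng G (q \<sigma>)} \<union> {\<alpha> \<in> q ` supp E f'. rng G \<alpha> = rng G (q \<sigma>)}"
    have F: "finite ?F" "?F \<subseteq> {\<alpha> \<in> arrows G. rng G \<alpha> = rng G (q \<sigma>)}"
      by (intro finite_UnI fibre_finiteD f f') (intro Un_least supp_fibre_subset)
    have sum: "(h \<star> g) \<sigma> = (\<Sum>\<alpha>\<in>?F. h (lift \<alpha>) * g (gcomp E (ginv E (lift \<alpha>)) \<sigma>))"
      if h: "equivariant h" "fibre_finite h" "\<And>\<tau>. h \<tau> \<noteq> 0 \<Longrightarrow> f \<tau> \<noteq> 0 \<or> f' \<tau> \<noteq> 0" for h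
    proof (rule convolution_eq_sum_lift [OF h(1) g h(2) True F])
      fix \<tau> assume "\<tau> \<in> arrows E" "rng E \<tau> = rng E \<sigma>" "h \<tau> \<noteq> 0"
      then show "q \<tau> \<in> ?F"
        using h(3) q_in_supp_fibre [OF True] by blast
    qed
    have "f \<tau> \<noteq> 0 \<or> f' \<tau> \<noteq> 0" if "(f + f') \<tau> \<noteq> 0" for \<tau>
      using that by auto
    from sum [OF equivariant_add [OF f(1) f'(1)] fibre_finite_add [OF f(2) f'(2)] this]
    show ?thesis
      using sum [OF f] sum [OF f'] by (simp add: distrib_right sum.distrib)
  qed simp
qed

text \<open>The set \<open>\<Gamma> x\<close> consists of the products with range \<open>x\<close> of an arrow in the support of \<open>f\<close> and an
  arrow in the support of \<open>g\<close>. It serves as a common index set for iterated convolutions.\<close>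

lemma finite_product_fibre:
  assumes "fibre_finite f" "fibre_finite g"
  defines "\<Gamma> \<equiv> \<lambda>x. \<Union>\<alpha>\<in>{\<alpha> \<in> q ` supp E f. rng G \<alpha> = x}.
                   gcomp G \<alpha> ` {\<beta> \<in> q ` supp E g. rng G \<beta> = src G \<alpha>}"
  shows "finite (\<Gamma> x)" "\<Gamma> x \<subseteq> {\<gamma> \<in> arrows G. rng G \<gamma> = x}"
    and "\<And>\<sigma> \<tau>. \<sigma> \<in> arrows E \<Longrightarrow> \<tau> \<in> arrows E \<Longrightarrow> rng G (q \<sigma>) = x \<Longrightarrow> src E \<sigma> = rng E \<tau>
           \<Longrightarrow> f \<sigma> \<noteq> 0 \<Longrightarrow> g \<tau> \<noteq> 0 \<Longrightarrow> gcomp G (q \<sigma>) (q \<tau>) \<in> \<Gamma> x"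
    and "\<And>\<sigma>. (f \<star> g) \<sigma> \<noteq> 0 \<Longrightarrow> rng G (q \<sigma>) = x \<Longrightarrow> q \<sigma> \<in> \<Gamma> x"
proof -
  show "finite (\<Gamma> x)"
    unfolding \<Gamma>_def using assms fibre_finiteD by blast
  show "\<Gamma> x \<subseteq> {\<gamma> \<in> arrows G. rng G \<gamma> = x}"
  proof
    fix \<gamma> assume "\<gamma> \<in> \<Gamma> x"
    then obtain \<alpha> \<beta> where "\<alpha> \<in> q ` supp E f" "rng G \<alpha> = x" "\<beta> \<in> q ` supp E g"
      "rng G \<beta> = src G \<alpha>" "\<gamma> = gcomp G \<alpha> \<beta>"
      unfolding \<Gamma>_def by blast
    moreover from this have "\<alpha> \<in> arrows G" "\<beta> \<in> arrows G"
      using q_supp_subset by blast+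
    ultimately show "\<gamma> \<in> {\<gamma> \<in> arrows G. rng G \<gamma> = x}" by simp
  qed
  show mem: "gcomp G (q \<sigma>) (q \<tau>) \<in> \<Gamma> x"
    if "\<sigma> \<in> arrows E" "\<tau> \<in> arrows E" "rng G (q \<sigma>) = x" "src E \<sigma> = rng E \<tau>"
      "f \<sigma> \<noteq> 0" "g \<tau> \<noteq> 0" for \<sigma> \<tau>
  proof -
    have "q \<sigma> \<in> {\<alpha> \<in> q ` supp E f. rng G \<alpha> = x}"
      using that q_supp_I by blast
    moreover have "q \<tau> \<in> {\<beta> \<in> q ` supp E g. rng G \<beta> = src G (q \<sigma>)}"
      using that q_supp_I q_composable by simp
    ultimately show ?thesis
      unfolding \<Gamma>_def by blast
  qed
  show "q \<sigma> \<in> \<Gamma> x" if nz: "(f \<star> g) \<sigma> \<noteq> 0" and x: "rng G (q \<sigma>) = x" for \<sigma>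
  proof -
    obtain \<tau> where \<tau>: "\<sigma> \<in> arrows E" "\<tau> \<in> arrows E" "rng E \<tau> = rng E \<sigma>"
      "f \<tau> \<noteq> 0" "g (gcomp E (ginv E \<tau>) \<sigma>) \<noteq> 0"
      using convolution_nonzeroE [OF nz] .
    have r: "rng G (q \<tau>) = rng G (q \<sigma>)"
      using \<tau> rng_eq_iff by blast
    have "gcomp G (q \<tau>) (q (gcomp E (ginv E \<tau>) \<sigma>)) \<in> \<Gamma> x"
      by (rule mem) (use \<tau> x r in simp_all)
    then show ?thesis
      using \<tau> r by simp
  qed
qed

lemma fibre_finite_convolution:
  assumes "fibre_finite f" "fibre_finite g"
  shows "fibre_finite (f \<star> g)"
  unfolding fibre_finite_def
proof
  fix x
  have "{\<alpha> \<in> q ` supp E (f \<star> g). rng G \<alpha> = x}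
      \<subseteq> (\<Union>\<alpha>\<in>{\<alpha> \<in> q ` supp E f. rng G \<alpha> = x}. gcomp G \<alpha> ` {\<beta> \<in> q ` supp E g. rng G \<beta> = src G \<alpha>})"
    using finite_product_fibre(4) [OF assms] by (auto simp: supp_def)
  then show "finite {\<alpha> \<in> q ` supp E (f \<star> g). rng G \<alpha> = x}"
    using finite_product_fibre(1) [OF assms] finite_subset by blast
qed

text \<open>Both bracketings at \<open>\<sigma>\<close> are the sum of \<open>f(T \<alpha>) g(T \<alpha>\<^sup>-\<^sup>1 T \<gamma>) h(T \<gamma>\<^sup>-\<^sup>1 \<sigma>)\<close> over \<open>\<alpha>\<close> in the
  support of \<open>f\<close> and \<open>\<gamma>\<close> in the product of the supports of \<open>f\<close> and \<open>g\<close>. For the right bracketing,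
  the inner sum is taken along the section \<open>T \<alpha>\<^sup>-\<^sup>1 T \<gamma>\<close>.\<close>

lemma convolution_assoc:
  assumes f: "equivariant f" "fibre_finite f" and g: "equivariant g" "fibre_finite g"
    and h: "equivariant h"
  shows "(f \<star> g) \<star> h = f \<star> (g \<star> h)"
proof
  fix \<sigma>
  show "((f \<star> g) \<star> h) \<sigma> = (f \<star> (g \<star> h)) \<sigma>"
  proof (cases "\<sigma> \<in> arrows E")
    case \<sigma>: True
    define x where "x = rng G (q \<sigma>)"
    define F where "F = {\<alpha> \<in> q ` supp E f. rng G \<alpha> = x}"
    define \<Gamma> where "\<Gamma> = (\<Union>\<alpha>\<in>{\<alpha> \<in> q ` supp E f. rng G \<alpha> = x}.
        gcomp G \<alpha> ` {\<beta> \<in> q ` supp E g. rng G \<beta> = src G \<alpha>})"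
    note \<Gamma> = finite_product_fibre [OF f(2) g(2), where x = x, folded \<Gamma>_def]
    have F: "finite F" "F \<subseteq> {\<alpha> \<in> arrows G. rng G \<alpha> = x}"
      unfolding F_def using fibre_finiteD [OF f(2)] supp_fibre_subset by blast+
    have lF: "lift \<alpha> \<in> arrows E" "q (lift \<alpha>) = \<alpha>" "rng E (lift \<alpha>) = rng E \<sigma>" if "\<alpha> \<in> F" for \<alpha>
      using that F \<sigma> by (auto simp: rng_eq_iff x_def)
    have l\<Gamma>: "lift \<gamma> \<in> arrows E" "q (lift \<gamma>) = \<gamma>" "rng E (lift \<gamma>) = rng E \<sigma>" if "\<gamma> \<in> \<Gamma>" for \<gamma>
      using that \<Gamma>(2) \<sigma> by (auto simp: rng_eq_iff x_def)
    have fg: "(f \<star> g) (lift \<gamma>) = (\<Sum>\<alpha>\<in>F. f (lift \<alpha>) * g (gcomp E (ginv E (lift \<alpha>)) (lift \<gamma>)))"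
      if "\<gamma> \<in> \<Gamma>" for \<gamma>
    proof (rule convolution_eq_sum_lift [OF f(1) g(1) f(2)])
      have r: "rng G (q (lift \<gamma>)) = x"
        using l\<Gamma> [OF that] \<Gamma>(2) that by auto
      show "F \<subseteq> {\<alpha> \<in> arrows G. rng G \<alpha> = rng G (q (lift \<gamma>))}"
        using F(2) r by simp
      fix \<tau> assume "\<tau> \<in> arrows E" "rng E \<tau> = rng E (lift \<gamma>)" "f \<tau> \<noteq> 0"
      then show "q \<tau> \<in> F"
        using q_in_supp_fibre [of "lift \<gamma>" \<tau> f] l\<Gamma>(1) [OF that] r by (simp add: F_def)
    qed (use l\<Gamma> that F in auto)
    have gh: "(g \<star> h) (gcomp E (ginv E (lift \<alpha>)) \<sigma>)
        = (\<Sum>\<gamma>\<in>\<Gamma>. g (gcomp E (ginv E (lift \<alpha>)) (lift \<gamma>)) * h (gcomp E (ginv E (lift \<gamma>)) \<sigma>))"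
      if \<alpha>: "\<alpha> \<in> F" for \<alpha>
    proof -
      let ?T = "\<lambda>\<gamma>. gcomp E (ginv E (lift \<alpha>)) (lift \<gamma>)"
      let ?\<sigma>' = "gcomp E (ginv E (lift \<alpha>)) \<sigma>"
      have qT: "q (?T \<gamma>) = gcomp G (ginv G \<alpha>) \<gamma>" if "\<gamma> \<in> \<Gamma>" for \<gamma>
        using lF [OF \<alpha>] l\<Gamma> [OF that] by simp
      have \<alpha>G: "\<alpha> \<in> arrows G" "rng G \<alpha> = x"
        using \<alpha> F(2) by auto
      have "(g \<star> h) ?\<sigma>' = (\<Sum>\<gamma>\<in>\<Gamma>. g (?T \<gamma>) * h (gcomp E (ginv E (?T \<gamma>)) ?\<sigma>'))"
      proof (rule convolution_eq_sum [OF g(1) h g(2) _ \<Gamma>(1)])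
        show "inj_on (\<lambda>\<gamma>. q (?T \<gamma>)) \<Gamma>"
        proof (rule inj_onI)
          fix \<gamma> \<gamma>' assume \<gamma>: "\<gamma> \<in> \<Gamma>" "\<gamma>' \<in> \<Gamma>" "q (?T \<gamma>) = q (?T \<gamma>')"
          then have "gcomp G (ginv G \<alpha>) \<gamma> = gcomp G (ginv G \<alpha>) \<gamma>'"
            using qT by simp
          then show "\<gamma> = \<gamma>'"
            by (rule base.left_cancel [rotated -1]) (use \<alpha>G \<Gamma>(2) \<gamma> in auto)
        qed
        fix \<tau> assume \<tau>: "\<tau> \<in> arrows E" "rng E \<tau> = rng E ?\<sigma>'" "q \<tau> \<notin> (\<lambda>\<gamma>. q (?T \<gamma>)) ` \<Gamma>"
        have s: "src E (lift \<alpha>) = rng E \<tau>"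
          using \<tau>(2) lF [OF \<alpha>] \<sigma> by simp
        have "g \<tau> = 0"
        proof (rule ccontr)
          assume "g \<tau> \<noteq> 0"
          moreover have "f (lift \<alpha>) \<noteq> 0"
            using q_in_q_supp_iff [OF f(1) lF(1) [OF \<alpha>]] \<alpha> lF(2) [OF \<alpha>] by (simp add: F_def)
          ultimately have \<Gamma>': "gcomp G \<alpha> (q \<tau>) \<in> \<Gamma>"
            using \<Gamma>(3) [of "lift \<alpha>" \<tau>] lF [OF \<alpha>] \<tau>(1) s \<alpha>G by simp
          have "src G \<alpha> = rng G (q \<tau>)"
            using q_composable [OF lF(1) [OF \<alpha>] \<tau>(1) s] lF [OF \<alpha>] by simp
          then have "q \<tau> = q (?T (gcomp G \<alpha> (q \<tau>)))"
            using qT [OF \<Gamma>'] \<alpha>G \<tau>(1) by simp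
          then show False
            using \<tau>(3) \<Gamma>' by blast
        qed
        then show "g \<tau> * h (gcomp E (ginv E \<tau>) ?\<sigma>') = 0" by simp
      qed (use lF [OF \<alpha>] l\<Gamma> \<sigma> in simp_all)
      also have "\<dots> = (\<Sum>\<gamma>\<in>\<Gamma>. g (?T \<gamma>) * h (gcomp E (ginv E (lift \<gamma>)) \<sigma>))"
        by (rule sum.cong) (use lF [OF \<alpha>] l\<Gamma> \<sigma> in simp_all)
      finally show ?thesis .
    qed
    have "((f \<star> g) \<star> h) \<sigma> = (\<Sum>\<gamma>\<in>\<Gamma>. (f \<star> g) (lift \<gamma>) * h (gcomp E (ginv E (lift \<gamma>)) \<sigma>))"
    proof (rule convolution_eq_sum_lift [OF equivariant_convolution [OF g(1)] h
          fibre_finite_convolution [OF f(2) g(2)] \<sigma> \<Gamma>(1) \<Gamma>(2) [unfolded x_def]])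
      fix \<tau> assume "\<tau> \<in> arrows E" "rng E \<tau> = rng E \<sigma>" "(f \<star> g) \<tau> \<noteq> 0"
      then show "q \<tau> \<in> \<Gamma>"
        using \<Gamma>(4) \<sigma> rng_eq_iff unfolding x_def by blast
    qed
    also have "\<dots> = (\<Sum>\<gamma>\<in>\<Gamma>. \<Sum>\<alpha>\<in>F. f (lift \<alpha>) * g (gcomp E (ginv E (lift \<alpha>)) (lift \<gamma>))
        * h (gcomp E (ginv E (lift \<gamma>)) \<sigma>))"
      by (rule sum.cong) (simp_all add: fg sum_distrib_right)
    also have "\<dots> = (\<Sum>\<alpha>\<in>F. \<Sum>\<gamma>\<in>\<Gamma>. f (lift \<alpha>) * g (gcomp E (ginv E (lift \<alpha>)) (lift \<gamma>))
        * h (gcomp E (ginv E (lift \<gamma>)) \<sigma>))"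
      by (rule sum.swap)
    also have "\<dots> = (\<Sum>\<alpha>\<in>F. f (lift \<alpha>) * (g \<star> h) (gcomp E (ginv E (lift \<alpha>)) \<sigma>))"
      by (rule sum.cong) (simp_all add: gh sum_distrib_left mult.assoc)
    also have "\<dots> = (f \<star> (g \<star> h)) \<sigma>"
    proof (rule convolution_eq_sum_lift [symmetric, OF f(1) equivariant_convolution [OF h] f(2) \<sigma> F(1)
          F(2) [unfolded x_def]])
      fix \<tau> assume "\<tau> \<in> arrows E" "rng E \<tau> = rng E \<sigma>" "f \<tau> \<noteq> 0"
      then show "q \<tau> \<in> F"
        using q_in_supp_fibre \<sigma> unfolding F_def x_def by blast
    qed
    finally show ?thesis .
  qed simp
qed

end

section \<open>Twisted Steinberg algebras\<close>

interpretation fun_module: module "fun_scale :: 'r::comm_ring_1 \<Rightarrow> ('s \<Rightarrow> 'r) \<Rightarrow> 's \<Rightarrow> 'r"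
  by unfold_locales (simp_all add: fun_scale_def fun_eq_iff algebra_simps)

lemma openin_locally_constant:
  assumes "locally_constant X f"
  shows "openin X {x \<in> topspace X. P (f x)}"
proof (subst openin_subopen, intro ballI)
  fix x assume x: "x \<in> {x \<in> topspace X. P (f x)}"
  then obtain U where U: "openin X U" "x \<in> U" "\<forall>y\<in>U. f y = f x"
    using assms unfolding locally_constant_def by blast
  then have "U \<subseteq> {x \<in> topspace X. P (f x)}"
    using x openin_subset by fastforce
  with U show "\<exists>T. openin X T \<and> x \<in> T \<and> T \<subseteq> {x \<in> topspace X. P (f x)}" by blast
qed

lemma locally_constant_binary:
  assumes "locally_constant X f" "locally_constant X g"
  shows "locally_constant X (\<lambda>x. h (f x) (g x))"
  unfolding locally_constant_def
proof
  fix x assume x: "x \<in> topspace X"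
  let ?U = "{y \<in> topspace X. f y = f x} \<inter> {y \<in> topspace X. g y = g x}"
  have "openin X ?U"
    using openin_locally_constant [OF assms(1), of "\<lambda>c. c = f x"]
      openin_locally_constant [OF assms(2), of "\<lambda>c. c = g x"] by (rule openin_Int)
  with x show "\<exists>U. openin X U \<and> x \<in> U \<and> (\<forall>y\<in>U. h (f y) (g y) = h (f x) (g x))"
    by (intro exI [of _ ?U]) auto
qed

lemma locally_constant_const: "locally_constant X (\<lambda>x. c)"
  unfolding locally_constant_def using openin_topspace by blast

lemma locally_constant_if:
  assumes f: "locally_constant X f" and D: "openin X D" "closedin X D"
  shows "locally_constant X (\<lambda>x. if x \<in> D then f x else 0)"
proof -
  have "locally_constant X (\<lambda>x. x \<in> D)"
    unfolding locally_constant_def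
  proof
    fix x assume "x \<in> topspace X"
    then show "\<exists>U. openin X U \<and> x \<in> U \<and> (\<forall>y\<in>U. (y \<in> D) = (x \<in> D))"
      using D openin_diff [OF openin_topspace D(2)] by (cases "x \<in> D") blast+
  qed
  from locally_constant_binary [OF this f, where h = "\<lambda>b c. if b then c else 0"] show ?thesis .
qed

context discrete_twist
begin

abbreviation A :: "('s \<Rightarrow> 'r) set" where "A \<equiv> steinberg_algebra G E i q"

abbreviation B :: "('s \<Rightarrow> 'r) set" where "B \<equiv> diagonal_subalgebra G E i q"

lemma steinberg_iff:
  "f \<in> A \<longleftrightarrow> equivariant f \<and> locally_constant (gtop E) f \<and> compactin (gtop G) (q ` supp E f)"
  by (auto simp: steinberg_algebra_def equivariant_def)

lemma steinberg_equivariant: "f \<in> A \<Longrightarrow> equivariant f"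
  and steinberg_locally_constant: "f \<in> A \<Longrightarrow> locally_constant (gtop E) f"
  and steinberg_compact: "f \<in> A \<Longrightarrow> compactin (gtop G) (q ` supp E f)"
  by (simp_all add: steinberg_iff)

lemma openin_q_supp:
  assumes "locally_constant (gtop E) f"
  shows "openin (gtop G) (q ` supp E f)"
  using openin_q_image [OF openin_locally_constant [OF assms, of "\<lambda>c. c \<noteq> 0"]] by (simp add: supp_def)

text \<open>An equivariant function vanishes at all or at no points of a fibre of \<open>q\<close>, so the complement of
  the image of the support is the image of the open set where the function vanishes.\<close>

lemma closedin_q_supp:
  assumes f: "equivariant f" "locally_constant (gtop E) f"
  shows "closedin (gtop G) (q ` supp E f)"
proof -
  have "arrows G - q ` supp E f = q ` {\<sigma> \<in> topspace (gtop E). f \<sigma> = 0}"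
  proof (intro set_eqI iffI)
    fix \<alpha> assume \<alpha>: "\<alpha> \<in> arrows G - q ` supp E f"
    then obtain \<sigma> where "\<sigma> \<in> arrows E" "\<alpha> = q \<sigma>"
      using q_surj by blast
    with \<alpha> show "\<alpha> \<in> q ` {\<sigma> \<in> topspace (gtop E). f \<sigma> = 0}"
      using q_in_q_supp_iff [OF f(1)] by auto
  next
    fix \<alpha> assume "\<alpha> \<in> q ` {\<sigma> \<in> topspace (gtop E). f \<sigma> = 0}"
    then obtain \<sigma> where "\<sigma> \<in> arrows E" "\<alpha> = q \<sigma>" "f \<sigma> = 0" by auto
    then show "\<alpha> \<in> arrows G - q ` supp E f"
      using q_in_q_supp_iff [OF f(1)] by simp
  qed
  then have "openin (gtop G) (arrows G - q ` supp E f)"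
    using openin_q_image [OF openin_locally_constant [OF f(2)]] by simp
  then show ?thesis
    using q_supp_subset by (simp add: closedin_def)
qed

text \<open>The image of the support is closed, so it is compact as soon as it lies in a compact set.\<close>

lemma steinbergI:
  assumes f: "equivariant f" "locally_constant (gtop E) f"
    and C: "compactin (gtop G) C" "q ` supp E f \<subseteq> C"
  shows "f \<in> A"
  using f closed_compactin [OF C closedin_q_supp [OF f]] by (simp add: steinberg_iff)

lemma steinberg_add:
  assumes "f \<in> A" "g \<in> A"
  shows "f + g \<in> A"
proof (rule steinbergI)
  show "equivariant (f + g)"
    using assms steinberg_equivariant equivariant_add by blast
  show "locally_constant (gtop E) (f + g)"
    using locally_constant_binary [of _ f g "(+)"] assms steinberg_locally_constant
    by (simp add: plus_fun_def)
  show "compactin (gtop G) (q ` supp E f \<union> q ` supp E g)"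
    using assms steinberg_compact compactin_Un by blast
  have "supp E (f + g) \<subseteq> supp E f \<union> supp E g"
    by (auto simp: supp_def)
  then show "q ` supp E (f + g) \<subseteq> q ` supp E f \<union> q ` supp E g" by blast
qed

lemma steinberg_scale:
  assumes "f \<in> A"
  shows "fun_scale c f \<in> A"
proof (rule steinbergI)
  show "equivariant (fun_scale c f)"
    using assms steinberg_equivariant equivariant_scale by blast
  show "locally_constant (gtop E) (fun_scale c f)"
    using locally_constant_binary [of _ f f "\<lambda>a _. c * a"] assms steinberg_locally_constant
    by (simp add: fun_scale_def)
  show "compactin (gtop G) (q ` supp E f)"
    using assms steinberg_compact by blast
  have "supp E (fun_scale c f) \<subseteq> supp E f"
    by (auto simp: supp_def fun_scale_def)
  then show "q ` supp E (fun_scale c f) \<subseteq> q ` supp E f" by blast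
qed

lemma subspace_steinberg: "fun_module.subspace A"
proof (rule fun_module.subspaceI)
  show "0 \<in> A"
  proof (rule steinbergI)
    show "equivariant 0" by (simp add: equivariant_def)
    show "locally_constant (gtop E) 0"
      using locally_constant_const [of _ 0] by (simp add: zero_fun_def)
    show "compactin (gtop G) {}" by simp
  qed (simp add: supp_def)
qed (use steinberg_add steinberg_scale in blast)+

lemma steinberg_fibre_finite: "f \<in> A \<Longrightarrow> fibre_finite f"
  unfolding fibre_finite_def using steinberg_compact base.finite_compact_fibre by blast

definition restrict_over :: "'g set \<Rightarrow> ('s \<Rightarrow> 'r) \<Rightarrow> 's \<Rightarrow> 'r" where
  "restrict_over K f = (\<lambda>\<sigma>. if \<sigma> \<in> preimage E q K then f \<sigma> else 0)"

lemma restrict_over_steinberg: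
  assumes f: "f \<in> A" and K: "openin (gtop G) K" "closedin (gtop G) K"
  shows "restrict_over K f \<in> A"
proof (rule steinbergI)
  show "equivariant (restrict_over K f)"
    using steinberg_equivariant [OF f]
    by (auto simp: equivariant_def restrict_over_def preimage_def)
  show "locally_constant (gtop E) (restrict_over K f)"
    unfolding restrict_over_def
    by (intro locally_constant_if steinberg_locally_constant f openin_q_preimage closedin_q_preimage K)
  show "compactin (gtop G) (q ` supp E f)"
    by (rule steinberg_compact [OF f])
  have "supp E (restrict_over K f) \<subseteq> supp E f"
    by (auto simp: supp_def restrict_over_def)
  then show "q ` supp E (restrict_over K f) \<subseteq> q ` supp E f" by blast
qed


section \<open>Indicators of bisections of a twist\<close>

text \<open>Compactness is asked of the image in \<open>G\<close> because this is where the supports of the functions in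
  the algebra are compact. Injectivity of the range map entails that \<open>q\<close> is injective on the set.\<close>

definition twist_bisection :: "'s set \<Rightarrow> bool" where
  "twist_bisection S \<longleftrightarrow> openin (gtop E) S \<and> compactin (gtop G) (q ` S) \<and>
     inj_on (rng E) S \<and> inj_on (src E) S"

lemma
  assumes "twist_bisection S"
  shows twist_bisection_open: "openin (gtop E) S"
    and twist_bisection_compact: "compactin (gtop G) (q ` S)"
    and twist_bisection_arrows: "\<And>\<sigma>. \<sigma> \<in> S \<Longrightarrow> \<sigma> \<in> arrows E"
    and twist_bisection_rng: "\<And>\<sigma> \<tau>. \<sigma> \<in> S \<Longrightarrow> \<tau> \<in> S \<Longrightarrow> rng E \<sigma> = rng E \<tau> \<Longrightarrow> \<sigma> = \<tau>"
    and twist_bisection_src: "\<And>\<sigma> \<tau>. \<sigma> \<in> S \<Longrightarrow> \<tau> \<in> S \<Longrightarrow> src E \<sigma> = src E \<tau> \<Longrightarrow> \<sigma> = \<tau>"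
  using assms openin_subset [of "gtop E" S] by (auto simp: twist_bisection_def inj_on_def)

lemma twist_bisection_q:
  assumes S: "twist_bisection S" and "\<sigma> \<in> S" "\<tau> \<in> S" "q \<sigma> = q \<tau>"
  shows "\<sigma> = \<tau>"
proof (rule twist_bisection_rng [OF S])
  show "rng E \<sigma> = rng E \<tau>"
    using assms twist_bisection_arrows [OF S] by (simp add: rng_eq_iff)
qed (use assms in auto)

lemma twist_bisection_restrict:
  assumes S: "twist_bisection S" and K: "openin (gtop G) K" "closedin (gtop G) K"
  shows "twist_bisection (S \<inter> preimage E q K)"
  unfolding twist_bisection_def
proof (intro conjI)
  show "openin (gtop E) (S \<inter> preimage E q K)"
    using twist_bisection_open [OF S] openin_q_preimage [OF K(1)] by (rule openin_Int)
  have "q ` (S \<inter> preimage E q K) = K \<inter> q ` S"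
    using twist_bisection_arrows [OF S] by (auto simp: preimage_def)
  then show "compactin (gtop G) (q ` (S \<inter> preimage E q K))"
    using closed_Int_compactin [OF K(2) twist_bisection_compact [OF S]] by simp
  show "inj_on (rng E) (S \<inter> preimage E q K)" "inj_on (src E) (S \<inter> preimage E q K)"
    using S inj_on_subset unfolding twist_bisection_def by blast+
qed

lemma twist_bisection_inverse:
  assumes S: "twist_bisection S"
  shows "twist_bisection (ginv E ` S)"
  unfolding twist_bisection_def
proof (intro conjI)
  note SE = twist_bisection_arrows [OF S]
  show "openin (gtop E) (ginv E ` S)"
    by (rule total.openin_inverse_image [OF twist_bisection_open [OF S]])
  have "q ` ginv E ` S = ginv G ` q ` S"
    using SE by (force simp: image_iff)
  then show "compactin (gtop G) (q ` ginv E ` S)"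
    using image_compactin [OF twist_bisection_compact [OF S] base.continuous_inv] by simp
  show "inj_on (rng E) (ginv E ` S)" "inj_on (src E) (ginv E ` S)"
    using SE S by (auto simp: inj_on_def twist_bisection_def)
qed

lemma inverse_inverse_image: "twist_bisection S \<Longrightarrow> ginv E ` ginv E ` S = S"
  using twist_bisection_arrows by (force simp: image_iff)

lemma twist_bisection_units:
  assumes L: "openin (gtop G) L" "compactin (gtop G) L" "L \<subseteq> units G"
  shows "twist_bisection (units E \<inter> preimage E q L)" and "q ` (units E \<inter> preimage E q L) = L"
proof -
  show q: "q ` (units E \<inter> preimage E q L) = L"
  proof (intro set_eqI iffI)
    fix x assume x: "x \<in> L"
    then have "i (x, 1) \<in> units E \<inter> preimage E q L" "q (i (x, 1)) = x"
      using L(3) i_one_unit by (auto simp: preimage_def)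
    then show "x \<in> q ` (units E \<inter> preimage E q L)" by force
  qed (auto simp: preimage_def)
  show "twist_bisection (units E \<inter> preimage E q L)"
    unfolding twist_bisection_def
  proof (intro conjI)
    show "openin (gtop E) (units E \<inter> preimage E q L)"
      using openin_units_total openin_q_preimage [OF L(1)] by (rule openin_Int)
    show "compactin (gtop G) (q ` (units E \<inter> preimage E q L))"
      using q L(2) by simp
    show "inj_on (rng E) (units E \<inter> preimage E q L)" "inj_on (src E) (units E \<inter> preimage E q L)"
      by (auto simp: inj_on_def total.rng_unit total.src_unit)
  qed
qed

text \<open>For a twist bisection \<open>S\<close>, the equivariant function that is \<open>1\<close> on \<open>S\<close> and vanishes off the translates of \<open>S\<close> by ring
  units. The description by \<open>THE\<close> is meaningful because a point determines the translate on which
  it lies.\<close>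

definition lift_indicator :: "'s set \<Rightarrow> 's \<Rightarrow> 'r" where
  "lift_indicator S \<sigma> =
     (if \<exists>t\<in>ring_units. \<exists>\<tau>\<in>S. \<sigma> = act t \<tau>
      then unit_inv (THE t. t \<in> ring_units \<and> (\<exists>\<tau>\<in>S. \<sigma> = act t \<tau>)) else 0)"

lemma lift_indicator_act:
  assumes S: "twist_bisection S" and \<tau>: "\<tau> \<in> S" and t: "t \<in> ring_units"
  shows "lift_indicator S (act t \<tau>) = unit_inv t"
proof -
  have "(THE u. u \<in> ring_units \<and> (\<exists>\<rho>\<in>S. act t \<tau> = act u \<rho>)) = t"
  proof (rule the_equality)
    fix u assume "u \<in> ring_units \<and> (\<exists>\<rho>\<in>S. act t \<tau> = act u \<rho>)"
    then obtain \<rho> where u: "u \<in> ring_units" "\<rho> \<in> S" "act t \<tau> = act u \<rho>" by blast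
    have arr: "\<tau> \<in> arrows E" "\<rho> \<in> arrows E"
      using \<tau> u twist_bisection_arrows [OF S] by auto
    have "q \<tau> = q (act t \<tau>)"
      using t arr by simp
    also have "\<dots> = q \<rho>"
      using u arr by simp
    finally have "\<tau> = \<rho>"
      using twist_bisection_q [OF S] \<tau> u by blast
    then show "u = t"
      using act_free [of \<tau> u t] u t arr by simp
  qed (use \<tau> t in blast)
  moreover have "\<exists>u\<in>ring_units. \<exists>\<rho>\<in>S. act t \<tau> = act u \<rho>"
    using \<tau> t by blast
  ultimately show ?thesis
    by (simp add: lift_indicator_def)
qed

lemma lift_indicator_eq_1:
  assumes "twist_bisection S" "\<tau> \<in> S"
  shows "lift_indicator S \<tau> = 1"
  using lift_indicator_act [OF assms one_in_ring_units] twist_bisection_arrows [OF assms] by simp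

lemma lift_indicator_nonzeroE:
  assumes "lift_indicator S \<sigma> \<noteq> 0"
  obtains t \<tau> where "t \<in> ring_units" "\<tau> \<in> S" "\<sigma> = act t \<tau>"
  using assms unfolding lift_indicator_def by (metis (no_types, lifting))

lemma equivariant_lift_indicator:
  assumes S: "twist_bisection S"
  shows "equivariant (lift_indicator S)"
  unfolding equivariant_def
proof (intro conjI allI impI ballI)
  fix \<sigma> assume "\<sigma> \<notin> arrows E"
  then show "lift_indicator S \<sigma> = 0"
    using lift_indicator_nonzeroE act_arrows twist_bisection_arrows [OF S] by metis
next
  fix t \<sigma> assume t: "t \<in> (ring_units :: 'r set)" and \<sigma>: "\<sigma> \<in> arrows E"
  show "lift_indicator S (act t \<sigma>) = unit_inv t * lift_indicator S \<sigma>"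
  proof (cases "lift_indicator S \<sigma> = 0")
    case False
    then obtain u \<tau> where u: "u \<in> ring_units" "\<tau> \<in> S" "\<sigma> = act u \<tau>"
      by (rule lift_indicator_nonzeroE)
    then have "act t \<sigma> = act (t * u) \<tau>"
      using t twist_bisection_arrows [OF S] by simp
    then show ?thesis
      using u t lift_indicator_act [OF S] by (simp add: unit_inv_mult)
  next
    case True
    have "lift_indicator S (act t \<sigma>) = 0"
    proof (rule ccontr)
      assume "lift_indicator S (act t \<sigma>) \<noteq> 0"
      then obtain u \<tau> where u: "u \<in> ring_units" "\<tau> \<in> S" "act t \<sigma> = act u \<tau>"
        by (rule lift_indicator_nonzeroE)
      have "\<sigma> = act (unit_inv t) (act t \<sigma>)"
        using t \<sigma> by simp
      also have "\<dots> = act (unit_inv t * u) \<tau>"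
        unfolding u(3) using t u twist_bisection_arrows [OF S] by simp
      finally have "lift_indicator S \<sigma> = unit_inv (unit_inv t * u)"
        using u t lift_indicator_act [OF S] by simp
      then have "unit_inv t * u * 0 = 1"
        using True u t mult_unit_inv(1) [of "unit_inv t * u"] by simp
      then show False by simp
    qed
    then show ?thesis using True by simp
  qed
qed

lemma q_supp_lift_indicator:
  assumes S: "twist_bisection S"
  shows "q ` supp E (lift_indicator S) = q ` S"
proof
  show "q ` supp E (lift_indicator S) \<subseteq> q ` S"
  proof
    fix \<alpha> assume "\<alpha> \<in> q ` supp E (lift_indicator S)"
    then obtain \<sigma> where "lift_indicator S \<sigma> \<noteq> 0" "\<alpha> = q \<sigma>"
      by (auto simp: supp_def)
    then obtain t \<tau> where "t \<in> ring_units" "\<tau> \<in> S" "\<alpha> = q (act t \<tau>)"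
      using lift_indicator_nonzeroE by metis
    then show "\<alpha> \<in> q ` S"
      using twist_bisection_arrows [OF S] by simp
  qed
  have "S \<subseteq> supp E (lift_indicator S)"
    using lift_indicator_eq_1 [OF S] twist_bisection_arrows [OF S] by (auto simp: supp_def)
  then show "q ` S \<subseteq> q ` supp E (lift_indicator S)" by blast
qed

text \<open>Equivariance determines a function over \<open>q ` S\<close> by its values on \<open>S\<close>.\<close>

lemma equivariant_eqI:
  assumes f: "equivariant f" and g: "equivariant g" and S: "S \<subseteq> arrows E"
    and eq: "\<And>\<tau>. \<tau> \<in> S \<Longrightarrow> f \<tau> = g \<tau>"
    and zero: "\<And>\<sigma>. \<sigma> \<in> arrows E \<Longrightarrow> q \<sigma> \<notin> q ` S \<Longrightarrow> f \<sigma> = g \<sigma>"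
  shows "f = g"
proof
  fix \<sigma>
  consider "\<sigma> \<notin> arrows E" | "\<sigma> \<in> arrows E" "q \<sigma> \<notin> q ` S" | "\<sigma> \<in> arrows E" "q \<sigma> \<in> q ` S"
    by blast
  then show "f \<sigma> = g \<sigma>"
  proof cases
    case 3
    then obtain \<tau> where \<tau>: "\<tau> \<in> S" "q \<tau> = q \<sigma>" by force
    then obtain t where "t \<in> ring_units" "\<sigma> = act t \<tau>"
      using act_transitive [of \<tau> \<sigma>] S 3 by blast
    then show ?thesis
      using \<tau> S eq f g by auto
  next
    case 1
    then show ?thesis
      using equivariant_outside [OF f] equivariant_outside [OF g] by simp
  qed (rule zero)
qed

lemma lift_indicator_eq_0:
  assumes S: "twist_bisection S" and "q \<sigma> \<notin> q ` S"
  shows "lift_indicator S \<sigma> = 0"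
proof (rule ccontr)
  assume "lift_indicator S \<sigma> \<noteq> 0"
  then obtain t \<tau> where "t \<in> ring_units" "\<tau> \<in> S" "\<sigma> = act t \<tau>"
    by (rule lift_indicator_nonzeroE)
  then show False
    using assms twist_bisection_arrows [OF S] by simp
qed

end

locale hausdorff_ample_twist = discrete_twist G E i q + base: ample_groupoid G
  for G :: "'g groupoid" and E :: "'s groupoid"
    and i :: "'g \<times> 'r::comm_ring_1 \<Rightarrow> 's" and q :: "'s \<Rightarrow> 'g" +
  assumes Hausdorff: "Hausdorff_space (gtop G)"
begin

lemma twist_bisection_closed: "twist_bisection S \<Longrightarrow> closedin (gtop G) (q ` S)"
  using compactin_imp_closedin [OF Hausdorff] twist_bisection_compact by blast

lemma twist_bisection_exists:
  assumes W: "openin (gtop E) W" and \<sigma>: "\<sigma> \<in> W"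
  obtains S where "twist_bisection S" "\<sigma> \<in> S" "S \<subseteq> W"
proof -
  obtain S0 where S0: "openin (gtop E) S0" "\<sigma> \<in> S0" "S0 \<subseteq> W" "inj_on q S0" "openin (gtop G) (q ` S0)"
    using q_local_homeomorphism [OF W \<sigma>] .
  obtain K where K: "openin (gtop G) K" "compactin (gtop G) K" "bisection G K" "q \<sigma> \<in> K" "K \<subseteq> q ` S0"
    using base.compact_open_bisection_basis [OF S0(5)] S0(2) by blast
  define S where "S = S0 \<inter> preimage E q K"
  have sub: "S0 \<subseteq> arrows E"
    using openin_subset [OF S0(1)] by simp
  have qS: "q ` S = K"
    using K(5) sub by (auto simp: S_def preimage_def)
  have inj: "\<sigma> = \<tau>" if "\<sigma> \<in> S" "\<tau> \<in> S" "q \<sigma> = q \<tau>" for \<sigma> \<tau>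
    using inj_onD [OF S0(4) that(3)] that by (simp add: S_def)
  have "twist_bisection S"
    unfolding twist_bisection_def
  proof (intro conjI)
    show "openin (gtop E) S"
      unfolding S_def using S0(1) openin_q_preimage [OF K(1)] by (rule openin_Int)
    show "compactin (gtop G) (q ` S)"
      using qS K(2) by simp
    have S: "\<sigma> \<in> arrows E" "q \<sigma> \<in> K" if "\<sigma> \<in> S" for \<sigma>
      using that by (auto simp: S_def preimage_def)
    show "inj_on (rng E) S"
    proof (rule inj_onI)
      fix \<sigma> \<tau> assume st: "\<sigma> \<in> S" "\<tau> \<in> S" "rng E \<sigma> = rng E \<tau>"
      then have "rng G (q \<sigma>) = rng G (q \<tau>)"
        using rng_eq_iff S by blast
      then have "q \<sigma> = q \<tau>"
        using inj_onD [OF base.bisection_inj(2) [OF K(3)]] S st by blast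
      then show "\<sigma> = \<tau>" using inj st by blast
    qed
    show "inj_on (src E) S"
    proof (rule inj_onI)
      fix \<sigma> \<tau> assume st: "\<sigma> \<in> S" "\<tau> \<in> S" "src E \<sigma> = src E \<tau>"
      then have "src G (q \<sigma>) = src G (q \<tau>)"
        using src_eq_iff S by blast
      then have "q \<sigma> = q \<tau>"
        using inj_onD [OF base.bisection_inj(3) [OF K(3)]] S st by blast
      then show "\<sigma> = \<tau>" using inj st by blast
    qed
  qed
  moreover have "\<sigma> \<in> S"
    using S0(2) K(4) sub by (auto simp: S_def preimage_def)
  ultimately show thesis
    using that S0(3) by (auto simp: S_def)
qed

text \<open>The indicator is constant on each open translate of \<open>S\<close>, and it vanishes off the preimage of
  \<open>q ` S\<close>, which is closed because \<open>q ` S\<close> is compact in a Hausdorff space.\<close>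

lemma lift_indicator_steinberg:
  assumes S: "twist_bisection S"
  shows "lift_indicator S \<in> A"
  unfolding steinberg_iff
proof (intro conjI)
  show "equivariant (lift_indicator S)"
    by (rule equivariant_lift_indicator [OF S])
  show "compactin (gtop G) (q ` supp E (lift_indicator S))"
    using q_supp_lift_indicator [OF S] twist_bisection_compact [OF S] by simp
  show "locally_constant (gtop E) (lift_indicator S)"
    unfolding locally_constant_def
  proof
    fix \<sigma> assume "\<sigma> \<in> topspace (gtop E)"
    then have \<sigma>: "\<sigma> \<in> arrows E" by simp
    show "\<exists>U. openin (gtop E) U \<and> \<sigma> \<in> U \<and> (\<forall>\<rho>\<in>U. lift_indicator S \<rho> = lift_indicator S \<sigma>)"
    proof (cases "q \<sigma> \<in> q ` S")
      case True
      then obtain \<tau> where "\<tau> \<in> S" "q \<tau> = q \<sigma>" by force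
      then obtain t where t: "t \<in> ring_units" "\<sigma> = act t \<tau>" "\<tau> \<in> S"
        using act_transitive [of \<tau> \<sigma>] twist_bisection_arrows [OF S] \<sigma> by metis
      have "openin (gtop E) (act t ` S)"
        using openin_act_image [OF twist_bisection_open [OF S] t(1)] .
      moreover have "lift_indicator S \<rho> = lift_indicator S \<sigma>" if "\<rho> \<in> act t ` S" for \<rho>
        using that t lift_indicator_act [OF S] by auto
      ultimately show ?thesis
        using t by blast
    next
      case False
      have "openin (gtop E) (preimage E q (arrows G - q ` S))"
        using twist_bisection_closed [OF S] by (intro openin_q_preimage) (simp add: closedin_def)
      moreover have "\<sigma> \<in> preimage E q (arrows G - q ` S)"
        using False \<sigma> by (simp add: preimage_def)
      moreover have "lift_indicator S \<rho> = lift_indicator S \<sigma>" if "\<rho> \<in> preimage E q (arrows G - q ` S)" for \<rho>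
        using that False lift_indicator_eq_0 [OF S] by (simp add: preimage_def)
      ultimately show ?thesis by blast
    qed
  qed
qed

text \<open>A function \<open>f\<close> in the algebra is constant near each lift of its support, so the support is
  covered by finitely many sets \<open>q ` S\<close> for which \<open>f\<close> is constant on \<open>S\<close>. Over \<open>q ` S\<close> the function
  is a multiple of the indicator of \<open>S\<close>; removing these clopen sets one by one exhausts the support.
  Taking for \<open>X\<close> all arrows, the units or the arrows over non-units gives spanning
  sets of the algebra, the diagonal and the functions supported off the units.\<close>

lemma steinberg_in_span:
  assumes f: "f \<in> A" and X: "openin (gtop E) X" "q ` supp E f \<subseteq> q ` X"
  shows "f \<in> fun_module.span (lift_indicator ` {S. twist_bisection S \<and> S \<subseteq> X})"
    (is "f \<in> ?span")
proof -
  let ?\<S> = "{S. twist_bisection S \<and> S \<subseteq> X \<and> (\<exists>c. \<forall>\<tau>\<in>S. f \<tau> = c)}"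
  \<comment> \<open>The clopen set \<open>K\<close> is the part of \<open>G\<close> still to be treated; it shrinks in the induction while
    \<open>f\<close> and the sets \<open>S\<close> remain fixed, so that \<open>f\<close> stays constant on them.\<close>
  have step: "restrict_over K f \<in> ?span"
    if "finite \<T>" "\<T> \<subseteq> ?\<S>" "openin (gtop G) K" "closedin (gtop G) K"
      "q ` supp E f \<inter> K \<subseteq> (\<Union>S\<in>\<T>. q ` S)" for \<T> K
    using that
  proof (induction \<T> arbitrary: K rule: finite_induct)
    case empty
    have "restrict_over K f \<sigma> = 0" for \<sigma>
      using empty(4) q_supp_I by (fastforce simp: restrict_over_def preimage_def)
    then have "restrict_over K f = 0"
      by (simp add: fun_eq_iff)
    then show ?case
      using fun_module.span_zero by metis
  next
    case (insert S \<T>)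
    have S: "twist_bisection S" "S \<subseteq> X"
      using insert.prems(1) by auto
    obtain c where c: "\<And>\<tau>. \<tau> \<in> S \<Longrightarrow> f \<tau> = c"
      using insert.prems(1) by auto
    note SE = twist_bisection_arrows [OF S(1)]
    let ?S' = "S \<inter> preimage E q K" and ?K' = "K - q ` S" and ?KS = "K \<inter> q ` S"
    have op: "openin (gtop G) (q ` S)" and cl: "closedin (gtop G) (q ` S)"
      using openin_q_image twist_bisection_open S(1) twist_bisection_closed by auto
    have S': "twist_bisection ?S'"
      using twist_bisection_restrict S(1) insert.prems by blast
    have "restrict_over ?K' f \<in> ?span"
    proof (rule insert.IH)
      show "\<T> \<subseteq> ?\<S>" using insert.prems by blast
      show "openin (gtop G) ?K'" using insert.prems cl by (intro openin_diff)
      show "closedin (gtop G) ?K'" using insert.prems op by (intro closedin_diff)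
      show "q ` supp E f \<inter> ?K' \<subseteq> (\<Union>S\<in>\<T>. q ` S)" using insert.prems by auto
    qed
    moreover have "restrict_over ?KS f = fun_scale c (lift_indicator ?S')"
    proof (rule equivariant_eqI [of _ _ ?S'])
      show "equivariant (restrict_over ?KS f)"
        by (rule steinberg_equivariant [OF restrict_over_steinberg [OF f]])
           (use op cl insert.prems in auto)
      show "equivariant (fun_scale c (lift_indicator ?S'))"
        by (rule equivariant_scale [OF equivariant_lift_indicator [OF S']])
      show "?S' \<subseteq> arrows E" using SE by blast
      show "restrict_over ?KS f \<tau> = fun_scale c (lift_indicator ?S') \<tau>" if "\<tau> \<in> ?S'" for \<tau>
        using that lift_indicator_eq_1 [OF S' that] c
        by (simp add: restrict_over_def fun_scale_def preimage_def)
      show "restrict_over ?KS f \<sigma> = fun_scale c (lift_indicator ?S') \<sigma>"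
        if "\<sigma> \<in> arrows E" "q \<sigma> \<notin> q ` ?S'" for \<sigma>
      proof -
        have "q \<sigma> \<notin> ?KS"
          using that SE by (force simp: preimage_def)
        then have "restrict_over ?KS f \<sigma> = 0"
          by (auto simp: restrict_over_def preimage_def)
        then show ?thesis
          using lift_indicator_eq_0 [OF S' that(2)] by (simp add: fun_scale_def)
      qed
    qed
    moreover have "lift_indicator ?S' \<in> ?span"
      using S' S(2) by (intro fun_module.span_base) blast
    moreover have "restrict_over K f = restrict_over ?KS f + restrict_over ?K' f"
      by (auto simp: fun_eq_iff restrict_over_def preimage_def)
    ultimately show ?case
      by (simp only: fun_module.span_add fun_module.span_scale)
  qed
  have cover: "q ` supp E f \<subseteq> \<Union> ((`) q ` ?\<S>)"
  proof
    fix \<alpha> assume "\<alpha> \<in> q ` supp E f"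
    then obtain \<sigma> where \<sigma>: "\<sigma> \<in> X" "\<alpha> = q \<sigma>"
      using X(2) by blast
    let ?W = "X \<inter> {\<tau> \<in> topspace (gtop E). f \<tau> = f \<sigma>}"
    have "openin (gtop E) ?W"
      using X(1) openin_locally_constant [OF steinberg_locally_constant [OF f]] by (rule openin_Int)
    moreover have "\<sigma> \<in> ?W"
      using \<sigma>(1) openin_subset [OF X(1)] by auto
    ultimately obtain S where "twist_bisection S" "\<sigma> \<in> S" "S \<subseteq> ?W"
      by (rule twist_bisection_exists)
    then have "S \<in> ?\<S>" "\<alpha> \<in> q ` S"
      using \<sigma>(2) by auto
    then show "\<alpha> \<in> \<Union> ((`) q ` ?\<S>)" by blast
  qed
  have "openin (gtop G) U" if "U \<in> (`) q ` ?\<S>" for U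
    using that openin_q_image twist_bisection_open by blast
  from compactinD [OF steinberg_compact [OF f] this cover] obtain \<U> where \<U>: "finite \<U>" "\<U> \<subseteq> (`) q ` ?\<S>" "q ` supp E f \<subseteq> \<Union> \<U>"
    by blast
  from finite_subset_image [OF \<U>(1,2)] obtain \<T> where \<T>: "finite \<T>" "\<T> \<subseteq> ?\<S>" "\<U> = (`) q ` \<T>"
    by blast
  have "restrict_over (arrows G) f \<in> ?span"
  proof (rule step [OF \<T>(1,2)])
    show "openin (gtop G) (arrows G)" "closedin (gtop G) (arrows G)"
      using openin_topspace [of "gtop G"] closedin_topspace [of "gtop G"] by simp_all
    show "q ` supp E f \<inter> arrows G \<subseteq> (\<Union>S\<in>\<T>. q ` S)"
      using \<U>(3) \<T>(3) by blast
  qed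
  moreover have "restrict_over (arrows G) f = f"
    using equivariant_outside [OF steinberg_equivariant [OF f]]
    by (auto simp: fun_eq_iff restrict_over_def preimage_def)
  ultimately show ?thesis by metis
qed

end

section \<open>Products with diagonal functions and with indicators\<close>

context discrete_twist
begin

lemma diagonal_iff:
  "f \<in> B \<longleftrightarrow> f \<in> A \<and> (\<forall>\<sigma>. f \<sigma> \<noteq> 0 \<longrightarrow> q \<sigma> \<in> units G)"
  using equivariant_nonzero_arrows [OF steinberg_equivariant]
  by (auto simp: diagonal_subalgebra_def supp_def preimage_def)

lemma diagonal_steinberg: "f \<in> B \<Longrightarrow> f \<in> A"
  and diagonal_over_units: "f \<in> B \<Longrightarrow> f \<sigma> \<noteq> 0 \<Longrightarrow> q \<sigma> \<in> units G"
  by (simp_all add: diagonal_iff)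

lemma rng_eq_src_over_units:
  assumes "\<sigma> \<in> arrows E" "q \<sigma> \<in> units G"
  shows "rng E \<sigma> = src E \<sigma>"
proof -
  have "src G (q \<sigma>) = rng G (q \<sigma>)"
    using assms base.src_unit base.rng_unit by simp
  then show ?thesis
    using src_eq_rng_iff [OF assms(1) assms(1)] by simp
qed

text \<open>Only the unit \<open>rng E \<sigma>\<close> contributes to the sum, and for a diagonal right factor only \<open>\<sigma>\<close> itself.\<close>

lemma convolution_diagonal_left:
  assumes f: "f \<in> B" and g: "equivariant g" and \<sigma>: "\<sigma> \<in> arrows E"
  shows "(f \<star> g) \<sigma> = f (rng E \<sigma>) * g \<sigma>"
proof -
  note fA = diagonal_steinberg [OF f]
  have "(f \<star> g) \<sigma> = f (rng E \<sigma>) * g (gcomp E (ginv E (rng E \<sigma>)) \<sigma>)"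
  proof (rule convolution_eq_term [OF steinberg_equivariant [OF fA] g steinberg_fibre_finite [OF fA] \<sigma>])
    fix \<rho> assume \<rho>: "\<rho> \<in> arrows E" "rng E \<rho> = rng E \<sigma>" "f \<rho> \<noteq> 0"
    then have "q \<rho> = rng G (q \<rho>)"
      using diagonal_over_units [OF f] base.rng_unit by metis
    also have "\<dots> = q (rng E \<rho>)"
      by (rule q_rng [OF \<rho>(1), symmetric])
    finally show "q \<rho> = q (rng E \<sigma>)"
      using \<rho>(2) by simp
  qed (use \<sigma> in simp_all)
  then show ?thesis
    using \<sigma> by simp
qed

lemma convolution_diagonal_right:
  assumes f: "equivariant f" "fibre_finite f" and g: "g \<in> B" and \<sigma>: "\<sigma> \<in> arrows E"
  shows "(f \<star> g) \<sigma> = f \<sigma> * g (src E \<sigma>)"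
proof -
  have "(f \<star> g) \<sigma> = f \<sigma> * g (gcomp E (ginv E \<sigma>) \<sigma>)"
  proof (rule convolution_eq_term [OF f(1) steinberg_equivariant [OF diagonal_steinberg [OF g]] f(2) \<sigma> \<sigma>])
    fix \<rho> assume \<rho>: "\<rho> \<in> arrows E" "rng E \<rho> = rng E \<sigma>" "g (gcomp E (ginv E \<rho>) \<sigma>) \<noteq> 0"
    have r: "rng G (q \<rho>) = rng G (q \<sigma>)"
      using \<rho> \<sigma> rng_eq_iff by blast
    have "gcomp G (ginv G (q \<rho>)) (q \<sigma>) \<in> units G"
      using diagonal_over_units [OF g \<rho>(3)] \<rho> \<sigma> by simp
    then show "q \<rho> = q \<sigma>"
      using base.inv_product_unit_iff [of "q \<rho>" "q \<sigma>"] r \<rho>(1) \<sigma> by simp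
  qed simp
  then show ?thesis
    using \<sigma> by simp
qed

lemma diagonal_commute:
  assumes "f \<in> B" "g \<in> B"
  shows "f \<star> g = g \<star> f"
proof
  fix \<sigma>
  note A = diagonal_steinberg [OF assms(1)] diagonal_steinberg [OF assms(2)]
  show "(f \<star> g) \<sigma> = (g \<star> f) \<sigma>"
  proof (cases "\<sigma> \<in> arrows E \<and> g \<sigma> \<noteq> 0")
    case True
    then show ?thesis
      using convolution_diagonal_left [OF assms(1) steinberg_equivariant [OF A(2)], of \<sigma>]
        convolution_diagonal_right [OF steinberg_equivariant [OF A(2)] steinberg_fibre_finite [OF A(2)]
          assms(1), of \<sigma>] rng_eq_src_over_units [of \<sigma>] diagonal_over_units [OF assms(2), of \<sigma>]
      by (simp add: mult.commute)
  next
    case False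
    then show ?thesis
      using convolution_diagonal_left [OF assms(1) steinberg_equivariant [OF A(2)], of \<sigma>]
        convolution_diagonal_right [OF steinberg_equivariant [OF A(2)] steinberg_fibre_finite [OF A(2)]
          assms(1), of \<sigma>]
      by (cases "\<sigma> \<in> arrows E") simp_all
  qed
qed

lemma subspace_diagonal: "fun_module.subspace B"
proof (rule fun_module.subspaceI)
  show "0 \<in> B"
    using fun_module.subspace_0 [OF subspace_steinberg] by (simp add: diagonal_iff)
  show "f + g \<in> B" if "f \<in> B" "g \<in> B" for f g
  proof -
    have "q \<sigma> \<in> units G" if "(f + g) \<sigma> \<noteq> 0" for \<sigma>
      using that diagonal_over_units \<open>f \<in> B\<close> \<open>g \<in> B\<close> by (cases "f \<sigma> = 0") auto
    then show ?thesis
      using that diagonal_steinberg steinberg_add by (simp add: diagonal_iff)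
  qed
  show "fun_scale c f \<in> B" if "f \<in> B" for c f
  proof -
    have "q \<sigma> \<in> units G" if "fun_scale c f \<sigma> \<noteq> 0" for \<sigma>
      using that diagonal_over_units [OF \<open>f \<in> B\<close>] by (cases "f \<sigma> = 0") (auto simp: fun_scale_def)
    then show ?thesis
      using that diagonal_steinberg steinberg_scale by (simp add: diagonal_iff)
  qed
qed

end

context hausdorff_ample_twist
begin

lemma lift_indicator_fibre_finite: "twist_bisection S \<Longrightarrow> fibre_finite (lift_indicator S)"
  by (rule steinberg_fibre_finite [OF lift_indicator_steinberg])

text \<open>Only \<open>\<tau>\<close> contributes to the sum, as \<open>S\<close> has no other element with the range of \<open>\<sigma>\<close>. The lemmas
  for products with indicators on the right use the source map in the same way.\<close>

lemma convolution_indicator_left: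
  assumes S: "twist_bisection S" and g: "equivariant g" and \<sigma>: "\<sigma> \<in> arrows E"
    and \<tau>: "\<tau> \<in> S" "rng E \<tau> = rng E \<sigma>"
  shows "(lift_indicator S \<star> g) \<sigma> = g (gcomp E (ginv E \<tau>) \<sigma>)"
proof -
  have \<tau>E: "\<tau> \<in> arrows E"
    using \<tau>(1) twist_bisection_arrows [OF S] by blast
  have "(lift_indicator S \<star> g) \<sigma> = lift_indicator S \<tau> * g (gcomp E (ginv E \<tau>) \<sigma>)"
  proof (rule convolution_eq_term [OF equivariant_lift_indicator [OF S] g lift_indicator_fibre_finite [OF S]
        \<sigma> \<tau>E \<tau>(2)])
    fix \<rho> assume \<rho>: "\<rho> \<in> arrows E" "rng E \<rho> = rng E \<sigma>" "lift_indicator S \<rho> \<noteq> 0"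
    from \<rho>(3) obtain t \<omega> where t: "t \<in> ring_units" "\<omega> \<in> S" "\<rho> = act t \<omega>"
      by (rule lift_indicator_nonzeroE)
    have \<omega>: "\<omega> \<in> arrows E"
      using t twist_bisection_arrows [OF S] by blast
    then have "\<omega> = \<tau>"
      using twist_bisection_rng [OF S t(2) \<tau>(1)] t \<rho>(2) \<tau>(2) by simp
    then show "q \<rho> = q \<tau>"
      using t \<omega> by simp
  qed
  then show ?thesis
    using lift_indicator_eq_1 [OF S \<tau>(1)] by simp
qed

lemma convolution_indicator_left_nonzeroE:
  assumes S: "twist_bisection S" and g: "equivariant g" and nz: "(lift_indicator S \<star> g) \<sigma> \<noteq> 0"
  obtains \<tau> where "\<sigma> \<in> arrows E" "\<tau> \<in> S" "rng E \<tau> = rng E \<sigma>" "g (gcomp E (ginv E \<tau>) \<sigma>) \<noteq> 0"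
proof -
  obtain \<rho> where \<rho>: "\<sigma> \<in> arrows E" "\<rho> \<in> arrows E" "rng E \<rho> = rng E \<sigma>" "lift_indicator S \<rho> \<noteq> 0"
    using convolution_nonzeroE [OF nz] .
  from \<rho>(4) obtain t \<omega> where t: "t \<in> ring_units" "\<omega> \<in> S" "\<rho> = act t \<omega>"
    by (rule lift_indicator_nonzeroE)
  have "rng E \<omega> = rng E \<sigma>"
    using t \<rho>(3) twist_bisection_arrows [OF S] by simp
  then show thesis
    using that [OF \<rho>(1) t(2)] convolution_indicator_left [OF S g \<rho>(1) t(2)] nz by simp
qed

lemma convolution_indicator_right:
  assumes S: "twist_bisection S" and f: "equivariant f" "fibre_finite f" and \<sigma>: "\<sigma> \<in> arrows E"
    and \<tau>: "\<tau> \<in> S" "src E \<tau> = src E \<sigma>"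
  shows "(f \<star> lift_indicator S) \<sigma> = f (gcomp E \<sigma> (ginv E \<tau>))"
proof -
  have \<tau>E: "\<tau> \<in> arrows E"
    using \<tau>(1) twist_bisection_arrows [OF S] by blast
  let ?\<rho> = "gcomp E \<sigma> (ginv E \<tau>)"
  have "(f \<star> lift_indicator S) \<sigma> = f ?\<rho> * lift_indicator S (gcomp E (ginv E ?\<rho>) \<sigma>)"
  proof (rule convolution_eq_term [OF f(1) equivariant_lift_indicator [OF S] f(2) \<sigma>])
    fix \<rho> assume \<rho>: "\<rho> \<in> arrows E" "rng E \<rho> = rng E \<sigma>" "lift_indicator S (gcomp E (ginv E \<rho>) \<sigma>) \<noteq> 0"
    from \<rho>(3) obtain t \<omega> where t: "t \<in> ring_units" "\<omega> \<in> S" "gcomp E (ginv E \<rho>) \<sigma> = act t \<omega>"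
      by (rule lift_indicator_nonzeroE)
    have \<omega>: "\<omega> \<in> arrows E"
      using t twist_bisection_arrows [OF S] by blast
    have "src E \<omega> = src E (act t \<omega>)"
      using t \<omega> by simp
    also have "\<dots> = src E \<tau>"
      unfolding t(3) [symmetric] using \<rho> \<sigma> \<tau> by simp
    finally have "\<omega> = \<tau>"
      using twist_bisection_src [OF S t(2) \<tau>(1)] by simp
    have "src E \<rho> = rng E (gcomp E (ginv E \<rho>) \<sigma>)"
      using \<rho>(1,2) \<sigma> by simp
    also have "\<dots> = rng E \<tau>"
      unfolding t(3) using t(1) \<omega> \<open>\<omega> = \<tau>\<close> by simp
    finally have sr: "src E \<rho> = rng E \<tau>" .
    have "\<sigma> = gcomp E \<rho> (gcomp E (ginv E \<rho>) \<sigma>)"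
      using \<rho>(1,2) \<sigma> by simp
    also have "\<dots> = act t (gcomp E \<rho> \<tau>)"
      unfolding t(3) using t(1) \<rho>(1) \<tau>E sr \<open>\<omega> = \<tau>\<close> by simp
    finally have "q \<sigma> = q (act t (gcomp E \<rho> \<tau>))"
      by (rule arg_cong)
    also have "\<dots> = gcomp G (q \<rho>) (q \<tau>)"
      using t(1) \<rho>(1) \<tau>E sr by simp
    finally have q\<sigma>: "q \<sigma> = gcomp G (q \<rho>) (q \<tau>)" .
    have "src G (q \<rho>) = rng G (q \<tau>)"
      by (rule q_composable [OF \<rho>(1) \<tau>E sr])
    then show "q \<rho> = q ?\<rho>"
      using \<rho>(1) \<tau>E \<sigma> \<tau>(2) q\<sigma> by simp
  qed (use \<sigma> \<tau> \<tau>E in simp_all)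
  also have "gcomp E (ginv E ?\<rho>) \<sigma> = \<tau>"
    using \<sigma> \<tau> \<tau>E by simp
  finally show ?thesis
    using lift_indicator_eq_1 [OF S \<tau>(1)] by simp
qed

lemma convolution_indicator_right_nonzeroE:
  assumes S: "twist_bisection S" and f: "equivariant f" "fibre_finite f"
    and nz: "(f \<star> lift_indicator S) \<sigma> \<noteq> 0"
  obtains \<tau> where "\<sigma> \<in> arrows E" "\<tau> \<in> S" "src E \<tau> = src E \<sigma>" "f (gcomp E \<sigma> (ginv E \<tau>)) \<noteq> 0"
proof -
  obtain \<rho> where \<rho>: "\<sigma> \<in> arrows E" "\<rho> \<in> arrows E" "rng E \<rho> = rng E \<sigma>"
      "lift_indicator S (gcomp E (ginv E \<rho>) \<sigma>) \<noteq> 0"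
    using convolution_nonzeroE [OF nz] .
  from \<rho>(4) obtain t \<omega> where t: "t \<in> ring_units" "\<omega> \<in> S" "gcomp E (ginv E \<rho>) \<sigma> = act t \<omega>"
    by (rule lift_indicator_nonzeroE)
  have "src E \<omega> = src E (act t \<omega>)"
    using t twist_bisection_arrows [OF S] by simp
  also have "\<dots> = src E \<sigma>"
    unfolding t(3) [symmetric] using \<rho> by simp
  finally show thesis
    using that [OF \<rho>(1) t(2)] convolution_indicator_right [OF S f \<rho>(1) t(2)] nz by simp
qed

lemma openin_rng_q_preimage:
  assumes "openin (gtop G) U"
  shows "openin (gtop E) (preimage E (\<lambda>\<rho>. rng G (q \<rho>)) U)"
  using openin_continuous_map_preimage [OF continuous_map_compose [OF continuous_q base.continuous_rng] assms]
  by (simp add: preimage_def)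

text \<open>Near \<open>\<sigma>\<close>, the value of the product with the indicator of \<open>S\<close> is \<open>g\<close> at \<open>\<tau>\<^sup>-\<^sup>1 \<sigma>\<close>, where
  \<open>\<tau>\<close> is the element of \<open>S\<close> with the range of \<open>\<sigma>\<close>; as the range map is open, nearby \<open>\<sigma>\<close> have their
  \<open>\<tau>\<close> nearby.\<close>

lemma locally_constant_convolution_indicator:
  assumes S: "twist_bisection S" and g: "equivariant g" "locally_constant (gtop E) g"
  shows "locally_constant (gtop E) (lift_indicator S \<star> g)"
  unfolding locally_constant_def
proof
  fix \<sigma> assume "\<sigma> \<in> topspace (gtop E)"
  then have \<sigma>: "\<sigma> \<in> arrows E" by simp
  let ?h = "lift_indicator S \<star> g"
  show "\<exists>U. openin (gtop E) U \<and> \<sigma> \<in> U \<and> (\<forall>\<rho>\<in>U. ?h \<rho> = ?h \<sigma>)"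
  proof (cases "\<exists>\<tau>\<in>S. rng E \<tau> = rng E \<sigma>")
    case True
    then obtain \<tau> where \<tau>: "\<tau> \<in> S" "rng E \<tau> = rng E \<sigma>" by blast
    let ?EE = "prod_topology (gtop E) (gtop E)"
    define X where "X = subtopology ?EE {z. rng E (fst z) = rng E (snd z)}"
    define W where "W = {\<rho> \<in> topspace (gtop E). g \<rho> = g (gcomp E (ginv E \<tau>) \<sigma>)}"
    have X: "topspace X = {z \<in> arrows E \<times> arrows E. rng E (fst z) = rng E (snd z)}"
      by (auto simp: X_def)
    have "continuous_map X (gtop E) (\<lambda>z. gcomp E (ginv E (fst z)) (snd z))"
    proof (rule total.continuous_product)
      have "continuous_map X (gtop E) fst" "continuous_map X (gtop E) snd"
        unfolding X_def by (simp_all add: continuous_map_from_subtopology continuous_map_fst continuous_map_snd)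
      then show "continuous_map X (gtop E) (\<lambda>z. ginv E (fst z))" "continuous_map X (gtop E) snd"
        using continuous_map_compose [OF _ total.continuous_inv] by (fastforce simp: o_def)+
    qed (auto simp: X)
    moreover have W: "openin (gtop E) W"
      unfolding W_def by (rule openin_locally_constant [OF g(2)])
    ultimately have "openin X {z \<in> topspace X. gcomp E (ginv E (fst z)) (snd z) \<in> W}"
      by (rule openin_continuous_map_preimage)
    then obtain O' where O': "openin ?EE O'"
      and O'X: "{z \<in> topspace X. gcomp E (ginv E (fst z)) (snd z) \<in> W} = O' \<inter> {z. rng E (fst z) = rng E (snd z)}"
      unfolding X_def openin_subtopology by blast
    have \<tau>E: "\<tau> \<in> arrows E"
      using \<tau>(1) twist_bisection_arrows [OF S] by blast
    then have "(\<tau>, \<sigma>) \<in> {z \<in> topspace X. gcomp E (ginv E (fst z)) (snd z) \<in> W}"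
      using \<tau> \<sigma> by (simp add: X W_def)
    then have "(\<tau>, \<sigma>) \<in> O'"
      unfolding O'X by blast
    with O' [unfolded openin_prod_topology_alt, rule_format] obtain T V where TV: "openin (gtop E) T" "openin (gtop E) V" "\<tau> \<in> T" "\<sigma> \<in> V" "T \<times> V \<subseteq> O'"
      by meson
    \<comment> \<open>For \<open>\<rho>\<close> in \<open>U\<close>, some \<open>\<omega>\<close> in \<open>S\<close> with the range of \<open>\<rho>\<close> is close to \<open>\<tau>\<close>.\<close>
    define U where "U = V \<inter> preimage E (\<lambda>\<rho>. rng G (q \<rho>)) (rng G ` q ` (T \<inter> S))"
    have "openin (gtop G) (rng G ` q ` (T \<inter> S))"
      by (intro base.openin_rng_image openin_q_image openin_Int TV(1) twist_bisection_open S)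
    then have "openin (gtop E) U"
      unfolding U_def by (intro openin_Int TV(2) openin_rng_q_preimage)
    moreover have "\<sigma> \<in> U"
    proof -
      have "rng G (q \<sigma>) = rng G (q \<tau>)"
        using \<tau> \<tau>E \<sigma> rng_eq_iff by metis
      then show ?thesis
        using TV \<tau>(1) \<sigma> by (auto simp: U_def preimage_def)
    qed
    moreover have "?h \<rho> = g (gcomp E (ginv E \<tau>) \<sigma>)" if \<rho>: "\<rho> \<in> U" for \<rho>
    proof -
      obtain \<omega> where \<omega>: "\<omega> \<in> T" "\<omega> \<in> S" "rng G (q \<rho>) = rng G (q \<omega>)"
        using \<rho> by (auto simp: U_def preimage_def)
      have arr: "\<rho> \<in> arrows E" "\<omega> \<in> arrows E" "\<rho> \<in> V"
        using \<rho> \<omega> twist_bisection_arrows [OF S] by (auto simp: U_def preimage_def)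
      then have r: "rng E \<omega> = rng E \<rho>"
        using \<omega>(3) rng_eq_iff by metis
      have "(\<omega>, \<rho>) \<in> O' \<inter> {z. rng E (fst z) = rng E (snd z)}"
        using TV(5) \<omega>(1) arr(3) r by auto
      then have "gcomp E (ginv E \<omega>) \<rho> \<in> W"
        unfolding O'X [symmetric] by simp
      then show ?thesis
        using convolution_indicator_left [OF S g(1) arr(1) \<omega>(2) r] by (simp add: W_def)
    qed
    ultimately show ?thesis by metis
  next
    case False
    define U where "U = preimage E (\<lambda>\<rho>. rng G (q \<rho>)) (arrows G - rng G ` q ` S)"
    have "compactin (gtop G) (rng G ` q ` S)"
      by (rule image_compactin [OF twist_bisection_compact [OF S] base.continuous_rng])
    then have "openin (gtop G) (arrows G - rng G ` q ` S)"
      using compactin_imp_closedin [OF Hausdorff] by (fastforce simp: closedin_def)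
    then have "openin (gtop E) U"
      unfolding U_def by (rule openin_rng_q_preimage)
    moreover have zero: "?h \<rho> = 0" if "\<forall>\<tau>\<in>S. rng E \<tau> \<noteq> rng E \<rho>" for \<rho>
      using that convolution_indicator_left_nonzeroE [OF S g(1)] by metis
    moreover have "\<sigma> \<in> U"
    proof -
      have "rng G (q \<sigma>) \<noteq> rng G (q \<tau>)" if "\<tau> \<in> S" for \<tau>
        using False that \<sigma> twist_bisection_arrows [OF S that] rng_eq_iff by metis
      then show ?thesis
        using \<sigma> by (auto simp: U_def preimage_def)
    qed
    moreover have "\<forall>\<tau>\<in>S. rng E \<tau> \<noteq> rng E \<rho>" if "\<rho> \<in> U" for \<rho>
    proof
      fix \<tau> assume \<tau>: "\<tau> \<in> S"
      have "rng G (q \<rho>) \<noteq> rng G (q \<tau>)" "\<rho> \<in> arrows E"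
        using that \<tau> by (auto simp: U_def preimage_def)
      then show "rng E \<tau> \<noteq> rng E \<rho>"
        using twist_bisection_arrows [OF S \<tau>] rng_eq_iff by metis
    qed
    ultimately show ?thesis
      using False by (intro exI [of _ U]) simp
  qed
qed

text \<open>The product is linear in its left factor, which may therefore be the indicator of a bisection \<open>S\<close>.
  Then the support of the product lies over the product of the compact sets \<open>q ` S\<close> and
  \<open>q ` supp E g\<close>.\<close>

lemma steinberg_convolution:
  assumes f: "f \<in> A" and g: "g \<in> A"
  shows "f \<star> g \<in> A"
proof -
  note ge = steinberg_equivariant [OF g]
  have ind: "lift_indicator S \<star> g \<in> A" if S: "twist_bisection S" for S
  proof (rule steinbergI)
    show "equivariant (lift_indicator S \<star> g)"
      by (rule equivariant_convolution [OF ge])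
    show "locally_constant (gtop E) (lift_indicator S \<star> g)"
      by (rule locally_constant_convolution_indicator [OF S ge steinberg_locally_constant [OF g]])
    let ?C = "{gcomp G x y | x y. x \<in> q ` S \<and> y \<in> q ` supp E g \<and> src G x = rng G y}"
    show "compactin (gtop G) ?C"
      by (rule base.compactin_product [OF twist_bisection_compact [OF S] steinberg_compact [OF g]])
    show "q ` supp E (lift_indicator S \<star> g) \<subseteq> ?C"
    proof
      fix \<alpha> assume "\<alpha> \<in> q ` supp E (lift_indicator S \<star> g)"
      then obtain \<sigma> where \<sigma>: "\<alpha> = q \<sigma>" "(lift_indicator S \<star> g) \<sigma> \<noteq> 0"
        by (auto simp: supp_def)
      obtain \<tau> where \<tau>: "\<sigma> \<in> arrows E" "\<tau> \<in> S" "rng E \<tau> = rng E \<sigma>" "g (gcomp E (ginv E \<tau>) \<sigma>) \<noteq> 0"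
        using convolution_indicator_left_nonzeroE [OF S ge \<sigma>(2)] .
      have \<tau>E: "\<tau> \<in> arrows E"
        using \<tau> twist_bisection_arrows [OF S] by blast
      then have r: "rng G (q \<tau>) = rng G (q \<sigma>)"
        using \<tau> rng_eq_iff by metis
      let ?\<rho> = "gcomp E (ginv E \<tau>) \<sigma>"
      have "q ?\<rho> \<in> q ` supp E g"
        using \<tau> \<tau>E by (intro q_supp_I) simp_all
      moreover have "src G (q \<tau>) = rng G (q ?\<rho>)" "\<alpha> = gcomp G (q \<tau>) (q ?\<rho>)"
        using \<tau> \<tau>E r \<sigma>(1) by simp_all
      ultimately show "\<alpha> \<in> ?C"
        using \<tau>(2) by blast
    qed
  qed
  let ?M = "{f \<in> A. f \<star> g \<in> A}"
  have "fun_module.subspace ?M"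
  proof (rule fun_module.subspaceI)
    have "0 \<star> g = 0"
      by (simp add: fun_eq_iff convolution_def supp_def)
    then show "0 \<in> ?M"
      using fun_module.subspace_0 [OF subspace_steinberg] by simp
    show "f + f' \<in> ?M" if "f \<in> ?M" "f' \<in> ?M" for f f'
    proof -
      have "(f + f') \<star> g = f \<star> g + f' \<star> g"
        using that by (intro convolution_add_left steinberg_equivariant steinberg_fibre_finite g) auto
      then show ?thesis
        using that steinberg_add by simp
    qed
    show "fun_scale c f \<in> ?M" if "f \<in> ?M" for c f
    proof -
      have "fun_scale c f \<star> g = fun_scale c (f \<star> g)"
        using that by (intro convolution_scale_left steinberg_equivariant steinberg_fibre_finite g) auto
      then show ?thesis
        using that steinberg_scale by simp
    qed
  qed
  then have "fun_module.span (lift_indicator ` {S. twist_bisection S \<and> S \<subseteq> arrows E}) \<subseteq> ?M"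
    using ind lift_indicator_steinberg by (intro fun_module.span_minimal) auto
  moreover have "f \<in> fun_module.span (lift_indicator ` {S. twist_bisection S \<and> S \<subseteq> arrows E})"
  proof (rule steinberg_in_span [OF f])
    show "openin (gtop E) (arrows E)"
      using openin_topspace [of "gtop E"] by simp
    show "q ` supp E f \<subseteq> q ` arrows E"
      unfolding q_surj by (rule q_supp_subset)
  qed
  ultimately show ?thesis by blast
qed

lemma r_algebra_steinberg: "r_algebra fun_scale (convolution G E q) A"
proof (intro r_algebra.intro r_algebra_axioms.intro fun_module.module_axioms subspace_steinberg)
  fix f g h c
  show "f \<in> A \<Longrightarrow> g \<in> A \<Longrightarrow> f \<star> g \<in> A"
    by (rule steinberg_convolution)
  show "f \<in> A \<Longrightarrow> g \<in> A \<Longrightarrow> h \<in> A \<Longrightarrow> (f \<star> g) \<star> h = f \<star> (g \<star> h)"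
    by (intro convolution_assoc steinberg_equivariant steinberg_fibre_finite)
  show "f \<in> A \<Longrightarrow> g \<in> A \<Longrightarrow> h \<in> A \<Longrightarrow> (f + g) \<star> h = f \<star> h + g \<star> h"
    by (intro convolution_add_left steinberg_equivariant steinberg_fibre_finite)
  show "f \<star> (g + h) = f \<star> g + f \<star> h"
    by (rule convolution_add_right)
  show "f \<in> A \<Longrightarrow> g \<in> A \<Longrightarrow> fun_scale c f \<star> g = fun_scale c (f \<star> g)"
    by (intro convolution_scale_left steinberg_equivariant steinberg_fibre_finite)
  show "f \<star> fun_scale c g = fun_scale c (f \<star> g)"
    by (rule convolution_scale_right)
qed

lemma diagonal_convolution:
  assumes "f \<in> B" "g \<in> B"
  shows "f \<star> g \<in> B"
  unfolding diagonal_iff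
proof (intro conjI allI impI)
  note A = diagonal_steinberg [OF assms(1)] diagonal_steinberg [OF assms(2)]
  show "f \<star> g \<in> A"
    by (rule steinberg_convolution [OF A])
  fix \<sigma> assume nz: "(f \<star> g) \<sigma> \<noteq> 0"
  then have "\<sigma> \<in> arrows E"
    using convolution_outside by blast
  then have "g \<sigma> \<noteq> 0"
    using nz convolution_diagonal_left [OF assms(1) steinberg_equivariant [OF A(2)], of \<sigma>] by auto
  then show "q \<sigma> \<in> units G"
    by (rule diagonal_over_units [OF assms(2)])
qed

lemma r_algebra_diagonal: "r_algebra fun_scale (convolution G E q) B"
proof -
  interpret A: r_algebra fun_scale "convolution G E q" A
    by (rule r_algebra_steinberg)
  show ?thesis
  proof (intro r_algebra.intro r_algebra_axioms.intro fun_module.module_axioms subspace_diagonal)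
    fix f g h c
    show "f \<in> B \<Longrightarrow> g \<in> B \<Longrightarrow> f \<star> g \<in> B"
      by (rule diagonal_convolution)
    show "f \<in> B \<Longrightarrow> g \<in> B \<Longrightarrow> h \<in> B \<Longrightarrow> (f \<star> g) \<star> h = f \<star> (g \<star> h)"
      by (intro A.mul_assoc diagonal_steinberg)
    show "f \<in> B \<Longrightarrow> g \<in> B \<Longrightarrow> h \<in> B \<Longrightarrow> (f + g) \<star> h = f \<star> h + g \<star> h"
      by (intro A.mul_add_left diagonal_steinberg)
    show "f \<star> (g + h) = f \<star> g + f \<star> h"
      by (rule convolution_add_right)
    show "f \<in> B \<Longrightarrow> g \<in> B \<Longrightarrow> fun_scale c f \<star> g = fun_scale c (f \<star> g)"
      by (intro A.mul_scale_left diagonal_steinberg)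
    show "f \<star> fun_scale c g = fun_scale c (f \<star> g)"
      by (rule convolution_scale_right)
  qed
qed

end

section \<open>Idempotents and normalisers\<close>

context r_algebra
begin

text \<open>A local unit \<open>e\<close> for \<open>n\<close> can be inserted: \<open>k n = k e n\<close>.\<close>

lemma normaliser_partial_inverse_in_subalgebra:
  assumes lu: "local_units mul A (idempotents mul B)" and sub: "B \<subseteq> A"
    and n: "n \<in> A" and k: "k \<in> A" and conj: "\<And>b. b \<in> B \<Longrightarrow> mul (mul k b) n \<in> B"
  shows "mul k n \<in> B"
proof -
  obtain e where e: "e \<in> idempotents mul B" "mul e n = n"
    using lu n unfolding local_units_def by (metis empty_subsetI finite.emptyI finite.insertI insertI1 insert_subset)
  then have eB: "e \<in> B" by (simp add: idempotents_def)
  then have "mul (mul k e) n = mul k (mul e n)"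
    using n k sub by (intro mul_assoc) auto
  then show ?thesis
    using conj [OF eB] e(2) by simp
qed

text \<open>For partial inverses \<open>k\<close> of \<open>n\<close> and \<open>l\<close> of \<open>m\<close>, the product \<open>l k\<close> is a partial inverse of \<open>n m\<close>
  because \<open>k n\<close> and \<open>m l\<close> lie in the commutative subalgebra.\<close>

lemma normalisers_mult:
  assumes lu: "local_units mul A (idempotents mul B)" and sub: "B \<subseteq> A"
    and comm: "\<And>a b. a \<in> B \<Longrightarrow> b \<in> B \<Longrightarrow> mul a b = mul b a"
    and n: "n \<in> normalisers mul A B" and m: "m \<in> normalisers mul A B"
  shows "mul n m \<in> normalisers mul A B"
proof -
  obtain k where nA: "n \<in> A" and kA: "k \<in> A" and k: "mul (mul k n) k = k" "mul (mul n k) n = n"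
    "\<And>b. b \<in> B \<Longrightarrow> mul (mul k b) n \<in> B" "\<And>b. b \<in> B \<Longrightarrow> mul (mul n b) k \<in> B"
    using n unfolding normalisers_def by blast
  obtain l where mA: "m \<in> A" and lA: "l \<in> A" and l: "mul (mul l m) l = l" "mul (mul m l) m = m"
    "\<And>b. b \<in> B \<Longrightarrow> mul (mul l b) m \<in> B" "\<And>b. b \<in> B \<Longrightarrow> mul (mul m b) l \<in> B"
    using m unfolding normalisers_def by blast
  note cl = mul_closed nA mA kA lA
  have knB: "mul k n \<in> B"
    by (rule normaliser_partial_inverse_in_subalgebra [OF lu sub nA kA k(3)])
  have mlB: "mul m l \<in> B"
    by (rule normaliser_partial_inverse_in_subalgebra [OF lu sub lA mA l(4)])
  have c: "mul (mul k n) (mul m l) = mul (mul m l) (mul k n)"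
    by (rule comm [OF knB mlB])
  have left: "mul (mul (mul n m) (mul l k)) (mul n m) = mul n m"
  proof -
    have "mul (mul (mul n m) (mul l k)) (mul n m) = mul n (mul (mul (mul m l) (mul k n)) m)"
      by (simp add: mul_assoc cl)
    also have "\<dots> = mul (mul (mul n k) n) (mul (mul m l) m)"
      unfolding c [symmetric] by (simp add: mul_assoc cl)
    also have "\<dots> = mul n m"
      using k l by simp
    finally show ?thesis .
  qed
  have right: "mul (mul (mul l k) (mul n m)) (mul l k) = mul l k"
  proof -
    have "mul (mul (mul l k) (mul n m)) (mul l k) = mul l (mul (mul (mul k n) (mul m l)) k)"
      by (simp add: mul_assoc cl)
    also have "\<dots> = mul (mul (mul l m) l) (mul (mul k n) k)"
      unfolding c by (simp add: mul_assoc cl)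
    also have "\<dots> = mul l k"
      using k l by simp
    finally show ?thesis .
  qed
  have "mul (mul (mul l k) b) (mul n m) \<in> B" "mul (mul (mul n m) b) (mul l k) \<in> B" if b: "b \<in> B" for b
  proof -
    have bA: "b \<in> A" using b sub by blast
    have "mul (mul (mul l k) b) (mul n m) = mul (mul l (mul (mul k b) n)) m"
      by (simp add: mul_assoc cl bA)
    then show "mul (mul (mul l k) b) (mul n m) \<in> B"
      using l(3) k(3) b by simp
    have "mul (mul (mul n m) b) (mul l k) = mul (mul n (mul (mul m b) l)) k"
      by (simp add: mul_assoc cl bA)
    then show "mul (mul (mul n m) b) (mul l k) \<in> B"
      using k(4) l(4) b by simp
  qed
  then show ?thesis
    unfolding normalisers_def using left right cl by blast
qed

end

context discrete_twist
begin

lemma idempotent_value: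
  assumes e: "e \<in> idempotents (convolution G E q) B" and u: "u \<in> units E"
    and indecomposable: "indecomposable_ring TYPE('r)"
  shows "e u = 0 \<or> e u = 1"
proof -
  have eB: "e \<in> B" "e \<star> e = e"
    using e by (simp_all add: idempotents_def)
  have "(e \<star> e) u = e (rng E u) * e u"
    by (rule convolution_diagonal_left [OF eB(1) steinberg_equivariant [OF diagonal_steinberg [OF eB(1)]]
          total.units_arrows [OF u]])
  then have "e u * e u = e u"
    using eB(2) total.rng_unit [OF u] by simp
  then show ?thesis
    using indecomposable by (simp add: indecomposable_ring_def)
qed

lemma lift_indicator_unit:
  assumes S: "twist_bisection S" "S \<subseteq> units E" and u: "u \<in> units E"
  shows "lift_indicator S u = (if q u \<in> q ` S then 1 else 0)"
proof (cases "q u \<in> q ` S")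
  case True
  then obtain v where "v \<in> S" "q u = q v" by blast
  then have "u \<in> S"
    using q_inj_units [OF u] S(2) by blast
  then show ?thesis
    using lift_indicator_eq_1 [OF S(1)] True by simp
qed (simp add: lift_indicator_eq_0 [OF S(1)])

end

context hausdorff_ample_twist
begin

lemma lift_indicator_idempotent:
  assumes S: "twist_bisection S" "S \<subseteq> units E"
  shows "lift_indicator S \<in> idempotents (convolution G E q) B"
proof -
  have nz: "q \<sigma> \<in> units G \<and> rng G (q \<sigma>) \<in> q ` S" if "lift_indicator S \<sigma> \<noteq> 0" for \<sigma>
  proof -
    have "q \<sigma> \<in> q ` S"
      using lift_indicator_eq_0 [OF S(1), of \<sigma>] that by argo
    moreover from this have "q \<sigma> \<in> units G"
      using image_mono [OF S(2), of q] q_image_units by auto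
    ultimately show ?thesis
      using base.rng_unit by simp
  qed
  have B: "lift_indicator S \<in> B"
    unfolding diagonal_iff using lift_indicator_steinberg [OF S(1)] nz by blast
  have "(lift_indicator S \<star> lift_indicator S) \<sigma> = lift_indicator S \<sigma>" for \<sigma>
  proof (cases "\<sigma> \<in> arrows E")
    case True
    have "(lift_indicator S \<star> lift_indicator S) \<sigma> = lift_indicator S (rng E \<sigma>) * lift_indicator S \<sigma>"
      by (rule convolution_diagonal_left [OF B equivariant_lift_indicator [OF S(1)] True])
    moreover have "lift_indicator S (rng E \<sigma>) = 1" if "lift_indicator S \<sigma> \<noteq> 0"
      using lift_indicator_unit [OF S total.rng_in_units [OF True]] nz [OF that] True by simp
    ultimately show ?thesis
      by (cases "lift_indicator S \<sigma> = 0") simp_all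
  next
    case False
    then show ?thesis
      using equivariant_outside [OF equivariant_lift_indicator [OF S(1)]] by simp
  qed
  then have "lift_indicator S \<star> lift_indicator S = lift_indicator S" by blast
  with B show ?thesis by (simp add: idempotents_def)
qed

lemma unit_indicator:
  assumes L: "openin (gtop G) L" "compactin (gtop G) L" "L \<subseteq> units G"
  obtains e where "e \<in> idempotents (convolution G E q) B"
    "\<And>u. u \<in> units E \<Longrightarrow> e u = (if q u \<in> L then 1 else 0)"
proof -
  let ?S = "units E \<inter> preimage E q L"
  note S = twist_bisection_units [OF L]
  show thesis
  proof
    show "lift_indicator ?S \<in> idempotents (convolution G E q) B"
      by (rule lift_indicator_idempotent [OF S(1)]) simp
    show "lift_indicator ?S u = (if q u \<in> L then 1 else 0)" if "u \<in> units E" for u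
      using lift_indicator_unit [OF S(1) _ that] S(2) by simp
  qed
qed

text \<open>The indicator of a compact open set of units containing all ranges and sources of the supports acts
  as an identity.\<close>

lemma local_units_diagonal: "local_units (convolution G E q) A (idempotents (convolution G E q) B)"
  unfolding local_units_def
proof (intro allI impI)
  fix F assume F: "finite F \<and> F \<subseteq> A"
  define L where "L = (\<Union>f\<in>F. rng G ` q ` supp E f \<union> src G ` q ` supp E f)"
  have open_supp: "openin (gtop G) (q ` supp E f)" and compact_supp: "compactin (gtop G) (q ` supp E f)"
    if "f \<in> F" for f
    using F that openin_q_supp steinberg_locally_constant steinberg_compact by blast+
  obtain e where e: "e \<in> idempotents (convolution G E q) B"
    "\<And>u. u \<in> units E \<Longrightarrow> e u = (if q u \<in> L then 1 else 0)"
  proof (rule unit_indicator)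
    show "openin (gtop G) L"
      unfolding L_def using open_supp base.openin_rng_image base.openin_src_image by (intro openin_Union) blast
    show "compactin (gtop G) L"
      unfolding L_def
    proof (rule compactin_Union)
      show "finite ((\<lambda>f. rng G ` q ` supp E f \<union> src G ` q ` supp E f) ` F)"
        using F by simp
      fix C assume "C \<in> (\<lambda>f. rng G ` q ` supp E f \<union> src G ` q ` supp E f) ` F"
      then obtain f where "f \<in> F" "C = rng G ` q ` supp E f \<union> src G ` q ` supp E f" by blast
      then show "compactin (gtop G) C"
        using image_compactin [OF compact_supp base.continuous_rng]
          image_compactin [OF compact_supp base.continuous_src] compactin_Un by blast
    qed
    show "L \<subseteq> units G"
      using q_supp_subset base.rng_in_units base.src_in_units by (fastforce simp: L_def)
  qed blast
  have eB: "e \<in> B"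
    using e(1) by (simp add: idempotents_def)
  have "e \<star> f = f \<and> f \<star> e = f" if f: "f \<in> F" for f
  proof -
    have fA: "f \<in> A" using F f by blast
    have e1: "e (rng E \<sigma>) = 1 \<and> e (src E \<sigma>) = 1" if \<sigma>: "\<sigma> \<in> arrows E" "f \<sigma> \<noteq> 0" for \<sigma>
    proof -
      have "q \<sigma> \<in> q ` supp E f"
        using \<sigma> by (intro q_supp_I)
      then have "rng G (q \<sigma>) \<in> L" "src G (q \<sigma>) \<in> L"
        unfolding L_def using f by blast+
      then show ?thesis
        using e(2) total.rng_in_units [OF \<sigma>(1)] total.src_in_units [OF \<sigma>(1)] \<sigma>(1) by simp
    qed
    have "(e \<star> f) \<sigma> = f \<sigma> \<and> (f \<star> e) \<sigma> = f \<sigma>" for \<sigma>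
    proof (cases "\<sigma> \<in> arrows E")
      case True
      then show ?thesis
        using convolution_diagonal_left [OF eB steinberg_equivariant [OF fA] True] e1 [OF True]
          convolution_diagonal_right [OF steinberg_equivariant [OF fA] steinberg_fibre_finite [OF fA] eB True]
        by (cases "f \<sigma> = 0") simp_all
    next
      case False
      then show ?thesis
        using equivariant_outside [OF steinberg_equivariant [OF fA]] by simp
    qed
    then show ?thesis by blast
  qed
  with e(1) show "\<exists>e\<in>idempotents (convolution G E q) B. \<forall>f\<in>F. e \<star> f = f \<and> f \<star> e = f" by blast
qed

lemma diagonal_span: "B = fun_module.span (idempotents (convolution G E q) B)"
proof
  show "B \<subseteq> fun_module.span (idempotents (convolution G E q) B)"
  proof
    fix f assume f: "f \<in> B"
    have "f \<in> fun_module.span (lift_indicator ` {S. twist_bisection S \<and> S \<subseteq> units E})"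
    proof (rule steinberg_in_span [OF diagonal_steinberg [OF f] openin_units_total])
      show "q ` supp E f \<subseteq> q ` units E"
        unfolding q_image_units using diagonal_over_units [OF f] by (auto simp: supp_def)
    qed
    moreover have "lift_indicator ` {S. twist_bisection S \<and> S \<subseteq> units E} \<subseteq> idempotents (convolution G E q) B"
      using lift_indicator_idempotent by blast
    ultimately show "f \<in> fun_module.span (idempotents (convolution G E q) B)"
      using fun_module.span_mono by blast
  qed
  show "fun_module.span (idempotents (convolution G E q) B) \<subseteq> B"
    by (rule fun_module.span_minimal [OF _ subspace_diagonal]) (simp add: idempotents_def)
qed

lemma
  assumes S: "twist_bisection S" and \<rho>: "\<rho> \<in> arrows E" and \<omega>: "\<omega> \<in> S"
  shows convolution_inverse_indicator_left:
      "equivariant g \<Longrightarrow> src E \<omega> = rng E \<rho> \<Longrightarrow> (lift_indicator (ginv E ` S) \<star> g) \<rho> = g (gcomp E \<omega> \<rho>)"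
    and convolution_inverse_indicator_right:
      "equivariant f \<Longrightarrow> fibre_finite f \<Longrightarrow> rng E \<omega> = src E \<rho>
         \<Longrightarrow> (f \<star> lift_indicator (ginv E ` S)) \<rho> = f (gcomp E \<rho> \<omega>)"
proof -
  have \<omega>E: "\<omega> \<in> arrows E"
    using \<omega> twist_bisection_arrows [OF S] by blast
  note S' = twist_bisection_inverse [OF S] and \<omega>' = imageI [OF \<omega>, of "ginv E"]
  show "(lift_indicator (ginv E ` S) \<star> g) \<rho> = g (gcomp E \<omega> \<rho>)"
    if g: "equivariant g" and s: "src E \<omega> = rng E \<rho>"
    using convolution_indicator_left [OF S' g \<rho> \<omega>'] \<omega>E s by simp
  show "(f \<star> lift_indicator (ginv E ` S)) \<rho> = f (gcomp E \<rho> \<omega>)"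
    if f: "equivariant f" "fibre_finite f" and s: "rng E \<omega> = src E \<rho>"
    using convolution_indicator_right [OF S' f \<rho> \<omega>'] \<omega>E s by simp
qed

text \<open>A nonzero value at \<open>\<sigma>\<close> comes from \<open>\<tau>, \<omega> \<in> S\<close> such that \<open>\<tau>\<^sup>-\<^sup>1 \<sigma> \<omega>\<close> lies over a unit. Then \<open>\<tau>\<close> and \<open>\<omega>\<close>
  have the same source, so they are equal and \<open>\<sigma>\<close> lies over a unit.\<close>

lemma lift_indicator_conjugates_diagonal:
  assumes S: "twist_bisection S" and b: "b \<in> B"
  shows "(lift_indicator S \<star> b) \<star> lift_indicator (ginv E ` S) \<in> B"
  unfolding diagonal_iff
proof (intro conjI allI impI)
  note bA = diagonal_steinberg [OF b] and S' = twist_bisection_inverse [OF S]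
  have hbA: "lift_indicator S \<star> b \<in> A"
    by (rule steinberg_convolution [OF lift_indicator_steinberg [OF S] bA])
  note hb = steinberg_equivariant [OF hbA] steinberg_fibre_finite [OF hbA]
  show "(lift_indicator S \<star> b) \<star> lift_indicator (ginv E ` S) \<in> A"
    by (rule steinberg_convolution [OF hbA lift_indicator_steinberg [OF S']])
  fix \<sigma> assume nz: "((lift_indicator S \<star> b) \<star> lift_indicator (ginv E ` S)) \<sigma> \<noteq> 0"
  obtain \<tau>' where \<tau>': "\<sigma> \<in> arrows E" "\<tau>' \<in> ginv E ` S" "src E \<tau>' = src E \<sigma>"
    "(lift_indicator S \<star> b) (gcomp E \<sigma> (ginv E \<tau>')) \<noteq> 0"
    using convolution_indicator_right_nonzeroE [OF S' hb nz] .
  obtain \<omega> where \<omega>: "\<omega> \<in> S" "\<tau>' = ginv E \<omega>"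
    using \<tau>'(2) by blast
  have \<omega>E: "\<omega> \<in> arrows E"
    using \<omega>(1) twist_bisection_arrows [OF S] by blast
  have s: "src E \<sigma> = rng E \<omega>"
    using \<tau>'(3) \<omega> \<omega>E by simp
  have "(lift_indicator S \<star> b) (gcomp E \<sigma> \<omega>) \<noteq> 0"
    using \<tau>'(4) \<omega>(2) \<omega>E by simp
  then obtain \<tau> where \<tau>: "\<tau> \<in> S" "rng E \<tau> = rng E (gcomp E \<sigma> \<omega>)"
    "b (gcomp E (ginv E \<tau>) (gcomp E \<sigma> \<omega>)) \<noteq> 0"
    using convolution_indicator_left_nonzeroE [OF S steinberg_equivariant [OF bA]] by metis
  have \<tau>E: "\<tau> \<in> arrows E"
    using \<tau>(1) twist_bisection_arrows [OF S] by blast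
  let ?\<rho> = "gcomp E \<sigma> \<omega>"
  have \<rho>: "?\<rho> \<in> arrows E" "src E ?\<rho> = src E \<omega>"
    using \<tau>'(1) \<omega>E s by simp_all
  have "q (gcomp E (ginv E \<tau>) ?\<rho>) = gcomp G (ginv G (q \<tau>)) (q ?\<rho>)"
    using q_product [of "ginv E \<tau>" ?\<rho>] \<tau>E \<rho>(1) \<tau>(2) by simp
  then have "gcomp G (ginv G (q \<tau>)) (q ?\<rho>) \<in> units G"
    using diagonal_over_units [OF b \<tau>(3)] by simp
  moreover have "rng G (q \<tau>) = rng G (q ?\<rho>)"
    using \<tau>(2) \<tau>E \<rho>(1) rng_eq_iff by metis
  ultimately have q\<tau>: "q \<tau> = q ?\<rho>"
    using base.inv_product_unit_iff [OF q_arrows [OF \<tau>E] q_arrows [OF \<rho>(1)]] by simp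
  then have "src E \<tau> = src E \<omega>"
    using \<rho> \<tau>E src_eq_iff by metis
  then have "\<tau> = \<omega>"
    by (rule twist_bisection_src [OF S \<tau>(1) \<omega>(1)])
  then have "gcomp G (q \<sigma>) (q \<omega>) = q \<omega>"
    using q\<tau> \<tau>'(1) \<omega>E s by simp
  moreover have sG: "src G (q \<sigma>) = rng G (q \<omega>)"
    by (rule q_composable [OF \<tau>'(1) \<omega>E s])
  moreover have "q \<sigma> = gcomp G (gcomp G (q \<sigma>) (q \<omega>)) (ginv G (q \<omega>))"
    using \<tau>'(1) \<omega>E sG by simp
  ultimately have "q \<sigma> = rng G (q \<omega>)"
    using \<omega>E by simp
  then show "q \<sigma> \<in> units G"
    using base.rng_in_units \<omega>E by simp
qed

text \<open>By equivariance it suffices to compare the functions on \<open>S\<close> and off \<open>q ` S\<close>. A nonzero value of the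
  left-hand side at \<open>\<sigma>\<close> comes from \<open>\<omega>, \<tau> \<in> S\<close> with \<open>\<omega>\<^sup>-\<^sup>1 \<sigma> \<tau>\<^sup>-\<^sup>1\<close> a translate of some \<open>\<kappa>\<^sup>-\<^sup>1\<close> with \<open>\<kappa> \<in> S\<close>.
  Comparing sources and ranges shows \<open>\<omega> = \<kappa> = \<tau>\<close>, so \<open>\<sigma>\<close> is a translate of \<open>\<tau>\<close>.\<close>

lemma lift_indicator_inverse_product:
  assumes S: "twist_bisection S"
  shows "(lift_indicator S \<star> lift_indicator (ginv E ` S)) \<star> lift_indicator S = lift_indicator S"
proof -
  let ?h = "lift_indicator S" and ?k = "lift_indicator (ginv E ` S)"
  note S' = twist_bisection_inverse [OF S]
  note SE = twist_bisection_arrows [OF S]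
  note h = equivariant_lift_indicator [OF S] and k = equivariant_lift_indicator [OF S']
  have hk: "equivariant (?h \<star> ?k)" "fibre_finite (?h \<star> ?k)"
    using equivariant_convolution [OF k]
      fibre_finite_convolution [OF lift_indicator_fibre_finite [OF S] lift_indicator_fibre_finite [OF S']]
    by blast+
  show ?thesis
  proof (rule equivariant_eqI [OF equivariant_convolution [OF h] h])
    show "S \<subseteq> arrows E" using SE by blast
    fix \<tau> assume \<tau>: "\<tau> \<in> S"
    then have \<tau>E: "\<tau> \<in> arrows E" by (rule SE)
    have "((?h \<star> ?k) \<star> ?h) \<tau> = (?h \<star> ?k) (gcomp E \<tau> (ginv E \<tau>))"
      by (rule convolution_indicator_right [OF S hk \<tau>E \<tau> refl])
    also have "\<dots> = ?k (gcomp E (ginv E \<tau>) (gcomp E \<tau> (ginv E \<tau>)))"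
      using \<tau>E by (intro convolution_indicator_left [OF S k _ \<tau>]) simp_all
    also have "\<dots> = 1"
      using \<tau>E lift_indicator_eq_1 [OF S' imageI [OF \<tau>]] by simp
    finally show "((?h \<star> ?k) \<star> ?h) \<tau> = ?h \<tau>"
      using lift_indicator_eq_1 [OF S \<tau>] by simp
  next
    fix \<sigma> assume \<sigma>: "\<sigma> \<in> arrows E" "q \<sigma> \<notin> q ` S"
    have "((?h \<star> ?k) \<star> ?h) \<sigma> = 0"
    proof (rule ccontr)
      assume "((?h \<star> ?k) \<star> ?h) \<sigma> \<noteq> 0"
      then obtain \<tau> where \<tau>: "\<tau> \<in> S" "src E \<tau> = src E \<sigma>" "(?h \<star> ?k) (gcomp E \<sigma> (ginv E \<tau>)) \<noteq> 0"
        using convolution_indicator_right_nonzeroE [OF S hk] by metis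
      have \<tau>E: "\<tau> \<in> arrows E" using \<tau>(1) by (rule SE)
      obtain \<omega> where \<omega>: "\<omega> \<in> S" "rng E \<omega> = rng E (gcomp E \<sigma> (ginv E \<tau>))"
        "?k (gcomp E (ginv E \<omega>) (gcomp E \<sigma> (ginv E \<tau>))) \<noteq> 0"
        using convolution_indicator_left_nonzeroE [OF S k \<tau>(3)] by metis
      have \<omega>E: "\<omega> \<in> arrows E" using \<omega>(1) by (rule SE)
      have r: "rng E \<omega> = rng E \<sigma>"
        using \<omega>(2) \<sigma>(1) \<tau>E \<tau>(2) by simp
      let ?\<rho> = "gcomp E (ginv E \<omega>) (gcomp E \<sigma> (ginv E \<tau>))"
      from \<omega>(3) obtain t \<kappa>' where t: "t \<in> ring_units" "\<kappa>' \<in> ginv E ` S" "?\<rho> = act t \<kappa>'"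
        by (rule lift_indicator_nonzeroE)
      then obtain \<kappa> where \<kappa>: "\<kappa> \<in> S" "\<kappa>' = ginv E \<kappa>" by blast
      have \<kappa>E: "\<kappa> \<in> arrows E" using \<kappa>(1) by (rule SE)
      have "src E \<omega> = rng E ?\<rho>"
        using \<omega>E \<sigma>(1) \<tau>E r \<tau>(2) by simp
      also have "\<dots> = src E \<kappa>"
        unfolding t(3) using t(1) \<kappa>(2) \<kappa>E by simp
      finally have \<omega>\<kappa>: "\<omega> = \<kappa>"
        by (rule twist_bisection_src [OF S \<omega>(1) \<kappa>(1)])
      have "rng E \<tau> = src E ?\<rho>"
        using \<omega>E \<sigma>(1) \<tau>E r \<tau>(2) by simp
      also have "\<dots> = rng E \<kappa>"
        unfolding t(3) using t(1) \<kappa>(2) \<kappa>E by simp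
      finally have \<tau>\<kappa>: "\<tau> = \<kappa>"
        by (rule twist_bisection_rng [OF S \<tau>(1) \<kappa>(1)])
      have eq: "\<omega> = \<tau>" using \<omega>\<kappa> \<tau>\<kappa> by simp
      have "gcomp E \<sigma> (ginv E \<tau>) = gcomp E \<tau> ?\<rho>"
        unfolding eq using \<sigma>(1) \<tau>E \<tau>(2) r [unfolded eq] by simp
      also have "\<dots> = act t (rng E \<tau>)"
        unfolding t(3) using t(1) \<kappa>(2) \<tau>\<kappa> \<kappa>E by simp
      finally have "q (gcomp E \<sigma> (ginv E \<tau>)) = q (act t (rng E \<tau>))"
        by (rule arg_cong)
      then have "gcomp G (q \<sigma>) (ginv G (q \<tau>)) \<in> units G"
        using \<sigma>(1) \<tau>E \<tau>(2) t(1) base.rng_in_units by simp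
      moreover have "src G (q \<sigma>) = src G (q \<tau>)"
        using \<tau>(2) \<tau>E \<sigma>(1) src_eq_iff by metis
      ultimately have "q \<sigma> = q \<tau>"
        using base.product_inv_unit_iff [OF q_arrows [OF \<sigma>(1)] q_arrows [OF \<tau>E]] by blast
      then show False
        using \<sigma>(2) \<tau>(1) by blast
    qed
    then show "((?h \<star> ?k) \<star> ?h) \<sigma> = ?h \<sigma>"
      using lift_indicator_eq_0 [OF S \<sigma>(2)] by simp
  qed
qed

lemma lift_indicator_normaliser:
  assumes S: "twist_bisection S"
  shows "lift_indicator S \<in> normalisers (convolution G E q) A B"
proof -
  note S' = twist_bisection_inverse [OF S]
  show ?thesis
    unfolding normalisers_def
    using lift_indicator_steinberg [OF S] lift_indicator_steinberg [OF S']
      lift_indicator_inverse_product [OF S] lift_indicator_inverse_product [OF S']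
      lift_indicator_conjugates_diagonal [OF S] lift_indicator_conjugates_diagonal [OF S']
    unfolding inverse_inverse_image [OF S] by blast
qed

lemma normalisers_steinberg: "normalisers (convolution G E q) A B \<subseteq> A"
  by (auto simp: normalisers_def)

lemma steinberg_span: "A = fun_module.span (normalisers (convolution G E q) A B)"
proof
  show "A \<subseteq> fun_module.span (normalisers (convolution G E q) A B)"
  proof
    fix f assume f: "f \<in> A"
    have "f \<in> fun_module.span (lift_indicator ` {S. twist_bisection S \<and> S \<subseteq> arrows E})"
    proof (rule steinberg_in_span [OF f])
      show "openin (gtop E) (arrows E)"
        using openin_topspace [of "gtop E"] by simp
      show "q ` supp E f \<subseteq> q ` arrows E"
        unfolding q_surj by (rule q_supp_subset)
    qed
    moreover have "lift_indicator ` {S. twist_bisection S \<and> S \<subseteq> arrows E}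
        \<subseteq> normalisers (convolution G E q) A B"
      using lift_indicator_normaliser by blast
    ultimately show "f \<in> fun_module.span (normalisers (convolution G E q) A B)"
      using fun_module.span_mono by blast
  qed
  show "fun_module.span (normalisers (convolution G E q) A B) \<subseteq> A"
    by (rule fun_module.span_minimal [OF normalisers_steinberg subspace_steinberg])
qed

end

section \<open>Conditional expectations\<close>

context discrete_twist
begin

lemma diagonal_restriction_eq:
  "diagonal_restriction G E q f = restrict_over (units G) f" for f :: "'s \<Rightarrow> 'r"
  by (simp add: diagonal_restriction_def restrict_over_def)

lemma diagonal_restriction_over_units:
  "\<sigma> \<in> arrows E \<Longrightarrow> q \<sigma> \<in> units G \<Longrightarrow> diagonal_restriction G E q f \<sigma> = f \<sigma>"
  for f :: "'s \<Rightarrow> 'r"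
  by (simp add: diagonal_restriction_def preimage_def)

lemma diagonal_restriction_off_units:
  "q \<sigma> \<notin> units G \<Longrightarrow> diagonal_restriction G E q f \<sigma> = 0"
  for f :: "'s \<Rightarrow> 'r"
  by (simp add: diagonal_restriction_def preimage_def)

lemma diagonal_restriction_outside:
  "\<sigma> \<notin> arrows E \<Longrightarrow> diagonal_restriction G E q f \<sigma> = 0"
  for f :: "'s \<Rightarrow> 'r"
  by (simp add: diagonal_restriction_def preimage_def)

end

context hausdorff_ample_twist
begin

lemma diagonal_restriction_diagonal:
  assumes "f \<in> A"
  shows "diagonal_restriction G E q f \<in> B"
  unfolding diagonal_iff
proof (intro conjI allI impI)
  show "diagonal_restriction G E q f \<in> A"
    unfolding diagonal_restriction_eq
    by (rule restrict_over_steinberg [OF assms base.openin_units base.closedin_units [OF Hausdorff]])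
  show "q \<sigma> \<in> units G" if "diagonal_restriction G E q f \<sigma> \<noteq> 0" for \<sigma>
    using that diagonal_restriction_off_units by metis
qed

lemma convolution_bimodule:
  assumes f: "f \<in> A" and b: "b \<in> B" and b': "b' \<in> B" and \<sigma>: "\<sigma> \<in> arrows E"
  shows "((b \<star> f) \<star> b') \<sigma> = b (rng E \<sigma>) * f \<sigma> * b' (src E \<sigma>)"
proof -
  have "b \<star> f \<in> A"
    by (rule steinberg_convolution [OF diagonal_steinberg [OF b] f])
  then have "((b \<star> f) \<star> b') \<sigma> = (b \<star> f) \<sigma> * b' (src E \<sigma>)"
    by (intro convolution_diagonal_right steinberg_equivariant steinberg_fibre_finite b' \<sigma>)
  then show ?thesis
    using convolution_diagonal_left [OF b steinberg_equivariant [OF f] \<sigma>] by simp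
qed

lemma conditional_expectation_restriction:
  "conditional_expectation fun_scale (convolution G E q) A B (diagonal_restriction G E q)"
  unfolding conditional_expectation_def
proof (intro conjI ballI allI)
  let ?P = "diagonal_restriction G E q"
  show "?P ` A \<subseteq> B"
    using diagonal_restriction_diagonal by blast
  show "?P (f + g) = ?P f + ?P g" for f g
    by (simp add: fun_eq_iff diagonal_restriction_def)
  show "?P (fun_scale t f) = fun_scale t (?P f)" for t f
    by (simp add: fun_eq_iff diagonal_restriction_def fun_scale_def)
  show "?P b = b" if b: "b \<in> B" for b
  proof
    fix \<sigma>
    show "?P b \<sigma> = b \<sigma>"
      using diagonal_over_units [OF b, of \<sigma>]
        equivariant_nonzero_arrows [OF steinberg_equivariant [OF diagonal_steinberg [OF b]], of \<sigma>]
      by (cases "b \<sigma> = 0") (simp_all add: diagonal_restriction_def preimage_def)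
  qed
  show "?P ((b \<star> f) \<star> b') = (b \<star> ?P f) \<star> b'" if f: "f \<in> A" and b: "b \<in> B" and b': "b' \<in> B" for b f b'
  proof
    fix \<sigma>
    note Pf = diagonal_steinberg [OF diagonal_restriction_diagonal [OF f]]
    show "?P ((b \<star> f) \<star> b') \<sigma> = ((b \<star> ?P f) \<star> b') \<sigma>"
    proof (cases "\<sigma> \<in> arrows E")
      case \<sigma>: True
      show ?thesis
        using convolution_bimodule [OF f b b' \<sigma>] convolution_bimodule [OF Pf b b' \<sigma>]
          diagonal_restriction_over_units [OF \<sigma>] diagonal_restriction_off_units [of \<sigma>]
        by (cases "q \<sigma> \<in> units G") simp_all
    next
      case False
      then show ?thesis by (simp add: diagonal_restriction_outside)
    qed
  qed
qed

text \<open>If \<open>a\<close> is nonzero at \<open>\<sigma>\<close>, multiplication by the indicator of the inverse of a bisection through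
  \<open>\<sigma>\<close> moves the value at \<open>\<sigma>\<close> to the unit \<open>src E \<sigma>\<close>.\<close>

lemma faithful_expectation_restriction:
  "faithful_expectation (convolution G E q) A B (diagonal_restriction G E q)"
  unfolding faithful_expectation_def
proof (intro ballI impI)
  fix a assume a: "a \<in> A" "a \<noteq> 0"
  then obtain \<sigma> where \<sigma>: "a \<sigma> \<noteq> 0"
    by (metis ext zero_fun_apply)
  then have \<sigma>E: "\<sigma> \<in> arrows E"
    using equivariant_nonzero_arrows [OF steinberg_equivariant [OF a(1)]] by blast
  obtain S where S: "twist_bisection S" "\<sigma> \<in> S" "S \<subseteq> arrows E"
    using twist_bisection_exists [of "arrows E" \<sigma>] \<sigma>E openin_topspace [of "gtop E"] by auto
  let ?n = "lift_indicator (ginv E ` S)"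
  have "(?n \<star> a) (src E \<sigma>) = a (gcomp E \<sigma> (src E \<sigma>))"
    using \<sigma>E by (intro convolution_inverse_indicator_left [OF S(1) _ S(2)] steinberg_equivariant a) simp_all
  then have "diagonal_restriction G E q (?n \<star> a) (src E \<sigma>) \<noteq> 0"
    using \<sigma> \<sigma>E diagonal_restriction_over_units [of "src E \<sigma>"] base.src_in_units by simp
  then have "diagonal_restriction G E q (?n \<star> a) \<noteq> 0"
    by (metis zero_fun_apply)
  moreover have "?n \<in> normalisers (convolution G E q) A B"
    by (rule lift_indicator_normaliser [OF twist_bisection_inverse [OF S(1)]])
  ultimately show "\<exists>n\<in>normalisers (convolution G E q) A B. diagonal_restriction G E q (n \<star> a) \<noteq> 0"
    by blast
qed

text \<open>The functions supported off the units are spanned by normalisers \<open>n\<close> supported off the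
  units. If \<open>Q n = n e\<close>, then \<open>Q n\<close> is supported in the support of \<open>n\<close>, hence off the units;
  being diagonal, it vanishes. So \<open>Q\<close> kills what the restriction kills.\<close>

lemma expectation_implemented_by_idempotents_unique:
  assumes Q: "conditional_expectation fun_scale (convolution G E q) A B Q"
    and impl: "implemented_by_idempotents (convolution G E q) A B Q" and f: "f \<in> A"
  shows "Q f = diagonal_restriction G E q f"
proof -
  have QB: "\<And>a. a \<in> A \<Longrightarrow> Q a \<in> B" and Qadd: "\<And>a b. a \<in> A \<Longrightarrow> b \<in> A \<Longrightarrow> Q (a + b) = Q a + Q b"
    and Qscale: "\<And>t a. a \<in> A \<Longrightarrow> Q (fun_scale t a) = fun_scale t (Q a)"
    and Qid: "\<And>b. b \<in> B \<Longrightarrow> Q b = b"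
    using Q unfolding conditional_expectation_def by blast+
  define N where "N = arrows G - units G"
  have N: "openin (gtop G) N" "closedin (gtop G) N"
    using openin_diff [OF openin_topspace base.closedin_units [OF Hausdorff]]
      closedin_diff [OF closedin_topspace base.openin_units] by (simp_all add: N_def)
  have zero: "Q (lift_indicator S) = 0" if S: "twist_bisection S" "S \<subseteq> preimage E q N" for S
  proof
    fix \<sigma>
    note h = equivariant_lift_indicator [OF S(1)] lift_indicator_fibre_finite [OF S(1)]
    obtain e where e: "e \<in> B" "Q (lift_indicator S) = lift_indicator S \<star> e"
      using impl lift_indicator_normaliser [OF S(1)]
      unfolding implemented_by_idempotents_def idempotents_def by blast
    have "Q (lift_indicator S) \<sigma> = 0"
    proof (rule ccontr)
      assume nz: "Q (lift_indicator S) \<sigma> \<noteq> 0"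
      then have \<sigma>: "\<sigma> \<in> arrows E"
        unfolding e(2) using convolution_outside by blast
      have "lift_indicator S \<sigma> \<noteq> 0"
        using nz convolution_diagonal_right [OF h e(1) \<sigma>] e(2) by auto
      then have "q \<sigma> \<in> q ` S"
        using lift_indicator_eq_0 [OF S(1), of \<sigma>] by argo
      then have "q \<sigma> \<in> N"
        using S(2) by (auto simp: preimage_def)
      moreover have "q \<sigma> \<in> units G"
        using diagonal_over_units [OF QB [OF lift_indicator_steinberg [OF S(1)]] nz] .
      ultimately show False by (simp add: N_def)
    qed
    then show "Q (lift_indicator S) \<sigma> = 0 \<sigma>" by simp
  qed
  let ?P = "diagonal_restriction G E q f" and ?d = "restrict_over N f"
  have PB: "?P \<in> B"
    by (rule diagonal_restriction_diagonal [OF f])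
  have d: "?d \<in> A"
    by (rule restrict_over_steinberg [OF f N])
  have split: "f = ?P + ?d"
  proof
    fix \<sigma>
    show "f \<sigma> = (?P + ?d) \<sigma>"
      using equivariant_outside [OF steinberg_equivariant [OF f], of \<sigma>]
      by (cases "\<sigma> \<in> arrows E") (auto simp: diagonal_restriction_def restrict_over_def preimage_def N_def)
  qed
  let ?K = "{g \<in> A. Q g = 0}"
  have "fun_module.subspace ?K"
  proof (rule fun_module.subspaceI)
    show "0 \<in> ?K"
      using fun_module.subspace_0 [OF subspace_diagonal] fun_module.subspace_0 [OF subspace_steinberg] Qid
      by simp
    show "g + h \<in> ?K" if "g \<in> ?K" "h \<in> ?K" for g h
      using that Qadd steinberg_add by simp
    show "fun_scale c g \<in> ?K" if "g \<in> ?K" for c g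
      using that Qscale steinberg_scale by simp
  qed
  then have "fun_module.span (lift_indicator ` {S. twist_bisection S \<and> S \<subseteq> preimage E q N}) \<subseteq> ?K"
    using zero lift_indicator_steinberg by (intro fun_module.span_minimal) auto
  moreover have "?d \<in> fun_module.span (lift_indicator ` {S. twist_bisection S \<and> S \<subseteq> preimage E q N})"
  proof (rule steinberg_in_span [OF d openin_q_preimage [OF N(1)]])
    show "q ` supp E ?d \<subseteq> q ` preimage E q N"
      by (intro image_mono) (auto simp: supp_def restrict_over_def)
  qed
  ultimately have "Q ?d = 0" by blast
  then have "Q (?P + ?d) = ?P"
    using Qadd [OF diagonal_steinberg [OF PB] d] Qid [OF PB] by simp
  then show ?thesis
    using split by simp
qed


section \<open>The local bisection hypothesis\<close>

text \<open>Let \<open>e\<close> implement the restriction of \<open>n\<close>. From \<open>n u = n u * e u \<noteq> 0\<close> the idempotent \<open>e\<close> does not vanish at \<open>u\<close>; as the ring is indecomposable,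
  \<open>e u = 1\<close>. Hence the restriction of \<open>n\<close> agrees with \<open>n\<close> on the arrows that start or end at \<open>u\<close>.\<close>

lemma implemented_expectation_at_normaliser:
  assumes impl: "implemented_by_idempotents (convolution G E q) A B (diagonal_restriction G E q)"
    and indecomposable: "indecomposable_ring TYPE('r)"
    and n: "n \<in> normalisers (convolution G E q) A B"
    and u: "u \<in> units E" "n u \<noteq> 0" and \<rho>: "\<rho> \<in> arrows E" "n \<rho> \<noteq> 0"
    and ends: "rng E \<rho> = u \<or> src E \<rho> = u"
  shows "q \<rho> \<in> units G"
proof -
  have nA: "n \<in> A"
    using n normalisers_steinberg by blast
  obtain e where e: "e \<in> idempotents (convolution G E q) B"
    "diagonal_restriction G E q n = n \<star> e" "n \<star> e = e \<star> n"
    using impl n unfolding implemented_by_idempotents_def by blast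
  have eB: "e \<in> B"
    using e(1) by (simp add: idempotents_def)
  have uE: "u \<in> arrows E"
    by (rule total.units_arrows [OF u(1)])
  have right: "diagonal_restriction G E q n \<sigma> = n \<sigma> * e (src E \<sigma>)"
    and left: "diagonal_restriction G E q n \<sigma> = e (rng E \<sigma>) * n \<sigma>" if "\<sigma> \<in> arrows E" for \<sigma>
    using convolution_diagonal_right [OF steinberg_equivariant [OF nA] steinberg_fibre_finite [OF nA] eB that]
      convolution_diagonal_left [OF eB steinberg_equivariant [OF nA] that] e by simp_all
  have "n u = n u * e u"
    using right [OF uE] diagonal_restriction_over_units [OF uE q_in_units [OF u(1)]] total.src_unit [OF u(1)]
    by simp
  then have "e u \<noteq> 0"
    using u(2) by auto
  then have "e u = 1"
    using idempotent_value [OF e(1) u(1) indecomposable] by blast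
  then have "diagonal_restriction G E q n \<rho> = n \<rho>"
    using ends right [OF \<rho>(1)] left [OF \<rho>(1)] by auto
  then show ?thesis
    using \<rho>(2) diagonal_restriction_off_units by metis
qed

text \<open>Let \<open>n\<close> be non-zero at \<open>\<sigma>\<close> and \<open>\<tau>\<close> with equal ranges, and translate \<open>n\<close> by a normaliser
  over a bisection through \<open>\<sigma>\<close>. The resulting normaliser is non-zero at the unit \<open>\<sigma>\<^sup>-\<^sup>1 \<sigma>\<close> and at
  \<open>\<sigma>\<^sup>-\<^sup>1 \<tau>\<close>, which ends there; so \<open>\<sigma>\<^sup>-\<^sup>1 \<tau>\<close> lies over a unit. Equal sources are treated by
  translating on the other side.\<close>

lemma normaliser_support_bisection:
  assumes impl: "implemented_by_idempotents (convolution G E q) A B (diagonal_restriction G E q)"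
    and indecomposable: "indecomposable_ring TYPE('r)"
    and n: "n \<in> normalisers (convolution G E q) A B"
  shows "bisection G (q ` supp E n)"
proof -
  interpret A: r_algebra fun_scale "convolution G E q" A
    by (rule r_algebra_steinberg)
  have nA: "n \<in> A"
    using n normalisers_steinberg by blast
  note ne = steinberg_equivariant [OF nA] and nf = steinberg_fibre_finite [OF nA]
  have sub: "B \<subseteq> A"
    using diagonal_steinberg by blast
  note mult = A.normalisers_mult [OF local_units_diagonal sub diagonal_commute]
  have lift: "\<exists>S. twist_bisection S \<and> \<sigma> \<in> S" if "\<sigma> \<in> arrows E" for \<sigma>
    using twist_bisection_exists [of "arrows E" \<sigma>] that openin_topspace [of "gtop E"] by auto
  show ?thesis
  proof (rule base.open_bisectionI)
    show "openin (gtop G) (q ` supp E n)"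
      by (rule openin_q_supp [OF steinberg_locally_constant [OF nA]])
    show "inj_on (rng G) (q ` supp E n)"
    proof (rule inj_onI)
      fix \<alpha> \<beta> assume "\<alpha> \<in> q ` supp E n" "\<beta> \<in> q ` supp E n" and r: "rng G \<alpha> = rng G \<beta>"
      then obtain \<sigma> \<tau> where \<sigma>: "\<sigma> \<in> arrows E" "n \<sigma> \<noteq> 0" "\<alpha> = q \<sigma>"
        and \<tau>: "\<tau> \<in> arrows E" "n \<tau> \<noteq> 0" "\<beta> = q \<tau>"
        by (auto simp: supp_def)
      have rE: "rng E \<sigma> = rng E \<tau>"
        using rng_eq_iff [OF \<sigma>(1) \<tau>(1)] r \<sigma>(3) \<tau>(3) by simp
      obtain S where S: "twist_bisection S" "\<sigma> \<in> S"
        using lift \<sigma>(1) by blast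
      let ?m = "lift_indicator (ginv E ` S) \<star> n" and ?\<rho> = "gcomp E (ginv E \<sigma>) \<tau>"
      have \<rho>: "?\<rho> \<in> arrows E" "rng E ?\<rho> = src E \<sigma>"
        using \<sigma>(1) \<tau>(1) rE by simp_all
      have "?m (src E \<sigma>) = n (gcomp E \<sigma> (src E \<sigma>))"
        using \<sigma>(1) by (intro convolution_inverse_indicator_left [OF S(1) _ S(2) ne]) simp_all
      then have m\<sigma>: "?m (src E \<sigma>) \<noteq> 0"
        using \<sigma> by simp
      have "?m ?\<rho> = n (gcomp E \<sigma> ?\<rho>)"
        using \<rho> by (intro convolution_inverse_indicator_left [OF S(1) _ S(2) ne]) simp_all
      then have m\<rho>: "?m ?\<rho> \<noteq> 0"
        using \<sigma>(1) \<tau> rE by simp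
      have "?m \<in> normalisers (convolution G E q) A B"
        by (rule mult [OF _ _ lift_indicator_normaliser [OF twist_bisection_inverse [OF S(1)]] n])
      from implemented_expectation_at_normaliser [OF impl indecomposable this total.src_in_units [OF \<sigma>(1)]
          m\<sigma> \<rho>(1) m\<rho>] \<rho>(2)
      have "q ?\<rho> \<in> units G" by blast
      then have "gcomp G (ginv G \<alpha>) \<beta> \<in> units G"
        using \<sigma>(1,3) \<tau>(1,3) rE by simp
      then show "\<alpha> = \<beta>"
        using base.inv_product_unit_iff [OF _ _ r] \<sigma>(1,3) \<tau>(1,3) by simp
    qed
    show "inj_on (src G) (q ` supp E n)"
    proof (rule inj_onI)
      fix \<alpha> \<beta> assume "\<alpha> \<in> q ` supp E n" "\<beta> \<in> q ` supp E n" and s: "src G \<alpha> = src G \<beta>"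
      then obtain \<sigma> \<tau> where \<sigma>: "\<sigma> \<in> arrows E" "n \<sigma> \<noteq> 0" "\<alpha> = q \<sigma>"
        and \<tau>: "\<tau> \<in> arrows E" "n \<tau> \<noteq> 0" "\<beta> = q \<tau>"
        by (auto simp: supp_def)
      have sE: "src E \<sigma> = src E \<tau>"
        using src_eq_iff [OF \<sigma>(1) \<tau>(1)] s \<sigma>(3) \<tau>(3) by simp
      obtain S where S: "twist_bisection S" "\<sigma> \<in> S"
        using lift \<sigma>(1) by blast
      let ?m = "n \<star> lift_indicator (ginv E ` S)" and ?\<rho> = "gcomp E \<tau> (ginv E \<sigma>)"
      have \<rho>: "?\<rho> \<in> arrows E" "src E ?\<rho> = rng E \<sigma>"
        using \<sigma>(1) \<tau>(1) sE by simp_all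
      have "?m (rng E \<sigma>) = n (gcomp E (rng E \<sigma>) \<sigma>)"
        using \<sigma>(1) by (intro convolution_inverse_indicator_right [OF S(1) _ S(2) ne nf]) simp_all
      then have m\<sigma>: "?m (rng E \<sigma>) \<noteq> 0"
        using \<sigma> by simp
      have "?m ?\<rho> = n (gcomp E ?\<rho> \<sigma>)"
        using \<rho> by (intro convolution_inverse_indicator_right [OF S(1) _ S(2) ne nf]) simp_all
      then have m\<rho>: "?m ?\<rho> \<noteq> 0"
        using \<sigma>(1) \<tau> sE by simp
      have "?m \<in> normalisers (convolution G E q) A B"
        by (rule mult [OF _ _ n lift_indicator_normaliser [OF twist_bisection_inverse [OF S(1)]]])
      from implemented_expectation_at_normaliser [OF impl indecomposable this total.rng_in_units [OF \<sigma>(1)]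
          m\<sigma> \<rho>(1) m\<rho>] \<rho>(2)
      have "q ?\<rho> \<in> units G" by blast
      then have "gcomp G \<beta> (ginv G \<alpha>) \<in> units G"
        using \<sigma>(1,3) \<tau>(1,3) sE by simp
      then show "\<alpha> = \<beta>"
        using base.product_inv_unit_iff [OF _ _ s [symmetric]] \<sigma>(1,3) \<tau>(1,3) by simp
    qed
  qed
qed

text \<open>If the support \<open>D\<close> of \<open>n\<close> is a bisection, cutting \<open>n\<close> down to ranges or sources in
  \<open>K = D \<inter> units G\<close> leaves only units: an arrow of \<open>D\<close> whose range or source lies in \<open>D\<close> coincides
  with that unit by injectivity.\<close>

lemma implemented_by_idempotents_if_local_bisection:
  assumes lbh: "local_bisection_hypothesis G E i q"
  shows "implemented_by_idempotents (convolution G E q) A B (diagonal_restriction G E q)"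
  unfolding implemented_by_idempotents_def
proof
  fix n assume n: "n \<in> normalisers (convolution G E q) A B"
  then have nA: "n \<in> A"
    using normalisers_steinberg by blast
  define D where "D = q ` supp E n"
  have "bisection G D"
    using lbh n unfolding local_bisection_hypothesis_def D_def by blast
  then have inj: "inj_on (rng G) D" "inj_on (src G) D"
    using base.bisection_inj by blast+
  define K where "K = units G \<inter> D"
  have D: "openin (gtop G) D" "compactin (gtop G) D"
    unfolding D_def by (rule openin_q_supp [OF steinberg_locally_constant [OF nA]]) (rule steinberg_compact [OF nA])
  obtain e where e: "e \<in> idempotents (convolution G E q) B"
    "\<And>u. u \<in> units E \<Longrightarrow> e u = (if q u \<in> K then 1 else 0)"
  proof (rule unit_indicator)
    show "openin (gtop G) K"
      unfolding K_def by (rule openin_Int [OF base.openin_units D(1)])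
    show "compactin (gtop G) K"
      unfolding K_def by (rule closed_Int_compactin [OF base.closedin_units [OF Hausdorff] D(2)])
    show "K \<subseteq> units G" by (simp add: K_def)
  qed blast
  have eB: "e \<in> B"
    using e(1) by (simp add: idempotents_def)
  have restriction: "(n \<star> e) \<sigma> = diagonal_restriction G E q n \<sigma> \<and> (e \<star> n) \<sigma> = diagonal_restriction G E q n \<sigma>"
    for \<sigma>
  proof (cases "\<sigma> \<in> arrows E")
    case \<sigma>: True
    have ne: "(n \<star> e) \<sigma> = n \<sigma> * (if src G (q \<sigma>) \<in> K then 1 else 0)"
      using convolution_diagonal_right [OF steinberg_equivariant [OF nA] steinberg_fibre_finite [OF nA] eB \<sigma>]
        e(2) [OF total.src_in_units [OF \<sigma>]] \<sigma> by simp
    have en: "(e \<star> n) \<sigma> = (if rng G (q \<sigma>) \<in> K then 1 else 0) * n \<sigma>"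
      using convolution_diagonal_left [OF eB steinberg_equivariant [OF nA] \<sigma>]
        e(2) [OF total.rng_in_units [OF \<sigma>]] \<sigma> by simp
    show ?thesis
    proof (cases "n \<sigma> = 0")
      case True
      then show ?thesis
        using ne en by (simp add: diagonal_restriction_def)
    next
      case False
      then have \<sigma>D: "q \<sigma> \<in> D"
        unfolding D_def using \<sigma> by (intro q_supp_I)
      have "src G (q \<sigma>) \<in> K \<longleftrightarrow> q \<sigma> \<in> units G"
      proof
        assume "src G (q \<sigma>) \<in> K"
        then have "src G (q \<sigma>) = q \<sigma>"
          using inj_onD [OF inj(2), of "src G (q \<sigma>)" "q \<sigma>"] \<sigma>D \<sigma> by (simp add: K_def)
        then show "q \<sigma> \<in> units G"
          using base.src_in_units [OF q_arrows [OF \<sigma>]] by simp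
      next
        assume "q \<sigma> \<in> units G"
        then show "src G (q \<sigma>) \<in> K"
          using base.src_unit \<sigma>D by (simp add: K_def)
      qed
      moreover have "rng G (q \<sigma>) \<in> K \<longleftrightarrow> q \<sigma> \<in> units G"
      proof
        assume "rng G (q \<sigma>) \<in> K"
        then have "rng G (q \<sigma>) = q \<sigma>"
          using inj_onD [OF inj(1), of "rng G (q \<sigma>)" "q \<sigma>"] \<sigma>D \<sigma> by (simp add: K_def)
        then show "q \<sigma> \<in> units G"
          using base.rng_in_units [OF q_arrows [OF \<sigma>]] by simp
      next
        assume "q \<sigma> \<in> units G"
        then show "rng G (q \<sigma>) \<in> K"
          using base.rng_unit \<sigma>D by (simp add: K_def)
      qed
      ultimately show ?thesis
        using ne en \<sigma> by (simp add: diagonal_restriction_def preimage_def)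
    qed
  next
    case False
    then show ?thesis by (simp add: diagonal_restriction_outside)
  qed
  have "diagonal_restriction G E q n = n \<star> e" "n \<star> e = e \<star> n"
    using restriction by (simp_all add: fun_eq_iff)
  with e(1) show "\<exists>e\<in>idempotents (convolution G E q) B.
      diagonal_restriction G E q n = n \<star> e \<and> n \<star> e = e \<star> n" by blast
qed

text \<open>A nonzero idempotent of the diagonal takes the value \<open>1\<close> at some unit.\<close>

lemma diagonal_idempotents_torsion_free:
  assumes indecomposable: "indecomposable_ring TYPE('r)"
    and e: "e \<in> idempotents (convolution G E q) B" "e \<noteq> 0" and t: "fun_scale t e = 0"
  shows "t = 0"
proof -
  have eA: "e \<in> A" and eB: "e \<in> B"
    using e(1) diagonal_steinberg by (auto simp: idempotents_def)
  obtain \<sigma> where \<sigma>: "e \<sigma> \<noteq> 0"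
    using e(2) by (metis ext zero_fun_apply)
  then have \<sigma>E: "\<sigma> \<in> arrows E"
    using equivariant_nonzero_arrows [OF steinberg_equivariant [OF eA]] by blast
  have "(e \<star> e) \<sigma> = e (rng E \<sigma>) * e \<sigma>"
    by (rule convolution_diagonal_left [OF eB steinberg_equivariant [OF eA] \<sigma>E])
  then have "e (rng E \<sigma>) \<noteq> 0"
    using \<sigma> e(1) by (auto simp: idempotents_def)
  then have "e (rng E \<sigma>) = 1"
    using idempotent_value [OF e(1) total.rng_in_units [OF \<sigma>E] indecomposable] by blast
  moreover have "fun_scale t e (rng E \<sigma>) = 0"
    using t by simp
  ultimately show ?thesis
    by (simp add: fun_scale_def)
qed

lemma quasi_cartan_imp_implemented:
  assumes "algebraic_quasi_cartan_pair fun_scale (convolution G E q) A B"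
  shows "implemented_by_idempotents (convolution G E q) A B (diagonal_restriction G E q)"
proof -
  have "\<exists>Q. conditional_expectation fun_scale (convolution G E q) A B Q \<and>
      faithful_expectation (convolution G E q) A B Q \<and>
      implemented_by_idempotents (convolution G E q) A B Q"
    using assms unfolding algebraic_quasi_cartan_pair_def by (elim conjE)
  then obtain Q where Q: "conditional_expectation fun_scale (convolution G E q) A B Q"
    "implemented_by_idempotents (convolution G E q) A B Q"
    by blast
  have "Q n = diagonal_restriction G E q n" if "n \<in> normalisers (convolution G E q) A B" for n
    using expectation_implemented_by_idempotents_unique [OF Q] that normalisers_steinberg by blast
  then show ?thesis
    using Q(2) unfolding implemented_by_idempotents_def by simp
qed

lemma implemented_imp_quasi_cartan:
  assumes indecomposable: "indecomposable_ring TYPE('r)"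
    and impl: "implemented_by_idempotents (convolution G E q) A B (diagonal_restriction G E q)"
  shows "algebraic_quasi_cartan_pair fun_scale (convolution G E q) A B"
  unfolding algebraic_quasi_cartan_pair_def
proof (intro conjI)
  show "B \<subseteq> A"
    using diagonal_steinberg by blast
  show "\<forall>a\<in>B. \<forall>b\<in>B. a \<star> b = b \<star> a"
    using diagonal_commute by blast
  show "\<forall>t. \<forall>e\<in>idempotents (convolution G E q) B - {0}. fun_scale t e = 0 \<longrightarrow> t = 0"
    using diagonal_idempotents_torsion_free [OF indecomposable] by blast
  show "\<exists>P. conditional_expectation fun_scale (convolution G E q) A B P \<and>
          faithful_expectation (convolution G E q) A B P \<and>
          implemented_by_idempotents (convolution G E q) A B P"
    using conditional_expectation_restriction faithful_expectation_restriction impl by blast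
qed (fact r_algebra_steinberg r_algebra_diagonal local_units_diagonal diagonal_span steinberg_span)+

end

theorem lemma4p2:
  fixes G :: "'g groupoid" and E :: "'s groupoid"
    and i :: "'g \<times> 'r::comm_ring_1 \<Rightarrow> 's" and q :: "'s \<Rightarrow> 'g"
    and A B :: "('s \<Rightarrow> 'r) set"
    and mul :: "('s \<Rightarrow> 'r) \<Rightarrow> ('s \<Rightarrow> 'r) \<Rightarrow> 's \<Rightarrow> 'r"
    and P :: "('s \<Rightarrow> 'r) \<Rightarrow> 's \<Rightarrow> 'r"
  assumes indecomposable: "indecomposable_ring TYPE('r)"
    and ample: "ample_groupoid G"
    and Hausdorff: "Hausdorff_space (gtop G)"
    and twist: "discrete_twist G E i q"
    and A_def: "A = steinberg_algebra G E i q"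
    and B_def: "B = diagonal_subalgebra G E i q"
    and mul_def: "mul = convolution G E q"
    and P_def: "P = diagonal_restriction G E q"
  shows "(local_units mul A (idempotents mul B) \<and>
          B = module.span fun_scale (idempotents mul B) \<and>
          A = module.span fun_scale (normalisers mul A B) \<and>
          conditional_expectation fun_scale mul A B P \<and>
          faithful_expectation mul A B P) \<and>
         (algebraic_quasi_cartan_pair fun_scale mul A B
            \<longrightarrow> implemented_by_idempotents mul A B P) \<and>
         (algebraic_quasi_cartan_pair fun_scale mul A B
            \<longleftrightarrow> local_bisection_hypothesis G E i q)"
proof -
  interpret T: hausdorff_ample_twist G E i q
    using ample Hausdorff twist by (simp add: hausdorff_ample_twist_def hausdorff_ample_twist_axioms_def)
  have lbh: "local_bisection_hypothesis G E i q"
    if "algebraic_quasi_cartan_pair fun_scale (convolution G E q) T.A T.B"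
    unfolding local_bisection_hypothesis_def
    by (intro ballI T.normaliser_support_bisection [OF T.quasi_cartan_imp_implemented [OF that] indecomposable])
  have qcp: "algebraic_quasi_cartan_pair fun_scale (convolution G E q) T.A T.B"
    if "local_bisection_hypothesis G E i q"
    by (rule T.implemented_imp_quasi_cartan
      [OF indecomposable T.implemented_by_idempotents_if_local_bisection [OF that]])
  show ?thesis
    unfolding A_def B_def mul_def P_def
    by (intro conjI) (rule T.local_units_diagonal T.diagonal_span T.steinberg_span
        T.conditional_expectation_restriction T.faithful_expectation_restriction
        impI [OF T.quasi_cartan_imp_implemented] iffI [OF lbh qcp] | assumption)+
qed


end
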